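(* Let $\sigma,\tau\in S_n$ be chosen independently and uniformly at random. Provided $n$ is sufficiently large, the conditional probability that $\sigma$ and $\tau$ are conjugate in $S_n$, given that $\sigma$ and $\tau$ have conjugates that commute, is at least $42/65$. That is, there exists $N$ such that this conditional probability is at least $42/65$ for all $n\ge N$.
   Context: $S_n$ is the symmetric group of degree $n$. Permutations $\sigma,\tau\in S_n$ have conjugates that commute if some conjugate of $\sigma$ in $S_n$ commutes with some conjugate of $\tau$ in $S_n$. *)

theory Defs
  imports "HOL-Algebra.Sym_Groups" "HOL-Probability.Probability"
begin

definition conjugate_in :: "('a, 'b) monoid_scheme \<Rightarrow> 'a \<Rightarrow> 'a \<Rightarrow> bool" where
  "conjugate_in G x y \<longleftrightarrow>
     (\<exists>g\<in>carrier G. y = g \<otimes>\<^bsub>G\<^esub> x \<otimes>\<^bsub>G\<^esub> inv\<^bsub>G\<^esub> g)"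

definition have_commuting_conjugates :: "('a, 'b) monoid_scheme \<Rightarrow> 'a \<Rightarrow> 'a \<Rightarrow> bool" where
  "have_commuting_conjugates G x y \<longleftrightarrow>
     (\<exists>x' y'. conjugate_in G x x' \<and> conjugate_in G y y' \<and>
              x' \<otimes>\<^bsub>G\<^esub> y' = y' \<otimes>\<^bsub>G\<^esub> x')"

definition random_perm_pair :: "nat \<Rightarrow> ((nat \<Rightarrow> nat) \<times> (nat \<Rightarrow> nat)) pmf" where
  "random_perm_pair n =
     pair_pmf (pmf_of_set (carrier (sym_group n))) (pmf_of_set (carrier (sym_group n)))"

end

theory Submission
  imports Defs "HOL-Combinatorics.Orbits" "HOL-Real_Asymp.Real_Asymp"
begin

text \<open>
  A uniformly random permutation of \<open>n\<close> points has cycle type \<open>l\<close> (that is, \<open>l a\<close> cycles of length \<open>a\<close>)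
  with probability \<open>w(l) = (\<Prod>a. 1 / (a ^ l a * (l a)!))\<close>. Conjugacy means equality of types, so the
  probability of being conjugate is \<open>\<kappa>(n) = (\<Sum>l. w(l)\<^sup>2)\<close>, which is the \<open>n\<close>-th coefficient of
  \<open>(\<Prod>a. I(x ^ a / a\<^sup>2))\<close> where \<open>I(y) = (\<Sum>c. y ^ c / (c!)\<^sup>2)\<close>. Whether two permutations have commuting
  conjugates depends only on their types \<open>l\<close>, \<open>m\<close>, and since conjugate permutations have commuting conjugates
  the conditional probability is a quotient \<open>\<kappa>(n) / \<rho>(n)\<close>. What is needed is an upper bound for \<open>\<rho>(n)\<close> in
  terms of \<open>\<kappa>(n)\<close>.

  If \<open>\<sigma>\<close> and \<open>\<tau>\<close> commute, the points lying in cycles of length \<open>a\<close> of \<open>\<sigma>\<close> and of length \<open>b\<close> of \<open>\<tau>\<close> form a set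
  invariant under both, so their number is \<open>lcm a b * X a b\<close> for some integer \<open>X a b\<close>. The matrix \<open>X\<close>
  determines both types, and \<open>\<rho>(n)\<close> is at most the sum of \<open>w(l) w(m)\<close> over all matrices of total size \<open>n\<close>
  (\<open>commuting_block_matrix\<close>, \<open>rho_bound_le_matrix_sum\<close>). Replacing \<open>1 / (\<Sum>b. k b)!\<close> by \<open>(\<Prod>b. 1 / (k b)!)\<close>
  makes the weight of a matrix multiplicative in its entries, so that the sum becomes a coefficient of a
  product of power series. Used for all rows and columns this is too lossy: the constant comes out larger
  than 65/42. The loss is concentrated at the cycles of length 1 and 2. The factorials of the numbers of fixed
  points are therefore kept exactly, as is the part of the factorials of the numbers of 2-cycles that comes
  from the blocks of types \<open>(2,2)\<close>, \<open>(1,2)\<close>, \<open>(2,1)\<close>. Moreover, a block of type \<open>(1,2)\<close> together with one of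
  type \<open>(2,1)\<close> may be exchanged for two blocks of type \<open>(1,1)\<close> and one of type \<open>(2,2)\<close>, so that \<open>X 1 2\<close> and
  \<open>X 2 1\<close> may be assumed not both positive. The outcome is \<open>rho_bound_le\<close>: \<open>\<rho>\<close> is majorised by a
  convolution \<open>core * off_diagonal * diag\<close>, where \<open>diag\<close> comes from the diagonal entries \<open>X a a\<close> with
  \<open>a \<ge> 3\<close> and is also a factor of the series of \<open>\<kappa>\<close>, namely \<open>\<kappa> = I(x) * I(x\<^sup>2 / 4) * diag\<close>.

  The coefficients of \<open>diag\<close> satisfy \<open>n\<^sup>2 diag(n) \<longlonglongrightarrow> (\<Sum>n. diag n)\<close> (\<open>diag_tendsto\<close>): typically one cycle
  carries almost all points, and both permutations have it. The coefficients of the other factors are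
  \<open>o(1 / n\<^sup>2)\<close>, and convolution with such a series only multiplies the limit by the value of the series at
  1 (\<open>convolution_tendsto\<close>). Thus the common limit of \<open>diag\<close> cancels, and the limit inferior of
  \<open>\<kappa>(n) / \<rho>(n)\<close> is at least \<open>I(1) I(1/4)\<close> divided by the product of the values of \<open>core\<close> and \<open>off_diagonal\<close> at 1. These
  are at most \<open>1.373 I(1) I(1/4)\<close> (\<open>core_series_total\<close>) and \<open>exp 0.116\<close> (\<open>sum_block_coeff\<close>), and
  \<open>1.373 * exp 0.116 < 65 / 42\<close>.
\<close>

section \<open>Cycle lengths and cycle types\<close>

definition cycle_length :: "('a \<Rightarrow> 'a) \<Rightarrow> 'a \<Rightarrow> nat" where
  "cycle_length p x = card (Orbits.orbit p x)"

text \<open>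
  The cycles of length \<open>a\<close> are counted by the points on them. The division is exact
  (\<open>card_points_of_length\<close>), and the value at \<open>a = 0\<close> is 0.
\<close>

definition cycle_type :: "'a set \<Rightarrow> ('a \<Rightarrow> 'a) \<Rightarrow> nat \<Rightarrow> nat" where
  "cycle_type A p a = card {x\<in>A. cycle_length p x = a} div a"

lemma orbit_eq:
  assumes "permutation p" "y \<in> Orbits.orbit p x"
  shows "Orbits.orbit p y = Orbits.orbit p x"
  using cyclic_on_orbit'[OF assms(1)] assms(2) by (rule orbit_cyclic_eq3)

lemma cycle_length_pos:
  assumes "permutation p"
  shows "cycle_length p x > 0"
  using assms unfolding cycle_length_def
  by (metis card_gt_0_iff finite_orbit orbit_nonempty permutation_self_in_orbit)

lemma cycle_length_apply:
  assumes "permutation p"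
  shows "cycle_length p (p x) = cycle_length p x"
  unfolding cycle_length_def using assms by (simp add: permutation_orbit_step)

lemma orbit_subset_invariant:
  assumes "\<And>x. x \<in> A \<Longrightarrow> p x \<in> A" "x \<in> A"
  shows "Orbits.orbit p x \<subseteq> A"
proof
  fix y assume "y \<in> Orbits.orbit p x"
  then show "y \<in> A" by induct (auto simp: assms)
qed

text \<open>
  The invariant set \<open>A\<close> is a disjoint union of cycles, all of them of size \<open>a\<close>.
\<close>

lemma dvd_card_invariant:
  assumes p: "permutation p" and A: "finite A" "\<And>x. x \<in> A \<Longrightarrow> p x \<in> A"
    and len: "\<And>x. x \<in> A \<Longrightarrow> cycle_length p x = a"
  shows "a dvd card A"
proof -
  have *: "\<Union> (Orbits.orbit p ` A) = A"
    using orbit_subset_invariant[of A p] A(2) permutation_self_in_orbit[OF p] by blast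
  have "a dvd card (\<Union> (Orbits.orbit p ` A))"
  proof (rule dvd_partition)
    show "finite (\<Union> (Orbits.orbit p ` A))" unfolding * by (rule A)
    show "\<forall>c\<in>Orbits.orbit p ` A. a dvd card c"
      using len by (auto simp: cycle_length_def)
    show "\<forall>c1\<in>Orbits.orbit p ` A. \<forall>c2\<in>Orbits.orbit p ` A. c1 \<noteq> c2 \<longrightarrow> c1 \<inter> c2 = {}"
      using orbit_eq[OF p] by (auto; blast)
  qed
  then show ?thesis unfolding * .
qed

lemma card_points_of_length:
  assumes p: "permutation p" and A: "finite A" "\<And>x. x \<in> A \<Longrightarrow> p x \<in> A"
  shows "card {x\<in>A. cycle_length p x = a} = a * cycle_type A p a"
proof -
  have "a dvd card {x\<in>A. cycle_length p x = a}"
    by (rule dvd_card_invariant[OF p]) (use A cycle_length_apply[OF p] in auto)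
  then show ?thesis by (simp add: cycle_type_def)
qed

text \<open>
  The possible cycle types of a permutation of \<open>n\<close> points; a type vanishes outside \<open>{1..n}\<close>, so that equality
  of types is equality of functions.
\<close>

definition is_type :: "nat \<Rightarrow> (nat \<Rightarrow> nat) \<Rightarrow> bool" where
  "is_type n l \<longleftrightarrow> (\<forall>a. a \<notin> {1..n} \<longrightarrow> l a = 0) \<and> (\<Sum>a=1..n. a * l a) = n"

lemma cycle_length_le_card:
  assumes "finite A" "\<And>x. x \<in> A \<Longrightarrow> p x \<in> A" "x \<in> A"
  shows "cycle_length p x \<le> card A"
  unfolding cycle_length_def using orbit_subset_invariant[of A p x] assms by (intro card_mono) auto

lemma is_type_cycle_type:
  assumes p: "permutation p" and A: "finite A" "\<And>x. x \<in> A \<Longrightarrow> p x \<in> A"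
  shows "is_type (card A) (cycle_type A p)"
  unfolding is_type_def
proof (intro conjI allI impI)
  fix a assume "a \<notin> {1..card A}"
  then have "cycle_length p x \<noteq> a" if "x \<in> A" for x
    using cycle_length_le_card[of A p x] A that cycle_length_pos[OF p, of x] by (auto simp: Suc_le_eq)
  then have "{x\<in>A. cycle_length p x = a} = {}" by blast
  then show "cycle_type A p a = 0" by (simp only: cycle_type_def card.empty div_0)
next
  have "card A = card (\<Union>a\<in>{1..card A}. {x\<in>A. cycle_length p x = a})"
    using cycle_length_le_card[of A p] A cycle_length_pos[OF p]
    by (intro arg_cong[where f = card]) (auto simp: Suc_le_eq)
  also have "\<dots> = (\<Sum>a=1..card A. card {x\<in>A. cycle_length p x = a})"
    using A by (intro card_UN_disjoint) auto
  finally show "(\<Sum>a=1..card A. a * cycle_type A p a) = card A"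
    using card_points_of_length[OF p A] by simp
qed

section \<open>The number of permutations of a given cycle type\<close>

text \<open>
  Every permutation of \<open>insert x A\<close> arises once from a permutation \<open>p\<close> of \<open>A\<close> by inserting \<open>x\<close> in front of a
  point \<open>b\<close> of a cycle, or as a new fixed point. The insertion lengthens the cycle of \<open>b\<close> by one point and leaves
  the other cycles alone.
\<close>

lemma orbit_insert_point:
  assumes p: "p permutes A" and A: "finite A" and x: "x \<notin> A" and b: "b \<in> A"
  defines "q \<equiv> Transposition.transpose x b \<circ> p"
  shows "y \<in> insert x (Orbits.orbit p b) \<Longrightarrow> Orbits.orbit q y = insert x (Orbits.orbit p b)"
    and "y \<in> A \<Longrightarrow> y \<notin> Orbits.orbit p b \<Longrightarrow> Orbits.orbit q y = Orbits.orbit p y"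
proof -
  have pp: "permutation p" using p A by (auto simp: permutation_permutes)
  have "q permutes insert x A"
    unfolding q_def by (intro permutes_compose permutes_subset[OF p] permutes_swap_id) (use b in auto)
  then have qp: "permutation q" using A by (auto simp: permutation_permutes)
  have px: "p x = x" using p x by (simp add: permutes_not_in)
  have qx: "q x = b" by (simp add: q_def px)
  have qA: "q y = (if p y = b then x else p y)" if "y \<in> A" for y
  proof -
    have "p y \<noteq> x" using permutes_in_image[OF p] that x by metis
    then show ?thesis by (auto simp: q_def Transposition.transpose_def)
  qed
  have sub: "Orbits.orbit p b \<subseteq> A" by (rule permutes_orbit_subset[OF p b])
  have self: "b \<in> Orbits.orbit p b" by (rule permutation_self_in_orbit[OF pp])
  have bq: "b \<in> Orbits.orbit q b" by (rule permutation_self_in_orbit[OF qp])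
  have 1: "z \<in> Orbits.orbit q b" if "z \<in> Orbits.orbit p b" for z
    using that
  proof induct
    case base
    then show ?case using qA[OF b] bq orbit.base[of q b] by (auto split: if_splits)
  next
    case (step y)
    then have "y \<in> A" using sub by auto
    then show ?case using qA[of y] bq orbit.step[OF step(2)] by (auto split: if_splits)
  qed
  have "Hilbert_Choice.inv p b \<in> Orbits.orbit p b"
    using orbit_inv_eq[OF pp, of b] orbit.base[of "Hilbert_Choice.inv p" b] by simp
  moreover have "p (Hilbert_Choice.inv p b) = b" using p by (simp add: permutes_inverses)
  ultimately have "q (Hilbert_Choice.inv p b) = x" using qA[of "Hilbert_Choice.inv p b"] sub by auto
  then have 2: "x \<in> Orbits.orbit q b"
    using orbit.step[OF 1[OF \<open>Hilbert_Choice.inv p b \<in> Orbits.orbit p b\<close>]] by simp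
  have "Orbits.orbit q b \<subseteq> insert x (Orbits.orbit p b)"
  proof (rule orbit_subset_invariant)
    fix y assume "y \<in> insert x (Orbits.orbit p b)"
    then consider "y = x" | "y \<in> Orbits.orbit p b" "y \<in> A" using sub by auto
    then show "q y \<in> insert x (Orbits.orbit p b)"
      by cases (simp_all add: qx qA self orbit.step)
  qed (use self in auto)
  with 1 2 have eq: "Orbits.orbit q b = insert x (Orbits.orbit p b)" by auto
  show "y \<in> insert x (Orbits.orbit p b) \<Longrightarrow> Orbits.orbit q y = insert x (Orbits.orbit p b)"
    using orbit_eq[OF qp, of y b] eq by simp
  assume y: "y \<in> A" "y \<notin> Orbits.orbit p b"
  show "Orbits.orbit q y = Orbits.orbit p y"
  proof (rule orbit_cong)
    show "y \<in> Orbits.orbit p y" by (rule permutation_self_in_orbit[OF pp])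
    fix z assume z: "z \<in> Orbits.orbit p y"
    have "z \<in> A" using permutes_orbit_subset[OF p y(1)] z by auto
    moreover have "p z \<noteq> b"
    proof
      assume "p z = b"
      then have "b \<in> Orbits.orbit p y" using orbit.step[OF z] by simp
      then show False using orbit_eq[OF pp, of b y] y(2) permutation_self_in_orbit[OF pp, of y] by simp
    qed
    ultimately show "q z = p z" using qA by simp
  qed
qed

lemma cycle_type_insert_point:
  assumes p: "p permutes A" and A: "finite A" and x: "x \<notin> A" and b: "b \<in> A"
    and k: "k = cycle_length p b"
  shows "cycle_type (insert x A) (Transposition.transpose x b \<circ> p) =
    (cycle_type A p)(k := cycle_type A p k - 1, Suc k := Suc (cycle_type A p (Suc k)))"
proof
  fix a
  have pp: "permutation p" using p A by (auto simp: permutation_permutes)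
  have inv: "\<And>x. x \<in> A \<Longrightarrow> p x \<in> A" using permutes_in_image[OF p] by simp
  have sub: "Orbits.orbit p b \<subseteq> A" by (rule permutes_orbit_subset[OF p b])
  have fin: "finite (Orbits.orbit p b)" using sub A finite_subset by auto
  have kpos: "k > 0" using cycle_length_pos[OF pp] k by simp
  let ?q = "Transposition.transpose x b \<circ> p"
  have len_in: "cycle_length ?q y = Suc k" if "y \<in> insert x (Orbits.orbit p b)" for y
    using orbit_insert_point(1)[OF p A x b that] fin sub x k
    by (simp add: cycle_length_def subset_iff card_insert_if) blast
  have len_out: "cycle_length ?q y = cycle_length p y" if "y \<in> A" "y \<notin> Orbits.orbit p b" for y
    using orbit_insert_point(2)[OF p A x b that] by (simp add: cycle_length_def)
  have len_p: "cycle_length p y = k" if "y \<in> Orbits.orbit p b" for y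
    using orbit_eq[OF pp that] k by (simp add: cycle_length_def)
  let ?N = "\<lambda>a. {y\<in>A. cycle_length p y = a}"
  have N: "card (?N a) = a * cycle_type A p a" for a
    by (rule card_points_of_length[OF pp A inv])
  have set: "{y\<in>insert x A. cycle_length ?q y = a} =
     (?N a - Orbits.orbit p b) \<union> (if a = Suc k then insert x (Orbits.orbit p b) else {})"
  proof (rule Set.set_eqI)
    fix y
    show "y \<in> {y\<in>insert x A. cycle_length ?q y = a} \<longleftrightarrow>
      y \<in> (?N a - Orbits.orbit p b) \<union> (if a = Suc k then insert x (Orbits.orbit p b) else {})"
      using len_in[of y] len_out[of y] sub x by (cases "y \<in> insert x (Orbits.orbit p b)") auto
  qed
  show "cycle_type (insert x A) ?q a =
    ((cycle_type A p)(k := cycle_type A p k - 1, Suc k := Suc (cycle_type A p (Suc k)))) a"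
  proof -
    consider "a = k" | "a = Suc k" | "a \<noteq> k" "a \<noteq> Suc k" by blast
    then show ?thesis
    proof cases
      case 1
      have "card (?N k - Orbits.orbit p b) = card (?N k) - k"
        using len_p sub fin k by (subst card_Diff_subset) (auto simp: cycle_length_def)
      also have "\<dots> = k * (cycle_type A p k - 1)" using N by (simp add: diff_mult_distrib2)
      finally show ?thesis using 1 set kpos by (simp add: cycle_type_def[of "insert x A"])
    next
      case 2
      have "?N (Suc k) - Orbits.orbit p b = ?N (Suc k)" using len_p by auto
      then have "card {y\<in>insert x A. cycle_length ?q y = a} = card (?N (Suc k) \<union> insert x (Orbits.orbit p b))"
        using set 2 by simp
      also have "\<dots> = card (?N (Suc k)) + card (insert x (Orbits.orbit p b))"
        using A fin len_p x by (intro card_Un_disjoint) auto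
      also have "card (insert x (Orbits.orbit p b)) = Suc k"
        using fin sub x k by (auto simp: cycle_length_def subset_iff card_insert_if)
      finally have "card {y\<in>insert x A. cycle_length ?q y = a} = Suc k * Suc (cycle_type A p (Suc k))"
        by (simp only: N mult_Suc_right add.commute)
      then have "cycle_type (insert x A) ?q a = Suc k * Suc (cycle_type A p (Suc k)) div Suc k"
        unfolding cycle_type_def[of "insert x A"] 2 by (simp only:)
      also have "\<dots> = Suc (cycle_type A p (Suc k))" by (rule nonzero_mult_div_cancel_left) simp
      finally show ?thesis using 2 by simp
    next
      case 3
      then have "{y\<in>insert x A. cycle_length ?q y = a} = ?N a" using set len_p by auto
      then show ?thesis using 3 by (simp add: cycle_type_def)
    qed
  qed
qed

lemma cycle_type_insert_fixed_point:
  assumes p: "p permutes A" and A: "finite A" and x: "x \<notin> A"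
  shows "cycle_type (insert x A) p = (cycle_type A p)(1 := Suc (cycle_type A p 1))"
proof
  fix a
  have "Orbits.orbit p x = {x}"
    using p x by (simp add: orbit_eq_singleton_iff permutes_not_in)
  then have "cycle_length p x = 1" by (simp add: cycle_length_def)
  then have *: "{y\<in>insert x A. cycle_length p y = a} =
     {y\<in>A. cycle_length p y = a} \<union> (if a = 1 then {x} else {})" by auto
  then show "cycle_type (insert x A) p a = ((cycle_type A p)(1 := Suc (cycle_type A p 1))) a"
    using A x by (cases "a = 1") (simp_all add: cycle_type_def)
qed

text \<open>
  The reciprocal of the order of the centraliser of a permutation of type \<open>l\<close>.
\<close>

definition type_weight :: "nat \<Rightarrow> (nat \<Rightarrow> nat) \<Rightarrow> real" where
  "type_weight n l = (\<Prod>a=1..n. 1 / (real a ^ l a * fact (l a)))"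

lemma type_weight_update:
  assumes "a \<in> {1..n}"
  shows "type_weight n (l(a := c)) * (real a ^ c * fact c) = type_weight n l * (real a ^ l a * fact (l a))"
proof -
  let ?P = "\<lambda>l. \<Prod>b\<in>{1..n}-{a}. 1 / (real b ^ l b * fact (l b))"
  have rem: "type_weight n m = 1 / (real a ^ m a * fact (m a)) * ?P m" for m
    unfolding type_weight_def using assms by (intro prod.remove) auto
  have "?P (l(a := c)) = ?P l" by (intro prod.cong) auto
  then show ?thesis using assms rem[of l] rem[of "l(a := c)"] by simp
qed

lemma type_weight_Suc:
  assumes "is_type n l"
  shows "type_weight (Suc n) l = type_weight n l"
  using assms by (simp add: type_weight_def is_type_def)

lemma type_weight_remove_fixed_point:
  assumes "l 1 > 0" "n \<ge> 1"
  shows "type_weight n (l(1 := l 1 - 1)) = type_weight n l * l 1"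
proof -
  obtain c where c: "l 1 = Suc c" using assms by (cases "l 1") auto
  have "type_weight n (l(1 := c)) * fact c = type_weight n l * (real (Suc c) * fact c)"
    using type_weight_update[of 1 n l c] assms(2) unfolding c fact_Suc by simp
  then have "type_weight n (l(1 := c)) = type_weight n l * real (Suc c)" by simp
  then show ?thesis unfolding c by simp
qed

text \<open>
  In the type \<open>l\<close> one cycle of length \<open>k + 1\<close> is replaced by one of length \<open>k\<close>; \<open>k * Suc (l k)\<close> is the number
  of places at which a point can be inserted to undo this.
\<close>

lemma type_weight_shorten:
  assumes "l (Suc k) > 0" "k \<ge> 1" "Suc k \<le> n"
  shows "type_weight n (l(k := Suc (l k), Suc k := l (Suc k) - 1)) * (k * Suc (l k))
    = type_weight n l * (Suc k * l (Suc k))"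
proof -
  obtain c where c: "l (Suc k) = Suc c" using assms by (cases "l (Suc k)") auto
  let ?l = "l(k := Suc (l k))"
  have "type_weight n (?l(Suc k := c)) * (real (Suc k) ^ c * fact c)
      = type_weight n ?l * (real (Suc k) ^ (Suc c) * fact (Suc c))"
    using type_weight_update[of "Suc k" n ?l c] assms c by simp
  then have 1: "type_weight n (?l(Suc k := c)) = type_weight n ?l * (real (Suc k) * Suc c)"
    by (simp add: field_simps del: of_nat_Suc)
  have "type_weight n ?l * (real k ^ Suc (l k) * fact (Suc (l k))) = type_weight n l * (real k ^ l k * fact (l k))"
    using type_weight_update[of k n l "Suc (l k)"] assms by simp
  then have 2: "type_weight n ?l * (real k * Suc (l k)) = type_weight n l"
    using assms(2) by (simp add: field_simps del: of_nat_Suc)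
  have "type_weight n (?l(Suc k := c)) * (real k * Suc (l k))
      = (type_weight n ?l * (real k * Suc (l k))) * (real (Suc k) * Suc c)"
    unfolding 1 by (simp only: mult_ac)
  then show ?thesis unfolding c diff_Suc_1 2 by (simp only: of_nat_mult)
qed

lemma is_type_remove_fixed_point:
  assumes "is_type (Suc n) l" "l 1 > 0"
  shows "is_type n (l(1 := l 1 - 1))"
proof -
  have s: "(\<Sum>a=1..Suc n. a * l a) = Suc n" and z: "\<And>a. a \<notin> {1..Suc n} \<Longrightarrow> l a = 0"
    using assms by (auto simp: is_type_def)
  have "(\<Sum>a=1..Suc n. a * l a) = l 1 + (\<Sum>a\<in>{1..Suc n}-{1}. a * l a)"
    by (subst sum.remove[of _ 1]) auto
  moreover have "(\<Sum>a=1..Suc n. a * (l(1 := l 1 - 1)) a) = (l 1 - 1) + (\<Sum>a\<in>{1..Suc n}-{1}. a * l a)"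
    by (subst sum.remove[of _ 1]) auto
  ultimately have s2: "(\<Sum>a=1..Suc n. a * (l(1 := l 1 - 1)) a) = n" using s assms(2) by simp
  have "Suc n * (l(1 := l 1 - 1)) (Suc n) \<le> (\<Sum>a=1..Suc n. a * (l(1 := l 1 - 1)) a)"
    by (rule member_le_sum) auto
  then have "(l(1 := l 1 - 1)) (Suc n) = 0" unfolding s2 by (cases "(l(1 := l 1 - 1)) (Suc n)") auto
  with s2 z show ?thesis unfolding is_type_def
    by (auto simp: not_le less_Suc_eq_le le_Suc_eq split: if_splits)
qed

lemma is_type_shorten:
  assumes "is_type (Suc n) l" "l (Suc k) > 0" "k \<ge> 1" "k \<le> n"
  shows "is_type n (l(k := Suc (l k), Suc k := l (Suc k) - 1))"
proof -
  let ?l = "l(k := Suc (l k), Suc k := l (Suc k) - 1)"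
  let ?R = "\<Sum>a\<in>{1..Suc n}-{k}-{Suc k}. a * l a"
  have s: "(\<Sum>a=1..Suc n. a * l a) = Suc n" and z: "\<And>a. a \<notin> {1..Suc n} \<Longrightarrow> l a = 0"
    using assms by (auto simp: is_type_def)
  have rem: "(\<Sum>a=1..Suc n. a * m a) = k * m k + (Suc k * m (Suc k) + (\<Sum>a\<in>{1..Suc n}-{k}-{Suc k}. a * m a))" for m :: "nat \<Rightarrow> nat"
    using assms by (subst sum.remove[of _ k], simp, simp, subst sum.remove[of _ "Suc k"]) auto
  have "(\<Sum>a\<in>{1..Suc n}-{k}-{Suc k}. a * ?l a) = ?R" by (intro sum.cong) auto
  moreover obtain c where c: "l (Suc k) = Suc c" using assms by (cases "l (Suc k)") auto
  ultimately have s2: "(\<Sum>a=1..Suc n. a * ?l a) = n" using s rem[of l] rem[of ?l] by simp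
  have "Suc n * ?l (Suc n) \<le> (\<Sum>a=1..Suc n. a * ?l a)"
    by (rule member_le_sum) auto
  then have "?l (Suc n) = 0" unfolding s2 by (cases "?l (Suc n)") auto
  with s2 z assms(3,4) show ?thesis unfolding is_type_def
    by (auto simp: not_le less_Suc_eq_le le_Suc_eq split: if_splits)
qed

text \<open>
  Induction on \<open>A\<close> by insertion of a point. Up to the common factor \<open>fact (card A) * type_weight (Suc (card A)) l\<close>
  the insertions that create a cycle of length \<open>a\<close> contribute \<open>a * l a\<close>, and these numbers add up to the number of
  points.
\<close>

theorem card_permutations_of_type:
  assumes "finite A" "is_type (card A) l"
  shows "real (card {p. p permutes A \<and> cycle_type A p = l}) = fact (card A) * type_weight (card A) l"
  using assms
proof (induction A arbitrary: l rule: finite_induct)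
  case empty
  then have l: "l = (\<lambda>_. 0)" by (auto simp: is_type_def)
  have "{p. p permutes ({}::'a set) \<and> cycle_type {} p = l} = {id}"
    by (auto simp: l cycle_type_def)
  then show ?case by (simp add: type_weight_def)
next
  case (insert x A)
  let ?n = "card A"
  let ?S = "{p. p permutes A}"
  have fS: "finite ?S" using insert by (simp add: finite_permutations)
  have n: "card (insert x A) = Suc ?n" using insert by simp
  have l: "is_type (Suc ?n) l" using insert by simp
  let ?W = "type_weight (Suc ?n)"
  let ?c = "\<lambda>m. card {p. p permutes A \<and> cycle_type A p = m}"
  let ?l = "\<lambda>k. l(k := Suc (l k), Suc k := l (Suc k) - 1)"
  have IH: "real (?c m) = fact ?n * ?W m" if "is_type ?n m" for m
    using insert.IH[OF that] type_weight_Suc[OF that] by simp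
  have cardP: "card {p. p permutes B \<and> Q p} = (\<Sum>p | p permutes B. of_bool (Q p))" if "finite B" for B :: "'a set" and Q
    using finite_permutations[OF that] by (simp add: Collect_conj_eq)
  have "card {p. p permutes insert x A \<and> cycle_type (insert x A) p = l}
      = (\<Sum>b\<in>insert x A. \<Sum>p\<in>?S. of_bool (cycle_type (insert x A) (Transposition.transpose x b \<circ> p) = l))"
    using insert by (subst cardP, simp, subst sum_over_permutations_insert) auto
  also have "\<dots> = (\<Sum>p\<in>?S. of_bool (cycle_type (insert x A) p = l))
      + (\<Sum>p\<in>?S. \<Sum>b\<in>A. of_bool (cycle_type (insert x A) (Transposition.transpose x b \<circ> p) = l))"
    unfolding sum.insert[OF insert(1,2)] sum.swap[of _ A] transpose_same id_comp ..
  also have "(\<Sum>p\<in>?S. of_bool (cycle_type (insert x A) p = l)) = of_bool (l 1 > 0) * ?c (l(1 := l 1 - 1))"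
  proof -
    have "(cycle_type (insert x A) p = l) = (l 1 > 0 \<and> cycle_type A p = l(1 := l 1 - 1))" if "p \<in> ?S" for p
      using that insert cycle_type_insert_fixed_point[of p A x] by auto
    then have "(\<Sum>p\<in>?S. of_bool (cycle_type (insert x A) p = l))
       = (\<Sum>p\<in>?S. of_bool (l 1 > 0) * of_bool (cycle_type A p = l(1 := l 1 - 1)) :: nat)"
      by (intro sum.cong) auto
    then show ?thesis using insert by (simp add: cardP sum_distrib_left)
  qed
  also have "(\<Sum>p\<in>?S. \<Sum>b\<in>A. of_bool (cycle_type (insert x A) (Transposition.transpose x b \<circ> p) = l))
     = (\<Sum>k=1..?n. of_bool (l (Suc k) > 0) * (k * Suc (l k)) * ?c (?l k))"
  proof -
    have "(\<Sum>b\<in>A. of_bool (cycle_type (insert x A) (Transposition.transpose x b \<circ> p) = l))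
      = (\<Sum>k=1..?n. of_bool (l (Suc k) > 0) * (k * Suc (l k)) * of_bool (cycle_type A p = ?l k) :: nat)"
      if p: "p permutes A" for p
    proof -
      have pp: "permutation p" using p insert by (auto simp: permutation_permutes)
      have inv: "\<And>x. x \<in> A \<Longrightarrow> p x \<in> A" using permutes_in_image[OF p] by simp
      let ?t = "cycle_type A p"
      let ?Q = "\<lambda>k. ?t(k := ?t k - 1, Suc k := Suc (?t (Suc k))) = l"
      have im: "cycle_length p ` A \<subseteq> {1..?n}"
        using cycle_length_le_card[of A p] cycle_length_pos[OF pp] inv insert by (auto simp: Suc_le_eq)
      have "(\<Sum>b\<in>A. of_bool (cycle_type (insert x A) (Transposition.transpose x b \<circ> p) = l))
         = (\<Sum>b\<in>A. of_bool (?Q (cycle_length p b)) :: nat)"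
        using cycle_type_insert_point[OF p insert(1,2)] by (intro sum.cong) auto
      also have "\<dots> = (\<Sum>k=1..?n. \<Sum>b | b \<in> A \<and> cycle_length p b = k. of_bool (?Q (cycle_length p b)))"
        using im insert by (intro sum.group[symmetric]) auto
      also have "\<dots> = (\<Sum>k=1..?n. k * ?t k * of_bool (?Q k))"
      proof (intro sum.cong refl)
        fix k
        have "(\<Sum>b | b \<in> A \<and> cycle_length p b = k. of_bool (?Q (cycle_length p b)))
          = (\<Sum>b | b \<in> A \<and> cycle_length p b = k. of_bool (?Q k) :: nat)"
          by (intro sum.cong) auto
        also have "\<dots> = k * ?t k * of_bool (?Q k)"
          using card_points_of_length[OF pp insert(1) inv, of k] by simp
        finally show "(\<Sum>b | b \<in> A \<and> cycle_length p b = k. of_bool (?Q (cycle_length p b))) = k * ?t k * of_bool (?Q k)" .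
      qed
      also have "\<dots> = (\<Sum>k=1..?n. of_bool (l (Suc k) > 0) * (k * Suc (l k)) * of_bool (?t = ?l k))"
      proof (intro sum.cong refl)
        fix k
        have *: "(?t k > 0 \<and> ?Q k) = (l (Suc k) > 0 \<and> ?t = ?l k)" by (auto simp: fun_eq_iff)
        show "k * ?t k * of_bool (?Q k) = of_bool (l (Suc k) > 0) * (k * Suc (l k)) * of_bool (?t = ?l k)"
        proof (cases "?t k > 0 \<and> ?Q k")
          case True
          then have "l k = ?t k - 1" by (metis fun_upd_other fun_upd_same n_not_Suc_n)
          then have "?t k = Suc (l k)" using True by simp
          then show ?thesis using True * by simp
        next
          case False
          then show ?thesis using * by auto
        qed
      qed
      finally show ?thesis .
    qed
    then have "(\<Sum>p\<in>?S. \<Sum>b\<in>A. of_bool (cycle_type (insert x A) (Transposition.transpose x b \<circ> p) = l))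
       = (\<Sum>p\<in>?S. \<Sum>k=1..?n. of_bool (l (Suc k) > 0) * (k * Suc (l k)) * of_bool (cycle_type A p = ?l k) :: nat)"
      by (intro sum.cong) auto
    then show ?thesis using insert by (simp only: sum.swap[of _ ?S] cardP sum_distrib_left)
  qed
  finally have count: "card {p. p permutes insert x A \<and> cycle_type (insert x A) p = l}
    = of_bool (l 1 > 0) * ?c (l(1 := l 1 - 1))
     + (\<Sum>k=1..?n. of_bool (l (Suc k) > 0) * (k * Suc (l k)) * ?c (?l k))" .
  have "real (card {p. p permutes insert x A \<and> cycle_type (insert x A) p = l})
    = of_bool (l 1 > 0) * real (?c (l(1 := l 1 - 1)))
     + (\<Sum>k=1..?n. of_bool (l (Suc k) > 0) * (k * Suc (l k)) * real (?c (?l k)))"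
    unfolding count by (simp only: of_nat_add of_nat_mult of_nat_sum of_nat_of_bool)
  also have "of_bool (l 1 > 0) * real (?c (l(1 := l 1 - 1))) = fact ?n * ?W l * l 1"
    using IH[OF is_type_remove_fixed_point[OF l]] type_weight_remove_fixed_point[of l "Suc ?n"] by auto
  also have "(\<Sum>k=1..?n. of_bool (l (Suc k) > 0) * (k * Suc (l k)) * real (?c (?l k)))
    = (\<Sum>k=1..?n. fact ?n * ?W l * (Suc k * l (Suc k)))"
  proof (intro sum.cong refl)
    fix k assume k: "k \<in> {1..?n}"
    show "of_bool (l (Suc k) > 0) * (k * Suc (l k)) * real (?c (?l k)) = fact ?n * ?W l * (Suc k * l (Suc k))"
    proof (cases "l (Suc k) > 0")
      case True
      have "real (?c (?l k)) = fact ?n * ?W (?l k)" using IH[OF is_type_shorten[OF l True]] k by auto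
      moreover have "?W (?l k) * (k * Suc (l k)) = ?W l * (Suc k * l (Suc k))"
        by (rule type_weight_shorten) (use True k in auto)
      ultimately show ?thesis using True by (simp add: mult_ac del: of_nat_Suc of_nat_mult)
    qed auto
  qed
  also have "fact ?n * ?W l * l 1 + (\<Sum>k=1..?n. fact ?n * ?W l * (Suc k * l (Suc k)))
     = fact ?n * ?W l * real (\<Sum>a=1..Suc ?n. a * l a)"
  proof -
    have "(\<Sum>a=1..Suc ?n. a * l a) = l 1 + (\<Sum>k=1..?n. Suc k * l (Suc k))"
      by (subst sum.atLeast_Suc_atMost) (simp_all add: sum.shift_bounds_cl_Suc_ivl del: mult_Suc sum.cl_ivl_Suc)
    then show ?thesis by (simp add: sum_distrib_left ring_distribs del: mult_Suc of_nat_Suc)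
  qed
  also have "(\<Sum>a=1..Suc ?n. a * l a) = Suc ?n" using l by (simp add: is_type_def)
  finally show ?case unfolding n by (simp add: mult_ac)
qed

section \<open>Conjugacy and cycle types\<close>

lemma orbit_conjugate:
  assumes g: "g permutes A" 
  shows "Orbits.orbit (g \<circ> p \<circ> Hilbert_Choice.inv g) (g x) = g ` Orbits.orbit p x"
proof -
  have "((g \<circ> p \<circ> Hilbert_Choice.inv g) ^^ n) (g x) = g ((p ^^ n) x)" for n
    using permutes_inverses(2)[OF g] by (induction n) auto
  then show ?thesis unfolding orbit_altdef by auto
qed

lemma cycle_type_conjugate:
  assumes p: "p permutes A" and g: "g permutes A"
  shows "cycle_type A (g \<circ> p \<circ> Hilbert_Choice.inv g) = cycle_type A p"
proof
  fix a
  let ?q = "g \<circ> p \<circ> Hilbert_Choice.inv g"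
  have inj: "inj g" using permutes_inj[OF g] .
  have len: "cycle_length ?q (g x) = cycle_length p x" for x
    unfolding cycle_length_def orbit_conjugate[OF g] by (rule card_image) (use inj inj_on_subset in auto)
  have "{y\<in>A. cycle_length ?q y = a} = g ` {x\<in>A. cycle_length p x = a}"
  proof (intro equalityI subsetI)
    fix y assume y: "y \<in> {y\<in>A. cycle_length ?q y = a}"
    then obtain x where "y = g x" "x \<in> A" using permutes_image[OF g] by blast
    then show "y \<in> g ` {x\<in>A. cycle_length p x = a}" using y len by auto
  qed (use len permutes_in_image[OF g] in auto)
  moreover have "card (g ` {x\<in>A. cycle_length p x = a}) = card {x\<in>A. cycle_length p x = a}"
    by (rule card_image) (use inj inj_on_subset in auto)
  ultimately show "cycle_type A ?q a = cycle_type A p a" by (simp add: cycle_type_def)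
qed

lemma funpow_eq_iff_mod_cycle_length:
  assumes p: "permutation p"
  shows "(p ^^ i) x = (p ^^ j) x \<longleftrightarrow> i mod cycle_length p x = j mod cycle_length p x"
proof -
  let ?d = "funpow_dist1 p x x"
  have self: "x \<in> Orbits.orbit p x" by (rule permutation_self_in_orbit[OF p])
  have per: "(p ^^ ?d) x = x" by (rule funpow_dist1_prop[OF self])
  have inj: "inj_on (\<lambda>n. (p ^^ n) x) {0..<?d}" by (rule inj_on_funpow_dist1[OF self])
  have "Orbits.orbit p x = (\<lambda>n. (p ^^ n) x) ` {0..<?d}" by (rule orbit_conv_funpow_dist1[OF self])
  then have d: "cycle_length p x = ?d" unfolding cycle_length_def using card_image[OF inj] by simp
  have "(p ^^ n) x = (p ^^ (n mod ?d)) x" for n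
    using funpow_mod_eq[OF per] by metis
  moreover have "i mod ?d \<in> {0..<?d}" "j mod ?d \<in> {0..<?d}" by auto
  ultimately show ?thesis unfolding d using inj_onD[OF inj] by metis
qed

text \<open>
  Two permutations are matched up cycle by cycle: a bijection between a cycle of \<open>p\<close> and a cycle of \<open>q\<close> of the
  same length is determined by the image of one point. The statement is about invariant sets, so that a pair of
  matched cycles can be removed without changing \<open>p\<close> and \<open>q\<close>.
\<close>

lemma equivariant_bijection:
  fixes p q :: "'a \<Rightarrow> 'a"
  assumes p: "permutation p" and q: "permutation q"
  assumes "finite A" "\<And>x. x \<in> A \<Longrightarrow> p x \<in> A"
  assumes "finite B" "\<And>x. x \<in> B \<Longrightarrow> q x \<in> B"
  assumes "\<And>a. card {x\<in>A. cycle_length p x = a} = card {x\<in>B. cycle_length q x = a}"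
  shows "\<exists>h. bij_betw h A B \<and> (\<forall>x\<in>A. h (p x) = q (h x))"
  using assms(3-)
proof (induction "card A" arbitrary: A B rule: less_induct)
  case less
  show ?case
  proof (cases "A = {}")
    case True
    have "B = {}"
    proof (rule ccontr)
      assume "B \<noteq> {}"
      then obtain y where "y \<in> B" by auto
      then have "card {x\<in>B. cycle_length q x = cycle_length q y} > 0"
        using less.prems(3) by (auto simp: card_gt_0_iff)
      then show False using less.prems(5)[of "cycle_length q y"] True by simp
    qed
    then show ?thesis using True by (auto simp: bij_betw_def)
  next
    case False
    then obtain x where x: "x \<in> A" by auto
    let ?a = "cycle_length p x"
    have "card {z\<in>A. cycle_length p z = ?a} > 0"
      using less.prems(1) x by (auto simp: card_gt_0_iff)
    then have "card {z\<in>B. cycle_length q z = ?a} > 0" using less.prems(5) by simp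
    then obtain y where y: "y \<in> B" "cycle_length q y = ?a"
      by (metis (mono_tags, lifting) card.empty empty_Collect_eq less_numeral_extra(3))
    let ?O = "Orbits.orbit p x" and ?O' = "Orbits.orbit q y"
    have O: "?O \<subseteq> A" and O': "?O' \<subseteq> B"
      using orbit_subset_invariant[of A p x] orbit_subset_invariant[of B q y] less.prems x y by auto
    have fin: "finite ?O" "finite ?O'" using O O' less.prems(1,3) finite_subset by auto
    have Ox: "x \<in> ?O" and Oy: "y \<in> ?O'" by (rule permutation_self_in_orbit[OF p], rule permutation_self_in_orbit[OF q])
    have out: "f z \<in> C - Orbits.orbit f w"
      if "permutation f" "\<And>x. x \<in> C \<Longrightarrow> f x \<in> C" "z \<in> C - Orbits.orbit f w" for f :: "'a \<Rightarrow> 'a" and C z w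
      using that orbit_eq[OF that(1), of "f z" w] permutation_orbit_step[OF that(1), of z]
        permutation_self_in_orbit[OF that(1), of z] by blast
    have cnt: "card {z\<in>C - Orbits.orbit f w. cycle_length f z = a}
        = card {z\<in>C. cycle_length f z = a} - (if a = cycle_length f w then a else 0)"
      if "permutation f" "finite C" "Orbits.orbit f w \<subseteq> C" for f :: "'a \<Rightarrow> 'a" and C w a
    proof -
      have len: "cycle_length f z = cycle_length f w" if "z \<in> Orbits.orbit f w" for z
        using orbit_eq[OF \<open>permutation f\<close> that] by (simp add: cycle_length_def)
      have "{z\<in>C - Orbits.orbit f w. cycle_length f z = a}
        = {z\<in>C. cycle_length f z = a} - (if a = cycle_length f w then Orbits.orbit f w else {})"
        using len by auto
      also have "card \<dots> = card {z\<in>C. cycle_length f z = a} - (if a = cycle_length f w then a else 0)"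
        using len that finite_subset[OF that(3,2)] by (subst card_Diff_subset) (auto simp: cycle_length_def)
      finally show ?thesis .
    qed
    have "\<exists>h. bij_betw h (A - ?O) (B - ?O') \<and> (\<forall>z\<in>A - ?O. h (p z) = q (h z))"
    proof (rule less.hyps)
      show "card (A - ?O) < card A" using less.prems(1) x Ox by (intro psubset_card_mono) auto
      show "p z \<in> A - ?O" if "z \<in> A - ?O" for z using out[OF p less.prems(2) that] .
      show "q z \<in> B - ?O'" if "z \<in> B - ?O'" for z using out[OF q less.prems(4) that] .
      show "card {z\<in>A - ?O. cycle_length p z = a} = card {z\<in>B - ?O'. cycle_length q z = a}" for a
        using cnt[OF p less.prems(1) O] cnt[OF q less.prems(3) O'] less.prems(5) y by simp
    qed (use less.prems in auto)
    then obtain h where h: "bij_betw h (A - ?O) (B - ?O')" "\<And>z. z \<in> A - ?O \<Longrightarrow> h (p z) = q (h z)"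
      by blast
    \<comment> \<open>The point \<open>p ^ k x\<close> of the cycle of \<open>x\<close> is sent to \<open>q ^ k y\<close>.\<close>
    define k where "k z = (SOME k. z = (p ^^ k) x)" for z
    have kz: "z = (p ^^ k z) x" if "z \<in> ?O" for z
      unfolding k_def by (rule someI_ex) (use that in \<open>auto simp: orbit_altdef\<close>)
    define g where "g z = (q ^^ k z) y" for z
    have g: "g ((p ^^ n) x) = (q ^^ n) y" for n
    proof -
      have "(p ^^ n) x \<in> ?O" by (rule funpow_in_orbit[OF Ox])
      from kz[OF this] have "n mod ?a = k ((p ^^ n) x) mod ?a"
        using funpow_eq_iff_mod_cycle_length[OF p] by metis
      then show ?thesis unfolding g_def using funpow_eq_iff_mod_cycle_length[OF q, of _ y] y(2) by metis
    qed
    have rep: "\<exists>n. z = (p ^^ n) x" if "z \<in> ?O" for z using kz[OF that] by blast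
    have "inj_on g ?O"
    proof (rule inj_onI)
      fix z z' assume z: "z \<in> ?O" "z' \<in> ?O" "g z = g z'"
      obtain n n' where n: "z = (p ^^ n) x" "z' = (p ^^ n') x" using rep z by blast
      then have "n mod ?a = n' mod ?a" using z(3) g funpow_eq_iff_mod_cycle_length[OF q, of _ y] y(2) by metis
      then show "z = z'" unfolding n using funpow_eq_iff_mod_cycle_length[OF p] by metis
    qed
    moreover have "g ` ?O = ?O'"
    proof (intro equalityI subsetI)
      fix w assume "w \<in> g ` ?O"
      then show "w \<in> ?O'" using rep g funpow_in_orbit[OF Oy] by force
    next
      fix w assume "w \<in> ?O'"
      then obtain n where "w = (q ^^ n) y" by (auto simp: orbit_altdef)
      then have "w = g ((p ^^ n) x)" using g by simp
      then show "w \<in> g ` ?O" using funpow_in_orbit[OF Ox] by blast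
    qed
    ultimately have gb: "bij_betw g ?O ?O'" by (simp add: bij_betw_def)
    have gq: "g (p z) = q (g z)" if "z \<in> ?O" for z
    proof -
      from rep[OF that] obtain n where "z = (p ^^ n) x" by blast
      then show ?thesis using g[of n] g[of "Suc n"] by simp
    qed
    let ?h = "\<lambda>z. if z \<in> ?O then g z else h z"
    have "bij_betw ?h (?O \<union> (A - ?O)) (?O' \<union> (B - ?O'))"
    proof (rule bij_betw_combine)
      show "bij_betw ?h ?O ?O'" using gb by (simp cong: bij_betw_cong)
      show "bij_betw ?h (A - ?O) (B - ?O')" using h(1) bij_betw_cong[of "A - ?O" ?h h] by auto
    qed auto
    moreover have "?O \<union> (A - ?O) = A" "?O' \<union> (B - ?O') = B" using O O' by auto
    moreover have "?h (p z) = q (?h z)" if "z \<in> A" for z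
      using that gq h(2) out[OF p less.prems(2), of z x] orbit.step[of z p x] by auto
    ultimately show ?thesis by (intro exI[of _ ?h]) simp
  qed
qed

lemma conjugate_if_same_type:
  assumes p: "p permutes A" and q: "q permutes A" and A: "finite A"
    and eq: "cycle_type A p = cycle_type A q"
  shows "\<exists>g. g permutes A \<and> q = g \<circ> p \<circ> Hilbert_Choice.inv g"
proof -
  have pp: "permutation p" and qp: "permutation q" using p q A by (auto simp: permutation_permutes)
  have inv: "p x \<in> A" "q x \<in> A" if "x \<in> A" for x
    using that permutes_in_image[OF p] permutes_in_image[OF q] by auto
  have "\<exists>h. bij_betw h A A \<and> (\<forall>x\<in>A. h (p x) = q (h x))"
    by (rule equivariant_bijection[OF pp qp A _ A])
      (use inv card_points_of_length[OF pp A] card_points_of_length[OF qp A] eq in auto)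
  then obtain h where h: "bij_betw h A A" "\<And>x. x \<in> A \<Longrightarrow> h (p x) = q (h x)" by blast
  define g where "g x = (if x \<in> A then h x else x)" for x
  have g: "g permutes A"
  proof (rule bij_imp_permutes)
    show "bij_betw g A A" using h(1) unfolding g_def by (simp cong: bij_betw_cong)
  qed (simp add: g_def)
  have "g (p x) = q (g x)" for x
    using h(2)[of x] inv[of x] p q by (cases "x \<in> A") (auto simp: g_def permutes_not_in)
  then have "q = g \<circ> p \<circ> Hilbert_Choice.inv g"
    using permutes_inverses(1)[OF g] by (auto simp: fun_eq_iff)
  then show ?thesis using g by blast
qed

section \<open>Commuting permutations\<close>

text \<open>
  A block of type \<open>(a, b)\<close> consists of \<open>lcm a b\<close> points on which \<open>\<sigma>\<close> has cycles of length \<open>a\<close> only and \<open>\<tau>\<close>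
  cycles of length \<open>b\<close> only; \<open>X a b\<close> is the number of these blocks.
\<close>

definition block_matrix :: "nat \<Rightarrow> (nat \<Rightarrow> nat \<Rightarrow> nat) \<Rightarrow> (nat \<Rightarrow> nat) \<Rightarrow> (nat \<Rightarrow> nat) \<Rightarrow> bool" where
  "block_matrix n X l m \<longleftrightarrow>
     (\<forall>a\<in>{1..n}. a * l a = (\<Sum>b=1..n. lcm a b * X a b)) \<and>
     (\<forall>b\<in>{1..n}. b * m b = (\<Sum>a=1..n. lcm a b * X a b))"

lemma cycle_length_commute:
  assumes p: "permutation p" and q: "permutation q" and comm: "p \<circ> q = q \<circ> p"
  shows "cycle_length p (q x) = cycle_length p x"
proof -
  have "(p ^^ n) (q x) = q ((p ^^ n) x)" for n
    using comm by (induction n) (auto simp: fun_eq_iff)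
  then have "Orbits.orbit p (q x) = q ` Orbits.orbit p x" unfolding orbit_altdef by auto
  moreover have "inj q" using permutation_bijective[OF q] by (rule bij_is_inj)
  ultimately show ?thesis unfolding cycle_length_def by (simp add: card_image inj_on_subset[of q UNIV])
qed

text \<open>
  Since \<open>p\<close> and \<open>q\<close> preserve each other's cycle lengths, the set of points with \<open>p\<close>-cycle of length \<open>a\<close> and \<open>q\<close>-cycle
  of length \<open>b\<close> is a union of \<open>p\<close>-cycles and a union of \<open>q\<close>-cycles. Its size is divisible by \<open>a\<close> and by \<open>b\<close>, hence
  by \<open>lcm a b\<close>.
\<close>

lemma commuting_block_matrix:
  assumes p: "p permutes A" and q: "q permutes A" and A: "finite A" and comm: "p \<circ> q = q \<circ> p"
  shows "\<exists>X. block_matrix (card A) X (cycle_type A p) (cycle_type A q)"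
proof -
  have pp: "permutation p" and qp: "permutation q" using p q A by (auto simp: permutation_permutes)
  have inv: "p x \<in> A" "q x \<in> A" if "x \<in> A" for x
    using that permutes_in_image[OF p] permutes_in_image[OF q] by auto
  let ?N = "\<lambda>a b. {x\<in>A. cycle_length p x = a \<and> cycle_length q x = b}"
  define X where "X a b = card (?N a b) div lcm a b" for a b
  have rng: "cycle_length p x \<in> {1..card A}" "cycle_length q x \<in> {1..card A}" if "x \<in> A" for x
    using cycle_length_le_card[OF A, of p] cycle_length_le_card[OF A, of q] that inv
      cycle_length_pos[OF pp, of x] cycle_length_pos[OF qp, of x] by auto
  have step: "cycle_length p (p x) = cycle_length p x" "cycle_length q (p x) = cycle_length q x"
      "cycle_length p (q x) = cycle_length p x" "cycle_length q (q x) = cycle_length q x" for x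
    using cycle_length_apply[OF pp] cycle_length_apply[OF qp]
      cycle_length_commute[OF pp qp comm] cycle_length_commute[OF qp pp comm[symmetric]] by auto
  have X: "lcm a b * X a b = card (?N a b)" for a b
  proof -
    have "a dvd card (?N a b)" by (rule dvd_card_invariant[OF pp]) (use A inv step in auto)
    moreover have "b dvd card (?N a b)" by (rule dvd_card_invariant[OF qp]) (use A inv step in auto)
    ultimately show ?thesis unfolding X_def by (intro dvd_mult_div_cancel lcm_least)
  qed
  have "a * cycle_type A p a = (\<Sum>b=1..card A. lcm a b * X a b)" for a
  proof -
    have "a * cycle_type A p a = card {x\<in>A. cycle_length p x = a}"
      by (rule card_points_of_length[OF pp A inv(1), symmetric])
    also have "{x\<in>A. cycle_length p x = a} = (\<Union>b\<in>{1..card A}. ?N a b)" using rng by blast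
    also have "card \<dots> = (\<Sum>b=1..card A. card (?N a b))"
      using A by (intro card_UN_disjoint) auto
    finally show ?thesis by (simp add: X)
  qed
  moreover have "b * cycle_type A q b = (\<Sum>a=1..card A. lcm a b * X a b)" for b
  proof -
    have "b * cycle_type A q b = card {x\<in>A. cycle_length q x = b}"
      by (rule card_points_of_length[OF qp A inv(2), symmetric])
    also have "{x\<in>A. cycle_length q x = b} = (\<Union>a\<in>{1..card A}. ?N a b)" using rng by blast
    also have "card \<dots> = (\<Sum>a=1..card A. card (?N a b))"
      using A by (intro card_UN_disjoint) auto
    finally show ?thesis by (simp add: X)
  qed
  ultimately show ?thesis unfolding block_matrix_def by blast
qed

text \<open>
  A block of type \<open>(1, 2)\<close> and a block of type \<open>(2, 1)\<close> have together the same rows and columns as two blocks of type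
  \<open>(1, 1)\<close> and one of type \<open>(2, 2)\<close>.
\<close>

lemma block_matrix_reduce:
  assumes X: "block_matrix n X l m" and n: "n \<ge> 2"
  shows "\<exists>Y. block_matrix n Y l m \<and> (Y 1 2 = 0 \<or> Y 2 1 = 0)"
proof -
  define c where "c = min (X 1 2) (X 2 1)"
  define Y where "Y = (\<lambda>a b. if a = 1 \<and> b = 2 \<or> a = 2 \<and> b = 1 then X a b - c
     else if a = 1 \<and> b = 1 then X a b + 2 * c else if a = 2 \<and> b = 2 then X a b + c else X a b)"
  have split: "(\<Sum>b=1..n. f b) = f 1 + (f 2 + (\<Sum>b=3..n. f b))" for f :: "nat \<Rightarrow> nat"
  proof -
    have "{1..n} = insert 1 (insert 2 {3..n})" using n by auto
    then show ?thesis by simp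
  qed
  obtain d e where c: "X 1 2 = c + d" "X 2 1 = c + e"
    unfolding c_def by (metis le_add_diff_inverse min.cobounded1 min.cobounded2)
  have Y: "Y 1 2 = d" "Y 2 1 = e" "Y 1 1 = X 1 1 + 2 * c" "Y 2 2 = X 2 2 + c"
    using c by (simp_all add: Y_def)
  have Y_out: "Y a b = X a b" if "a \<ge> 3 \<or> b \<ge> 3" for a b using that by (auto simp: Y_def)
  have row: "(\<Sum>b=1..n. lcm a b * Y a b) = (\<Sum>b=1..n. lcm a b * X a b)" if "a \<ge> 1" for a
  proof -
    have "(\<Sum>b=3..n. lcm a b * Y a b) = (\<Sum>b=3..n. lcm a b * X a b)"
      by (intro sum.cong) (auto simp: Y_out)
    moreover have "lcm a 1 * Y a 1 + lcm a 2 * Y a 2 = lcm a 1 * X a 1 + lcm a 2 * X a 2"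
    proof -
      have "a = 1 \<or> a = 2 \<or> a \<ge> 3" using that by linarith
      then show ?thesis
      proof (elim disjE)
        assume 1: "a = 1"
        have "lcm 1 (2::nat) = 2" by simp
        then show ?thesis unfolding 1 Y c(1) by simp
      next
        assume 2: "a = 2"
        have "lcm 2 (1::nat) = 2" "lcm 2 (2::nat) = 2" by simp_all
        then show ?thesis unfolding 2 Y c(2) by simp
      qed (simp add: Y_out)
    qed
    ultimately show ?thesis unfolding split by linarith
  qed
  have col: "(\<Sum>a=1..n. lcm a b * Y a b) = (\<Sum>a=1..n. lcm a b * X a b)" if "b \<ge> 1" for b
  proof -
    have "(\<Sum>a=3..n. lcm a b * Y a b) = (\<Sum>a=3..n. lcm a b * X a b)"
      by (intro sum.cong) (auto simp: Y_out)
    moreover have "lcm 1 b * Y 1 b + lcm 2 b * Y 2 b = lcm 1 b * X 1 b + lcm 2 b * X 2 b"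
    proof -
      have "b = 1 \<or> b = 2 \<or> b \<ge> 3" using that by linarith
      then show ?thesis
      proof (elim disjE)
        assume 1: "b = 1"
        have "lcm 2 (1::nat) = 2" by simp
        then show ?thesis unfolding 1 Y c(2) by simp
      next
        assume 2: "b = 2"
        have "lcm 1 (2::nat) = 2" "lcm 2 (2::nat) = 2" by simp_all
        then show ?thesis unfolding 2 Y c(1) by simp
      qed (simp add: Y_out)
    qed
    ultimately show ?thesis unfolding split by linarith
  qed
  have "block_matrix n Y l m" using X row col by (simp add: block_matrix_def)
  moreover have "Y 1 2 = 0 \<or> Y 2 1 = 0" by (auto simp: Y_def c_def)
  ultimately show ?thesis by blast
qed

definition types :: "nat \<Rightarrow> (nat \<Rightarrow> nat) set" where
  "types n = {l. is_type n l}"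

definition block_pairs :: "nat \<Rightarrow> ((nat \<Rightarrow> nat) \<times> (nat \<Rightarrow> nat)) set" where
  "block_pairs n = {(l, m). is_type n l \<and> is_type n m \<and>
     (\<exists>X. block_matrix n X l m \<and> (X 1 2 = 0 \<or> X 2 1 = 0))}"

lemma is_type_le:
  assumes "is_type n l"
  shows "l a \<le> n"
proof (cases "a \<in> {1..n}")
  case True
  have "a * l a \<le> (\<Sum>a=1..n. a * l a)" using True by (intro member_le_sum) auto
  then have "a * l a \<le> n" using assms by (simp add: is_type_def)
  moreover have "1 * l a \<le> a * l a" using True by (intro mult_right_mono) auto
  ultimately show ?thesis by linarith
next
  case False
  then have "l a = 0" using assms unfolding is_type_def by blast
  then show ?thesis by simp
qed

lemma finite_types: "finite (types n)"
proof (rule finite_subset)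
  show "types n \<subseteq> {l. \<forall>a. (a \<in> {1..n} \<longrightarrow> l a \<in> {..n}) \<and> (a \<notin> {1..n} \<longrightarrow> l a = 0)}"
  proof
    fix l assume "l \<in> types n"
    then have l: "is_type n l" by (simp add: types_def)
    then have "l a = 0" if "a \<notin> {1..n}" for a using that unfolding is_type_def by blast
    with is_type_le[OF l] show "l \<in> {l. \<forall>a. (a \<in> {1..n} \<longrightarrow> l a \<in> {..n}) \<and> (a \<notin> {1..n} \<longrightarrow> l a = 0)}"
      by blast
  qed
  show "finite {l :: nat \<Rightarrow> nat. \<forall>a. (a \<in> {1..n} \<longrightarrow> l a \<in> {..n}) \<and> (a \<notin> {1..n} \<longrightarrow> l a = 0)}"
    by (rule finite_set_of_finite_funs) auto
qed

lemma block_pairs_subset: "block_pairs n \<subseteq> types n \<times> types n"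
  by (auto simp: block_pairs_def types_def)

section \<open>The two probabilities in terms of cycle types\<close>

lemma card_pairs_of_types:
  assumes "T \<subseteq> types n \<times> types n"
  shows "real (card {(p, q). p permutes {1..n} \<and> q permutes {1..n} \<and>
      (cycle_type {1..n} p, cycle_type {1..n} q) \<in> T})
    = fact n ^ 2 * (\<Sum>(l, m)\<in>T. type_weight n l * type_weight n m)"
proof -
  let ?P = "\<lambda>l. {p. p permutes {1..n} \<and> cycle_type {1..n} p = l}"
  have fT: "finite T" using assms finite_types finite_subset by blast
  have fP: "finite (?P l)" for l
    by (rule finite_subset[of _ "{p. p permutes {1..n}}"]) (auto simp: finite_permutations)
  have union: "{(p, q). p permutes {1..n} \<and> q permutes {1..n} \<and>
      (cycle_type {1..n} p, cycle_type {1..n} q) \<in> T} = (\<Union>t\<in>T. ?P (fst t) \<times> ?P (snd t))"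
    by force
  have card: "card (\<Union>t\<in>T. ?P (fst t) \<times> ?P (snd t)) = (\<Sum>t\<in>T. card (?P (fst t) \<times> ?P (snd t)))"
  proof (rule card_UN_disjoint[OF fT])
    show "\<forall>t\<in>T. finite (?P (fst t) \<times> ?P (snd t))" using fP by simp
    have "t = t'" if "x \<in> ?P (fst t) \<times> ?P (snd t)" "x \<in> ?P (fst t') \<times> ?P (snd t')" for t t' x
    proof -
      have "cycle_type {1..n} (fst x) = fst t" "cycle_type {1..n} (snd x) = snd t"
        "cycle_type {1..n} (fst x) = fst t'" "cycle_type {1..n} (snd x) = snd t'" using that by (simp_all add: mem_Times_iff)
      then show ?thesis by (metis prod.collapse)
    qed
    then show "\<forall>t\<in>T. \<forall>t'\<in>T. t \<noteq> t' \<longrightarrow> (?P (fst t) \<times> ?P (snd t)) \<inter> (?P (fst t') \<times> ?P (snd t')) = {}"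
      by blast
  qed
  have "real (card {(p, q). p permutes {1..n} \<and> q permutes {1..n} \<and>
      (cycle_type {1..n} p, cycle_type {1..n} q) \<in> T}) = (\<Sum>t\<in>T. real (card (?P (fst t) \<times> ?P (snd t))))"
    unfolding union card by (rule of_nat_sum)
  also have "\<dots> = (\<Sum>t\<in>T. real (card (?P (fst t))) * real (card (?P (snd t))))"
    by (simp only: card_cartesian_product of_nat_mult)
  also have "\<dots> = (\<Sum>t\<in>T. (fact n * type_weight n (fst t)) * (fact n * type_weight n (snd t)))"
  proof (intro sum.cong refl)
    fix t assume "t \<in> T"
    then have "is_type n (fst t)" "is_type n (snd t)" using assms by (auto simp: types_def)
    then show "real (card (?P (fst t))) * real (card (?P (snd t)))
      = (fact n * type_weight n (fst t)) * (fact n * type_weight n (snd t))"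
      using card_permutations_of_type[of "{1..n}" "fst t"] card_permutations_of_type[of "{1..n}" "snd t"] by simp
  qed
  also have "\<dots> = fact n ^ 2 * (\<Sum>(l, m)\<in>T. type_weight n l * type_weight n m)"
    by (simp add: sum_distrib_left power2_eq_square mult_ac case_prod_beta)
  finally show ?thesis .
qed

lemma inv_sym_group:
  assumes "g permutes {1..n}"
  shows "inv\<^bsub>sym_group n\<^esub> g = Hilbert_Choice.inv g"
proof (rule group.inv_equality[OF sym_group_is_group])
  show "Hilbert_Choice.inv g \<otimes>\<^bsub>sym_group n\<^esub> g = \<one>\<^bsub>sym_group n\<^esub>"
    using assms by (simp add: sym_group_mult sym_group_one permutes_inv_o)
qed (use assms in \<open>auto simp: sym_group_carrier permutes_inv\<close>)

lemma conjugate_in_sym_group: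
  assumes p: "p permutes {1..n}" and q: "q permutes {1..n}"
  shows "conjugate_in (sym_group n) p q \<longleftrightarrow> cycle_type {1..n} p = cycle_type {1..n} q"
proof
  assume "conjugate_in (sym_group n) p q"
  then obtain g where "g permutes {1..n}" "q = g \<circ> p \<circ> Hilbert_Choice.inv g"
    by (auto simp: conjugate_in_def sym_group_carrier sym_group_mult inv_sym_group)
  then show "cycle_type {1..n} p = cycle_type {1..n} q" using cycle_type_conjugate[OF p] by simp
next
  assume "cycle_type {1..n} p = cycle_type {1..n} q"
  then obtain g where "g permutes {1..n}" "q = g \<circ> p \<circ> Hilbert_Choice.inv g"
    using conjugate_if_same_type[OF p q] by auto
  then show "conjugate_in (sym_group n) p q"
    by (auto simp: conjugate_in_def sym_group_carrier sym_group_mult inv_sym_group intro!: exI[of _ g])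
qed

lemma permutes_of_conjugate_in:
  assumes "p permutes {1..n}" "conjugate_in (sym_group n) p q"
  shows "q permutes {1..n}"
  using assms by (auto simp: conjugate_in_def sym_group_carrier sym_group_mult inv_sym_group
      intro!: permutes_compose permutes_inv)

lemma type_in_types:
  assumes "p permutes {1..n}"
  shows "cycle_type {1..n} p \<in> types n"
  using is_type_cycle_type[of p "{1..n}"] assms permutes_in_image[OF assms]
  by (auto simp: types_def permutation_permutes)

lemma commuting_conjugates_block_pairs:
  assumes p: "p permutes {1..n}" and q: "q permutes {1..n}" and n: "n \<ge> 2"
    and comm: "have_commuting_conjugates (sym_group n) p q"
  shows "(cycle_type {1..n} p, cycle_type {1..n} q) \<in> block_pairs n"
proof -
  obtain p' q' where pq: "conjugate_in (sym_group n) p p'" "conjugate_in (sym_group n) q q'" "p' \<circ> q' = q' \<circ> p'"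
    using comm by (auto simp: have_commuting_conjugates_def sym_group_mult)
  have p': "p' permutes {1..n}" and q': "q' permutes {1..n}"
    by (rule permutes_of_conjugate_in[OF p pq(1)], rule permutes_of_conjugate_in[OF q pq(2)])
  obtain X where "block_matrix n X (cycle_type {1..n} p') (cycle_type {1..n} q')"
    using commuting_block_matrix[OF p' q' _ pq(3)] by auto
  from block_matrix_reduce[OF this n]
  obtain Y where Y: "block_matrix n Y (cycle_type {1..n} p') (cycle_type {1..n} q')" "Y 1 2 = 0 \<or> Y 2 1 = 0"
    by blast
  have ty: "is_type n (cycle_type {1..n} r)" if "r permutes {1..n}" for r
    using type_in_types[OF that] by (simp add: types_def)
  have "cycle_type {1..n} p' = cycle_type {1..n} p" "cycle_type {1..n} q' = cycle_type {1..n} q"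
    using conjugate_in_sym_group p q p' q' pq by metis+
  then show ?thesis using Y ty[OF p] ty[OF q] by (auto simp: block_pairs_def)
qed

lemma conjugate_imp_have_commuting_conjugates:
  assumes p: "p permutes {1..n}" and q: "q permutes {1..n}" and conj: "conjugate_in (sym_group n) p q"
  shows "have_commuting_conjugates (sym_group n) p q"
proof -
  have "conjugate_in (sym_group n) q q" using conjugate_in_sym_group[OF q q] by simp
  then show ?thesis using conj unfolding have_commuting_conjugates_def by blast
qed

definition kappa :: "nat \<Rightarrow> real" where
  "kappa n = (\<Sum>l\<in>types n. type_weight n l ^ 2)"

text \<open>
  An upper bound for the probability of having commuting conjugates, since a pair of types that is not in \<open>block_pairs n\<close>
  cannot have them.
\<close>

definition rho_bound :: "nat \<Rightarrow> real" where
  "rho_bound n = (\<Sum>(l, m)\<in>block_pairs n. type_weight n l * type_weight n m)"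

lemma pair_pmf_of_set:
  assumes "finite A" "A \<noteq> {}" "finite B" "B \<noteq> {}"
  shows "pair_pmf (pmf_of_set A) (pmf_of_set B) = pmf_of_set (A \<times> B)"
proof (rule pmf_eqI)
  fix x :: "'a \<times> 'b"
  obtain a b where x: "x = (a, b)" by (cases x)
  show "pmf (pair_pmf (pmf_of_set A) (pmf_of_set B)) x = pmf (pmf_of_set (A \<times> B)) x"
    unfolding x using assms by (simp add: pmf_pair card_cartesian_product indicator_def)
qed

lemma conditional_probability_ge:
  assumes n: "n \<ge> 2" and c: "c * rho_bound n \<le> kappa n" "c \<ge> 0"
  shows "\<P>((\<sigma>, \<tau>) in measure_pmf (random_perm_pair n).
      conjugate_in (sym_group n) \<sigma> \<tau> \<bar> have_commuting_conjugates (sym_group n) \<sigma> \<tau>) \<ge> c"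
proof -
  let ?S = "{p. p permutes {1..n}}"
  let ?conj = "\<lambda>(p, q). conjugate_in (sym_group n) p q"
  let ?comm = "\<lambda>(p, q). have_commuting_conjugates (sym_group n) p q"
  have "id \<in> ?S" by (simp add: permutes_id)
  then have S: "finite ?S" "?S \<noteq> {}" by (auto simp only: finite_permutations finite_atLeastAtMost)
  have "card ?S = fact n" by (rule card_permutations) auto
  then have cS: "real (card (?S \<times> ?S)) = fact n ^ 2"
    by (simp add: card_cartesian_product power2_eq_square)
  have "random_perm_pair n = pmf_of_set (?S \<times> ?S)"
    using pair_pmf_of_set[OF S S] by (simp add: random_perm_pair_def sym_group_def)
  then have prob: "measure_pmf.prob (random_perm_pair n) B = real (card ((?S \<times> ?S) \<inter> B)) / fact n ^ 2" for B
    using S by (simp only: measure_pmf_of_set finite_cartesian_product Times_empty de_Morgan_disj cS simp_thms)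
  let ?J = "{x. ?conj x \<and> ?comm x}" and ?C = "{x. ?comm x}"
  have J_eq: "(?S \<times> ?S) \<inter> ?J = {(p, q). p permutes {1..n} \<and> q permutes {1..n} \<and>
      (cycle_type {1..n} p, cycle_type {1..n} q) \<in> (\<lambda>l. (l, l)) ` types n}"
  proof (intro equalityI subsetI)
    fix x assume "x \<in> (?S \<times> ?S) \<inter> ?J"
    then obtain p q where x: "x = (p, q)" "p permutes {1..n}" "q permutes {1..n}"
      "conjugate_in (sym_group n) p q" by auto
    then have "cycle_type {1..n} p = cycle_type {1..n} q" using conjugate_in_sym_group by blast
    moreover have "cycle_type {1..n} q \<in> types n" using x(3) type_in_types by blast
    ultimately show "x \<in> {(p, q). p permutes {1..n} \<and> q permutes {1..n} \<and>
      (cycle_type {1..n} p, cycle_type {1..n} q) \<in> (\<lambda>l. (l, l)) ` types n}" using x by simp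
  next
    fix x assume "x \<in> {(p, q). p permutes {1..n} \<and> q permutes {1..n} \<and>
      (cycle_type {1..n} p, cycle_type {1..n} q) \<in> (\<lambda>l. (l, l)) ` types n}"
    then obtain p q where x: "x = (p, q)" "p permutes {1..n}" "q permutes {1..n}"
      "cycle_type {1..n} p = cycle_type {1..n} q" by auto
    then have "conjugate_in (sym_group n) p q" using conjugate_in_sym_group by blast
    then show "x \<in> (?S \<times> ?S) \<inter> ?J" using x conjugate_imp_have_commuting_conjugates by simp
  qed
  have "real (card ((?S \<times> ?S) \<inter> ?J))
      = fact n ^ 2 * (\<Sum>(l, m)\<in>(\<lambda>l. (l, l)) ` types n. type_weight n l * type_weight n m)"
    unfolding J_eq by (rule card_pairs_of_types) blast
  also have "(\<Sum>(l, m)\<in>(\<lambda>l. (l, l)) ` types n. type_weight n l * type_weight n m) = kappa n"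
    unfolding kappa_def by (subst sum.reindex) (auto simp: inj_on_def power2_eq_square)
  finally have J: "real (card ((?S \<times> ?S) \<inter> ?J)) = fact n ^ 2 * kappa n" .
  have "real (card ((?S \<times> ?S) \<inter> ?C)) \<le> real (card {(p, q). p permutes {1..n} \<and> q permutes {1..n} \<and>
      (cycle_type {1..n} p, cycle_type {1..n} q) \<in> block_pairs n})"
  proof (rule of_nat_mono[OF card_mono])
    show "finite {(p, q). p permutes {1..n} \<and> q permutes {1..n} \<and>
        (cycle_type {1..n} p, cycle_type {1..n} q) \<in> block_pairs n}"
      by (rule finite_subset[of _ "?S \<times> ?S"]) (use S in blast)+
    show "(?S \<times> ?S) \<inter> ?C \<subseteq> {(p, q). p permutes {1..n} \<and> q permutes {1..n} \<and>
        (cycle_type {1..n} p, cycle_type {1..n} q) \<in> block_pairs n}"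
      using commuting_conjugates_block_pairs[OF _ _ n] by blast
  qed
  also have "\<dots> = fact n ^ 2 * rho_bound n"
    unfolding rho_bound_def by (rule card_pairs_of_types[OF block_pairs_subset])
  finally have C: "real (card ((?S \<times> ?S) \<inter> ?C)) \<le> fact n ^ 2 * rho_bound n" .
  have "id permutes {1..n}" by (rule permutes_id)
  then have "(id, id) \<in> (?S \<times> ?S) \<inter> ?C"
    using conjugate_imp_have_commuting_conjugates conjugate_in_sym_group by auto
  moreover have "finite ((?S \<times> ?S) \<inter> ?C)" using S by simp
  ultimately have C0: "real (card ((?S \<times> ?S) \<inter> ?C)) > 0" unfolding of_nat_0_less_iff card_gt_0_iff by blast
  have "c * real (card ((?S \<times> ?S) \<inter> ?C)) \<le> c * (fact n ^ 2 * rho_bound n)"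
    by (rule mult_left_mono[OF C c(2)])
  also have "\<dots> = fact n ^ 2 * (c * rho_bound n)" by (rule mult.left_commute)
  also have "\<dots> \<le> fact n ^ 2 * kappa n" using c(1) by (rule mult_left_mono) simp
  finally have "c \<le> fact n ^ 2 * kappa n / real (card ((?S \<times> ?S) \<inter> ?C))"
    using C0 by (simp only: pos_le_divide_eq)
  also have "\<dots> = measure_pmf.prob (random_perm_pair n) ?J / measure_pmf.prob (random_perm_pair n) ?C"
    unfolding prob J by simp
  also have "\<dots> = cond_prob (measure_pmf (random_perm_pair n)) ?conj ?comm"
    by (simp add: cond_prob_def)
  finally show ?thesis by simp
qed

section \<open>Power series with nonnegative coefficients\<close>

definition block_series :: "nat \<Rightarrow> (nat \<Rightarrow> real) \<Rightarrow> real fps" where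
  "block_series s f = Abs_fps (\<lambda>k. if s dvd k then f (k div s) else 0)"

lemma block_series_nth: "fps_nth (block_series s f) k = (if s dvd k then f (k div s) else 0)"
  by (simp add: block_series_def)

lemma fps_prod_nth_cong:
  assumes "\<And>t k. t \<in> T \<Longrightarrow> k \<le> n \<Longrightarrow> fps_nth (F t) k = fps_nth (G t) k" "k \<le> n"
  shows "fps_nth (\<Prod>t\<in>T. F t) k = fps_nth (\<Prod>t\<in>T. G t) (k :: nat)"
  using assms
proof (induction T arbitrary: k rule: infinite_finite_induct)
  case (insert x T)
  then show ?case by (simp add: fps_mult_nth)
qed auto

text \<open>
  Such a product enumerates the vectors \<open>g\<close> of multiplicities by their total size. The cutoff \<open>n\<close>
  makes the set of vectors finite and does not affect the coefficients up to \<open>n\<close>.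
\<close>

lemma prod_block_series_nth:
  assumes T: "finite T" and s: "\<And>t. t \<in> T \<Longrightarrow> s t \<ge> 1" and m: "m \<le> n"
  shows "fps_nth (\<Prod>t\<in>T. block_series (s t) (f t)) m =
    (\<Sum>g | g \<in> PiE T (\<lambda>_. {..n}) \<and> (\<Sum>t\<in>T. s t * g t) = m. \<Prod>t\<in>T. f t (g t))"
proof -
  let ?G = "\<lambda>t. \<Sum>c\<le>n. fps_const (f t c) * fps_X ^ (s t * c) :: real fps"
  have "fps_nth (block_series (s t) (f t)) k = fps_nth (?G t) k" if t: "t \<in> T" and k: "k \<le> n" for t k
  proof -
    have "fps_nth (?G t) k = (\<Sum>c\<le>n. if k = s t * c then f t c else 0)"
      by (auto simp: fps_sum_nth intro!: sum.cong)
    also have "\<dots> = (if s t dvd k then f t (k div s t) else 0)"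
    proof (cases "s t dvd k")
      case True
      then obtain c where c: "k = s t * c" by blast
      have "c \<le> n" using c k s[OF t] by (metis le_trans mult_le_mono1 nat_mult_1)
      moreover have "(s t * c = s t * c') = (c = c')" for c' using s[OF t] by (simp only: mult_cancel1) simp
      ultimately have "(\<Sum>c'\<le>n. if k = s t * c' then f t c' else 0) = f t c" unfolding c by simp
      then show ?thesis using s[OF t] unfolding c by simp
    qed (auto intro!: sum.neutral)
    finally show ?thesis by (simp add: block_series_nth)
  qed
  then have "fps_nth (\<Prod>t\<in>T. block_series (s t) (f t)) m = fps_nth (\<Prod>t\<in>T. ?G t) m"
    using m by (rule fps_prod_nth_cong)
  also have "(\<Prod>t\<in>T. ?G t) = (\<Sum>g\<in>PiE T (\<lambda>_. {..n}). \<Prod>t\<in>T. fps_const (f t (g t)) * fps_X ^ (s t * g t))"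
    by (rule prod_sum_PiE) (use T in auto)
  also have "\<dots> = (\<Sum>g\<in>PiE T (\<lambda>_. {..n}). fps_const (\<Prod>t\<in>T. f t (g t)) * fps_X ^ (\<Sum>t\<in>T. s t * g t))"
  proof (intro sum.cong refl)
    fix g
    have "(\<Prod>t\<in>T. fps_const (f t (g t))) = fps_const (\<Prod>t\<in>T. f t (g t))"
      using T by (induction T rule: finite_induct) auto
    then show "(\<Prod>t\<in>T. fps_const (f t (g t)) * fps_X ^ (s t * g t))
      = fps_const (\<Prod>t\<in>T. f t (g t)) * fps_X ^ (\<Sum>t\<in>T. s t * g t)"
      by (simp add: prod.distrib power_sum)
  qed
  also have "fps_nth \<dots> m = (\<Sum>g\<in>PiE T (\<lambda>_. {..n}). if (\<Sum>t\<in>T. s t * g t) = m then \<Prod>t\<in>T. f t (g t) else 0)"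
    unfolding fps_sum_nth by (intro sum.cong refl) auto
  also have "\<dots> = (\<Sum>g | g \<in> PiE T (\<lambda>_. {..n}) \<and> (\<Sum>t\<in>T. s t * g t) = m. \<Prod>t\<in>T. f t (g t))"
    using T by (subst sum.inter_filter[symmetric]) (auto intro: finite_PiE)
  finally show ?thesis .
qed

definition nonneg_series :: "real fps \<Rightarrow> bool" where
  "nonneg_series F \<longleftrightarrow> (\<forall>k. fps_nth F k \<ge> 0)"

lemma nonneg_seriesD: "nonneg_series F \<Longrightarrow> fps_nth F k \<ge> 0"
  by (simp add: nonneg_series_def)

lemma nonneg_series_mult: "nonneg_series F \<Longrightarrow> nonneg_series G \<Longrightarrow> nonneg_series (F * G)"
  by (auto simp: nonneg_series_def fps_mult_nth intro!: sum_nonneg)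

lemma nonneg_series_prod: "(\<And>t. t \<in> T \<Longrightarrow> nonneg_series (F t)) \<Longrightarrow> nonneg_series (\<Prod>t\<in>T. F t)"
  by (induction T rule: infinite_finite_induct) (auto simp: nonneg_series_mult, auto simp: nonneg_series_def)

lemma nonneg_block_series: "(\<And>c. f c \<ge> 0) \<Longrightarrow> nonneg_series (block_series s f)"
  by (simp add: nonneg_series_def block_series_nth)

lemma fps_mult_mono:
  assumes "nonneg_series F" "\<And>k. fps_nth G k \<le> fps_nth H k"
  shows "fps_nth (F * G) n \<le> fps_nth (F * H) n"
  using assms by (auto simp: fps_mult_nth nonneg_series_def intro!: sum_mono mult_left_mono)

text \<open>
  The value at \<open>r\<close> of the truncated series. It is submultiplicative for nonnegative series; at \<open>r = 1\<close> this controls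
  sums of coefficients, at \<open>r = 2\<close> it shows that they decay geometrically.
\<close>

definition partial_eval :: "nat \<Rightarrow> real \<Rightarrow> real fps \<Rightarrow> real" where
  "partial_eval N r F = (\<Sum>k\<le>N. fps_nth F k * r ^ k)"

lemma partial_eval_nonneg: "nonneg_series F \<Longrightarrow> r \<ge> 0 \<Longrightarrow> partial_eval N r F \<ge> 0"
  by (auto simp: partial_eval_def nonneg_series_def intro!: sum_nonneg)

lemma partial_eval_one: "partial_eval N r 1 = 1"
proof -
  have "(\<Sum>k\<le>N. fps_nth 1 k * r ^ k) = (\<Sum>k\<in>{0::nat}. 1)"
    by (rule sum.mono_neutral_cong_right) auto
  then show ?thesis by (simp add: partial_eval_def)
qed

lemma partial_eval_mult_le:
  assumes F: "nonneg_series F" and G: "nonneg_series G" and r: "r \<ge> 0"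
  shows "partial_eval N r (F * G) \<le> partial_eval N r F * partial_eval N r G"
proof -
  let ?h = "\<lambda>i j. (fps_nth F i * r ^ i) * (fps_nth G j * r ^ j)"
  have "partial_eval N r (F * G) = (\<Sum>k\<le>N. \<Sum>i\<le>k. ?h i (k - i))"
    unfolding partial_eval_def
  proof (intro sum.cong refl)
    fix k
    have "fps_nth (F * G) k * r ^ k = (\<Sum>i\<le>k. fps_nth F i * fps_nth G (k - i) * r ^ k)"
      by (simp add: fps_mult_nth sum_distrib_right atLeast0AtMost)
    also have "\<dots> = (\<Sum>i\<le>k. ?h i (k - i))"
    proof (intro sum.cong refl)
      fix i assume "i \<in> {..k}"
      then have "r ^ k = r ^ i * r ^ (k - i)" by (simp flip: power_add)
      then show "fps_nth F i * fps_nth G (k - i) * r ^ k = ?h i (k - i)" by simp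
    qed
    finally show "fps_nth (F * G) k * r ^ k = (\<Sum>i\<le>k. ?h i (k - i))" .
  qed
  also have "\<dots> = (\<Sum>(i, j)\<in>{(i, j). i + j \<le> N}. ?h i j)"
    by (rule sum.triangle_reindex_eq[symmetric])
  also have "\<dots> \<le> (\<Sum>(i, j)\<in>{..N} \<times> {..N}. ?h i j)"
    using F G r by (intro sum_mono2) (auto simp: nonneg_series_def)
  also have "\<dots> = partial_eval N r F * partial_eval N r G"
    by (simp add: partial_eval_def sum_product sum.cartesian_product)
  finally show ?thesis .
qed

lemma partial_eval_prod_le:
  assumes "\<And>t. t \<in> T \<Longrightarrow> nonneg_series (F t)" "r \<ge> 0"
  shows "partial_eval N r (\<Prod>t\<in>T. F t) \<le> (\<Prod>t\<in>T. partial_eval N r (F t))"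
  using assms
proof (induction T rule: infinite_finite_induct)
  case (insert x T)
  have "partial_eval N r (F x * (\<Prod>t\<in>T. F t)) \<le> partial_eval N r (F x) * partial_eval N r (\<Prod>t\<in>T. F t)"
    using insert.prems by (intro partial_eval_mult_le nonneg_series_prod) auto
  also have "\<dots> \<le> partial_eval N r (F x) * (\<Prod>t\<in>T. partial_eval N r (F t))"
    using insert.prems by (intro mult_left_mono insert.IH partial_eval_nonneg) auto
  finally show ?case using insert.hyps by simp
qed (simp_all add: partial_eval_one)

lemma sum_exp_le:
  assumes "x \<ge> 0"
  shows "(\<Sum>c\<le>N. x ^ c / fact c) \<le> exp (x :: real)"
proof -
  have "(\<Sum>c<Suc N. inverse (fact c) *\<^sub>R x ^ c) \<le> (\<Sum>c. inverse (fact c) *\<^sub>R x ^ c)"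
    using assms by (intro sum_le_suminf summable_exp_generic) auto
  then show ?thesis by (simp add: exp_def lessThan_Suc_atMost divide_inverse mult.commute)
qed

lemma partial_eval_block_series_le:
  assumes s: "s \<ge> 1" and r: "r \<ge> 0" and f: "\<And>c. 0 \<le> f c" "\<And>c. f c \<le> w ^ c / fact c" and w: "w \<ge> 0"
  shows "partial_eval N r (block_series s f) \<le> exp (w * r ^ s)"
proof -
  have "partial_eval N r (block_series s f) = (\<Sum>k\<in>{k. k \<le> N \<and> s dvd k}. f (k div s) * r ^ k)"
    unfolding partial_eval_def block_series_nth
    by (rule sum.mono_neutral_cong_right) auto
  also have "\<dots> \<le> (\<Sum>k\<in>(\<lambda>c. s * c) ` {..N}. f (k div s) * r ^ k)"
  proof (rule sum_mono2)
    show "{k. k \<le> N \<and> s dvd k} \<subseteq> (\<lambda>c. s * c) ` {..N}"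
    proof
      fix k assume "k \<in> {k. k \<le> N \<and> s dvd k}"
      then obtain c where c: "k = s * c" "s * c \<le> N" by auto
      have "c \<le> s * c" using s by simp
      from le_trans[OF this c(2)] have "c \<in> {..N}" by simp
      then show "k \<in> (\<lambda>c. s * c) ` {..N}" using c(1) by blast
    qed
  qed (use f r in auto)
  also have "\<dots> = (\<Sum>c\<le>N. f c * r ^ (s * c))"
    using s by (subst sum.reindex) (auto simp: inj_on_def)
  also have "\<dots> \<le> (\<Sum>c\<le>N. (w * r ^ s) ^ c / fact c)"
  proof (rule sum_mono)
    fix c
    have "f c * r ^ (s * c) \<le> w ^ c / fact c * r ^ (s * c)" using f r by (intro mult_right_mono) auto
    then show "f c * r ^ (s * c) \<le> (w * r ^ s) ^ c / fact c" by (simp add: power_mult_distrib power_mult)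
  qed
  also have "\<dots> \<le> exp (w * r ^ s)" using w r by (intro sum_exp_le) auto
  finally show ?thesis .
qed

section \<open>Exponentials of power series\<close>

text \<open>
  The coefficients \<open>e\<close> of \<open>exp (\<Sum>k. h k * x ^ k)\<close>. Differentiation gives
  \<open>n * e n = (\<Sum>k. k * h k * e (n - k))\<close>.
\<close>

fun exp_coeff :: "(nat \<Rightarrow> real) \<Rightarrow> nat \<Rightarrow> real" where
  "exp_coeff h 0 = 1"
| "exp_coeff h (Suc n) = (\<Sum>i\<le>n. real (Suc i) * h (Suc i) * exp_coeff h (n - i)) / real (Suc n)"

declare exp_coeff.simps(2) [simp del]

lemma exp_coeff_nonneg:
  assumes "\<And>k. k \<ge> 1 \<Longrightarrow> h k \<ge> 0"
  shows "exp_coeff h n \<ge> 0"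
  using assms
  by (induction h n rule: exp_coeff.induct) (auto simp: exp_coeff.simps(2) intro!: divide_nonneg_nonneg sum_nonneg)

lemma exp_coeff_mono:
  assumes "\<And>k. k \<in> {1..n} \<Longrightarrow> 0 \<le> h k \<and> h k \<le> h' k"
  shows "0 \<le> exp_coeff h n \<and> exp_coeff h n \<le> exp_coeff h' n"
  using assms
proof (induction n rule: less_induct)
  case (less n)
  show ?case
  proof (cases n)
    case (Suc m)
    have IH: "0 \<le> exp_coeff h (m - i) \<and> exp_coeff h (m - i) \<le> exp_coeff h' (m - i)" for i
      using less Suc by auto
    have hh: "0 \<le> h (Suc i) \<and> h (Suc i) \<le> h' (Suc i)" if "i \<le> m" for i using less.prems Suc that by auto
    have "0 \<le> exp_coeff h n" unfolding Suc exp_coeff.simps(2)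
      using IH hh by (intro divide_nonneg_nonneg sum_nonneg mult_nonneg_nonneg) auto
    moreover have "(\<Sum>i\<le>m. real (Suc i) * h (Suc i) * exp_coeff h (m - i))
      \<le> (\<Sum>i\<le>m. real (Suc i) * h' (Suc i) * exp_coeff h' (m - i))"
    proof (intro sum_mono mult_mono)
      fix i assume "i \<in> {..m}"
      then have "0 \<le> h (Suc i) \<and> h (Suc i) \<le> h' (Suc i)" using hh by auto
      then show "0 \<le> real (Suc i) * h' (Suc i)" "h (Suc i) \<le> h' (Suc i)" "0 \<le> h (Suc i)" by auto
    qed (use IH in auto)
    ultimately show ?thesis unfolding Suc exp_coeff.simps(2) by (auto intro!: divide_right_mono)
  qed simp
qed

text \<open>
  The exponential of the finite sum of the \<open>w t * x ^ s t\<close>.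
\<close>

definition exp_product :: "'t set \<Rightarrow> ('t \<Rightarrow> nat) \<Rightarrow> ('t \<Rightarrow> real) \<Rightarrow> real fps" where
  "exp_product T s w = (\<Prod>t\<in>T. block_series (s t) (\<lambda>c. w t ^ c / fact c))"

lemma deriv_block_series_exp:
  assumes s: "s \<ge> 1"
  shows "fps_deriv (block_series s (\<lambda>c. w ^ c / fact c))
    = fps_const (real s * w) * fps_X ^ (s - 1) * block_series s (\<lambda>c. w ^ c / fact c)" (is "?L = ?R")
proof (rule fps_ext)
  fix k
  have R: "fps_nth ?R k = (if k < s - 1 then 0
     else real s * w * fps_nth (block_series s (\<lambda>c. w ^ c / fact c)) (k - (s - 1)))"
    by (simp add: mult.assoc fps_X_power_mult_nth)
  show "fps_nth ?L k = fps_nth ?R k"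
  proof (cases "s dvd Suc k")
    case True
    then obtain c where c: "Suc k = s * c" by blast
    then obtain d where d: "c = Suc d" by (cases c) auto
    have k: "k - (s - 1) = s * d" "\<not> k < s - 1" using c d s by (auto simp: algebra_simps)
    have 1: "real (Suc k) = real s * real (Suc d)" unfolding c d by (rule of_nat_mult)
    have "fps_nth (block_series s (\<lambda>c. w ^ c / fact c)) (Suc k) = w ^ Suc d / fact (Suc d)"
      unfolding block_series_nth c d using s by (simp del: power_Suc fact_Suc mult_Suc_right)
    then have "fps_nth ?L k = real s * real (Suc d) * (w ^ Suc d / fact (Suc d))"
      unfolding fps_deriv_nth 1[symmetric] by simp
    also have "\<dots> = real s * w * (w ^ d / fact d)" by (simp add: field_simps del: of_nat_Suc)
    also have "\<dots> = fps_nth ?R k" unfolding R using k s by (simp add: block_series_nth)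
    finally show ?thesis .
  next
    case False
    have "\<not> s dvd k - (s - 1)" if "\<not> k < s - 1"
    proof
      assume "s dvd k - (s - 1)"
      then have "s dvd k - (s - 1) + s" by simp
      also have "k - (s - 1) + s = Suc k" using that s by simp
      finally show False using False by simp
    qed
    then show ?thesis using False R by (simp add: block_series_nth)
  qed
qed

lemma exp_product_eq_exp_coeff:
  assumes T: "finite T" and s: "\<And>t. t \<in> T \<Longrightarrow> s t \<ge> 1"
  shows "fps_nth (exp_product T s w) n = exp_coeff (\<lambda>k. \<Sum>t | t \<in> T \<and> s t = k. w t) n"
proof -
  have deriv: "fps_deriv (exp_product T s w)
     = (\<Sum>t\<in>T. fps_const (real (s t) * w t) * fps_X ^ (s t - 1)) * exp_product T s w"
    using T s unfolding exp_product_def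
  proof (induction T rule: finite_induct)
    case (insert x T)
    have d: "fps_deriv (block_series (s x) (\<lambda>c. w x ^ c / fact c))
       = fps_const (real (s x) * w x) * fps_X ^ (s x - 1) * block_series (s x) (\<lambda>c. w x ^ c / fact c)"
      by (rule deriv_block_series_exp) (use insert.prems in auto)
    show ?case using insert by (simp add: fps_deriv_mult d algebra_simps)
  qed simp
  let ?h = "\<lambda>k. \<Sum>t | t \<in> T \<and> s t = k. w t"
  let ?E = "exp_product T s w"
  show ?thesis
  proof (induction n rule: less_induct)
    case (less n)
    show ?case
    proof (cases n)
      case 0
      have 0: "fps_nth (block_series (s t) (\<lambda>c. w t ^ c / fact c)) 0 = 1" for t by (simp add: block_series_nth)
      have "fps_nth (\<Prod>t\<in>S. block_series (s t) (\<lambda>c. w t ^ c / fact c)) 0 = 1" if "finite S" for S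
        using that by (induction S rule: finite_induct) (simp_all add: 0)
      then have "fps_nth ?E 0 = 1" unfolding exp_product_def using T by simp
      then show ?thesis using \<open>n = 0\<close> by simp
    next
      case (Suc m)
      have "real (Suc m) * fps_nth ?E (Suc m) = fps_nth (fps_deriv ?E) m" by simp
      also have "\<dots> = (\<Sum>i\<le>m. (\<Sum>t\<in>T. if s t - 1 = i then real (s t) * w t else 0) * fps_nth ?E (m - i))"
        unfolding deriv fps_mult_nth[of "\<Sum>t\<in>T. _ t"] atLeast0AtMost fps_sum_nth
        by (intro sum.cong refl arg_cong2[where f = "(*)"]) auto
      also have "\<dots> = (\<Sum>i\<le>m. real (Suc i) * ?h (Suc i) * exp_coeff ?h (m - i))"
      proof (intro sum.cong refl)
        fix i assume i: "i \<in> {..m}"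
        have "(\<Sum>t\<in>T. if s t - 1 = i then real (s t) * w t else 0) = (\<Sum>t | t \<in> T \<and> s t = Suc i. real (Suc i) * w t)"
          using T s by (subst sum.inter_filter) (auto intro!: sum.cong simp del: of_nat_Suc dest: s)
        moreover have "fps_nth ?E (m - i) = exp_coeff ?h (m - i)" using less Suc by simp
        ultimately show "(\<Sum>t\<in>T. if s t - 1 = i then real (s t) * w t else 0) * fps_nth ?E (m - i)
           = real (Suc i) * ?h (Suc i) * exp_coeff ?h (m - i)"
          by (simp add: sum_distrib_left)
      qed
      finally show ?thesis unfolding Suc exp_coeff.simps(2) by (simp add: field_simps del: of_nat_Suc)
    qed
  qed
qed

lemma exp_product_le_exp_coeff:
  assumes T: "finite T" and s: "\<And>t. t \<in> T \<Longrightarrow> s t \<ge> 1" and w: "\<And>t. t \<in> T \<Longrightarrow> w t \<ge> 0"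
    and h: "\<And>k. k \<in> {1..n} \<Longrightarrow> (\<Sum>t | t \<in> T \<and> s t = k. w t) \<le> h k"
  shows "fps_nth (exp_product T s w) n \<le> exp_coeff h n"
proof -
  have "fps_nth (exp_product T s w) n = exp_coeff (\<lambda>k. \<Sum>t | t \<in> T \<and> s t = k. w t) n"
    using T s by (rule exp_product_eq_exp_coeff)
  also have "\<dots> \<le> exp_coeff h n"
    by (rule exp_coeff_mono[THEN conjunct2]) (use h w in \<open>auto intro!: sum_nonneg\<close>)
  finally show ?thesis .
qed

lemma sum_exp_coeff_le:
  assumes h: "\<And>k. k \<ge> 1 \<Longrightarrow> h k \<ge> 0"
  shows "(\<Sum>n\<le>N. exp_coeff h n) \<le> exp (\<Sum>k=1..N. h k)"
proof -
  let ?E = "exp_product {1..N} (\<lambda>k. k) h"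
  have "exp_coeff h n \<le> fps_nth ?E n" if n: "n \<le> N" for n
  proof -
    have "(\<Sum>t | t \<in> {1..N} \<and> t = k. h t) = h k" if "k \<in> {1..n}" for k
    proof -
      have "{t. t \<in> {1..N} \<and> t = k} = {k}" using that n by auto
      then show ?thesis by simp
    qed
    then have "exp_coeff h n \<le> exp_coeff (\<lambda>k. \<Sum>t | t \<in> {1..N} \<and> (\<lambda>k. k) t = k. h t) n"
      using exp_coeff_mono[of n h "\<lambda>k. \<Sum>t | t \<in> {1..N} \<and> t = k. h t"] h by simp
    also have "\<dots> = fps_nth ?E n" by (rule exp_product_eq_exp_coeff[symmetric]) auto
    finally show ?thesis .
  qed
  then have "(\<Sum>n\<le>N. exp_coeff h n) \<le> partial_eval N 1 ?E" by (auto simp: partial_eval_def intro!: sum_mono)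
  also have "\<dots> \<le> (\<Prod>k=1..N. partial_eval N 1 (block_series k (\<lambda>c. h k ^ c / fact c)))"
    unfolding exp_product_def using h by (intro partial_eval_prod_le nonneg_block_series) auto
  also have "\<dots> \<le> (\<Prod>k=1..N. exp (h k))"
  proof (intro prod_mono conjI)
    fix k assume k: "k \<in> {1..N}"
    show "0 \<le> partial_eval N 1 (block_series k (\<lambda>c. h k ^ c / fact c))"
      using h k by (intro partial_eval_nonneg nonneg_block_series) auto
    show "partial_eval N 1 (block_series k (\<lambda>c. h k ^ c / fact c)) \<le> exp (h k)"
      using partial_eval_block_series_le[of k 1 "\<lambda>c. h k ^ c / fact c" "h k" N] h k by auto
  qed
  also have "\<dots> = exp (\<Sum>k=1..N. h k)" by (simp add: exp_sum)
  finally show ?thesis .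
qed

section \<open>Coefficients of order \<open>1 / n\<^sup>2\<close>\<close>

lemma sum_inverse_squares_le:
  assumes "K \<ge> 1"
  shows "(\<Sum>k=Suc K..n. 1 / real k ^ 2) \<le> 1 / real K"
proof -
  have telescope: "(\<Sum>k=Suc K..n. 1 / real k ^ 2) \<le> 1 / real K - 1 / real n" if "n \<ge> K" for n
    using that
  proof (induction n rule: dec_induct)
    case (step n)
    have "n \<ge> 1" using step assms by linarith
    have "1 / real (Suc n) ^ 2 \<le> 1 / (real n * real (Suc n))"
      using \<open>n \<ge> 1\<close> by (intro divide_left_mono) (auto simp: power2_eq_square)
    also have "\<dots> = 1 / real n - 1 / real (Suc n)" using \<open>n \<ge> 1\<close> by (simp add: field_simps)
    finally show ?case using step by (simp del: of_nat_Suc)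
  qed simp
  show ?thesis
  proof (cases "n \<ge> K")
    case True
    have "1 / real K - 1 / real n \<le> 1 / real K" by simp
    then show ?thesis using telescope[OF True] by linarith
  qed simp
qed

lemma bounded_coeff_of_tendsto:
  assumes "(\<lambda>n. real n ^ 2 * f n) \<longlonglongrightarrow> l"
  shows "\<exists>C>0. \<forall>n. real n ^ 2 * \<bar>f n\<bar> \<le> C"
proof -
  have "Bseq (\<lambda>n. real n ^ 2 * f n)" using assms by (intro convergent_imp_Bseq convergentI)
  then obtain C where "C > 0" "\<And>n. norm (real n ^ 2 * f n) \<le> C" by (auto elim: BseqE)
  then show ?thesis by (intro exI[of _ C]) (auto simp: abs_mult)
qed

lemma summable_of_bounded_coeff:
  fixes f :: "nat \<Rightarrow> real"
  assumes "\<And>n. real n ^ 2 * \<bar>f n\<bar> \<le> C"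
  shows "summable f"
proof (rule summable_comparison_test_ev)
  show "eventually (\<lambda>n. norm (f n) \<le> C * (1 / real n ^ 2)) sequentially"
    using eventually_ge_at_top[of 1]
  proof eventually_elim
    case (elim n)
    then show ?case using assms[of n] by (simp add: field_simps)
  qed
  show "summable (\<lambda>n. C * (1 / real n ^ 2))"
    using inverse_power_summable[of 2, where 'a = real] by (intro summable_mult) (simp add: field_simps)
qed

lemma tendsto_shift_square:
  assumes "(\<lambda>n. real n ^ 2 * g n) \<longlonglongrightarrow> (l :: real)"
  shows "(\<lambda>n. real n ^ 2 * g (n - m)) \<longlonglongrightarrow> l"
proof -
  have "(\<lambda>n. (real (n + m) / real n) ^ 2 * (real n ^ 2 * g n)) \<longlonglongrightarrow> 1 ^ 2 * l"
  proof (intro tendsto_mult tendsto_power assms)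
    show "(\<lambda>n. real (n + m) / real n) \<longlonglongrightarrow> 1" by real_asymp
  qed
  moreover have "eventually (\<lambda>n. (real (n + m) / real n) ^ 2 * (real n ^ 2 * g n) = real (n + m) ^ 2 * g (n + m - m)) sequentially"
    using eventually_gt_at_top[of 0] by eventually_elim (simp add: field_simps)
  ultimately have "(\<lambda>n. real (n + m) ^ 2 * g (n + m - m)) \<longlonglongrightarrow> 1 ^ 2 * l"
    by (rule Lim_transform_eventually)
  then have "(\<lambda>n. real (n + m) ^ 2 * g (n + m - m)) \<longlonglongrightarrow> l" by (simp only: power_one mult_1)
  then show ?thesis by (rule LIMSEQ_offset)
qed

text \<open>
  The part of a convolution in which \<open>g\<close> has an argument of at least \<open>n / 2\<close>; there \<open>n\<^sup>2 g (n - m)\<close> is bounded, and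
  Tannery's theorem applies. The relation \<open>R\<close> selects the summands, so that a convolution can be cut into two such parts.
\<close>

lemma half_convolution_tendsto:
  fixes f g :: "nat \<Rightarrow> real"
  assumes f: "summable (\<lambda>n. \<bar>f n\<bar>)" and g: "(\<lambda>n. real n ^ 2 * g n) \<longlonglongrightarrow> l"
    and r: "\<And>m. eventually (\<lambda>n. R m n) sequentially" "\<And>m n. R m n \<Longrightarrow> 2 * m \<le> n"
  shows "(\<lambda>n. real n ^ 2 * (\<Sum>m | m \<le> n \<and> R m n. f m * g (n - m))) \<longlonglongrightarrow> l * suminf f"
proof -
  obtain C where C: "C > 0" "\<And>n. real n ^ 2 * \<bar>g n\<bar> \<le> C" using bounded_coeff_of_tendsto[OF g] by blast
  let ?a = "\<lambda>m n. if R m n then f m * (real n ^ 2 * g (n - m)) else 0"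
  have bound: "norm (?a m n) \<le> 4 * C * \<bar>f m\<bar>" for m n
  proof (cases "R m n")
    case True
    then have "real n \<le> 2 * real (n - m)" using r(2)[of m n] by linarith
    then have "real n ^ 2 \<le> (2 * real (n - m)) ^ 2" by (rule power_mono) simp
    then have "real n ^ 2 * \<bar>g (n - m)\<bar> \<le> (2 * real (n - m)) ^ 2 * \<bar>g (n - m)\<bar>"
      by (rule mult_right_mono) simp
    also have "\<dots> = 4 * (real (n - m) ^ 2 * \<bar>g (n - m)\<bar>)" by (simp add: power_mult_distrib)
    also have "\<dots> \<le> 4 * C" using C(2)[of "n - m"] by simp
    finally have "\<bar>f m\<bar> * (real n ^ 2 * \<bar>g (n - m)\<bar>) \<le> \<bar>f m\<bar> * (4 * C)" by (rule mult_left_mono) simp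
    then show ?thesis using True by (simp add: abs_mult mult_ac)
  qed (use C in simp)
  have "(\<lambda>n. suminf (\<lambda>m. ?a m n)) \<longlonglongrightarrow> suminf (\<lambda>m. f m * l)"
  proof (rule tannerys_theorem[THEN conjunct2, THEN conjunct2])
    show "(\<lambda>n. ?a m n) \<longlonglongrightarrow> f m * l" for m
    proof -
      have "(\<lambda>n. f m * (real n ^ 2 * g (n - m))) \<longlonglongrightarrow> f m * l"
        by (intro tendsto_mult tendsto_const tendsto_shift_square g)
      moreover have "eventually (\<lambda>n. f m * (real n ^ 2 * g (n - m)) = ?a m n) sequentially"
        using r(1)[of m] by eventually_elim simp
      ultimately show ?thesis by (simp add: tendsto_cong)
    qed
    show "eventually (\<lambda>(m, n). norm (?a m n) \<le> 4 * C * \<bar>f m\<bar>) (sequentially \<times>\<^sub>F sequentially)"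
      using bound by (intro always_eventually) auto
    show "summable (\<lambda>m. 4 * C * \<bar>f m\<bar>)" using f by (rule summable_mult)
  qed simp
  moreover have "suminf (\<lambda>m. ?a m n) = real n ^ 2 * (\<Sum>m | m \<le> n \<and> R m n. f m * g (n - m))" for n
  proof -
    have "suminf (\<lambda>m. ?a m n) = (\<Sum>m | m \<le> n \<and> R m n. ?a m n)"
    proof (rule suminf_finite)
      have "m \<le> n" if "R m n" for m using r(2)[OF that] by linarith
      then show "?a m n = 0" if "m \<notin> {m. m \<le> n \<and> R m n}" for m using that by auto
    qed simp
    also have "\<dots> = (\<Sum>m | m \<le> n \<and> R m n. real n ^ 2 * (f m * g (n - m)))"
      by (intro sum.cong) (auto simp: mult_ac)
    finally show ?thesis by (simp add: sum_distrib_left)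
  qed
  moreover have "suminf (\<lambda>m. f m * l) = l * suminf f"
    using suminf_mult[OF summable_rabs_cancel[OF f], of l] by (simp only: mult.commute)
  ultimately show ?thesis by simp
qed

text \<open>
  In one half of the convolution \<open>G\<close> has the large argument, which yields the limit. In the other half the roles
  are exchanged, and the limit 0 of \<open>n\<^sup>2 F n\<close> makes the contribution disappear.
\<close>

theorem convolution_tendsto:
  fixes F G :: "real fps"
  assumes F: "(\<lambda>n. real n ^ 2 * fps_nth F n) \<longlonglongrightarrow> 0" and G: "(\<lambda>n. real n ^ 2 * fps_nth G n) \<longlonglongrightarrow> l"
  shows "(\<lambda>n. real n ^ 2 * fps_nth (F * G) n) \<longlonglongrightarrow> l * (\<Sum>n. fps_nth F n)"
proof -
  have sum: "summable (\<lambda>n. \<bar>fps_nth H n\<bar>)" if "(\<lambda>n. real n ^ 2 * fps_nth H n) \<longlonglongrightarrow> l'" for H l'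
  proof -
    from bounded_coeff_of_tendsto[OF that] obtain C where "\<And>n. real n ^ 2 * \<bar>fps_nth H n\<bar> \<le> C" by blast
    then show ?thesis by (intro summable_of_bounded_coeff[of _ C]) auto
  qed
  let ?f = "fps_nth F" and ?g = "fps_nth G"
  have "(\<lambda>n. real n ^ 2 * (\<Sum>m | m \<le> n \<and> 2 * m \<le> n. ?f m * ?g (n - m))
      + real n ^ 2 * (\<Sum>m | m \<le> n \<and> 2 * m < n. ?g m * ?f (n - m))) \<longlonglongrightarrow> l * suminf ?f + 0 * suminf ?g"
    by (intro tendsto_add half_convolution_tendsto sum[OF F] sum[OF G] F G)
      (auto intro: eventually_ge_at_top eventually_gt_at_top)
  moreover have "real n ^ 2 * (\<Sum>m | m \<le> n \<and> 2 * m \<le> n. ?f m * ?g (n - m))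
      + real n ^ 2 * (\<Sum>m | m \<le> n \<and> 2 * m < n. ?g m * ?f (n - m)) = real n ^ 2 * fps_nth (F * G) n" for n
  proof -
    have "(\<Sum>m | m \<le> n \<and> 2 * m < n. ?g m * ?f (n - m)) = (\<Sum>m | m \<le> n \<and> \<not> 2 * m \<le> n. ?f m * ?g (n - m))"
      by (rule sum.reindex_bij_witness[where i = "\<lambda>m. n - m" and j = "\<lambda>m. n - m"]) auto
    moreover have "fps_nth (F * G) n = (\<Sum>m | m \<le> n \<and> 2 * m \<le> n. ?f m * ?g (n - m))
       + (\<Sum>m | m \<le> n \<and> \<not> 2 * m \<le> n. ?f m * ?g (n - m))"
      unfolding fps_mult_nth by (subst sum.union_disjoint[symmetric]) (auto intro!: sum.cong)
    ultimately show ?thesis by (simp add: distrib_left)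
  qed
  ultimately show ?thesis by simp
qed

lemma geometric_coeff_tendsto:
  assumes "nonneg_series F" "\<And>N. partial_eval N 2 F \<le> C"
  shows "(\<lambda>n. real n ^ 2 * fps_nth F n) \<longlonglongrightarrow> 0"
proof (rule tendsto_sandwich[OF _ _ tendsto_const])
  have "fps_nth F n * 2 ^ n \<le> C" for n
  proof -
    have "fps_nth F n * 2 ^ n \<le> partial_eval n 2 F"
      unfolding partial_eval_def using assms(1) by (intro member_le_sum) (auto simp: nonneg_series_def)
    then show ?thesis using assms(2)[of n] by linarith
  qed
  then have "real n ^ 2 * fps_nth F n \<le> C * (real n ^ 2 / 2 ^ n)" for n
  proof -
    have "real n ^ 2 * (fps_nth F n * 2 ^ n) \<le> real n ^ 2 * C"
      using \<open>\<And>n. fps_nth F n * 2 ^ n \<le> C\<close> by (rule mult_left_mono) simp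
    then show ?thesis by (simp add: field_simps)
  qed
  then show "eventually (\<lambda>n. real n ^ 2 * fps_nth F n \<le> C * (real n ^ 2 / 2 ^ n)) sequentially" by simp
  have "(\<lambda>n. C * (real n ^ 2 / 2 ^ n)) \<longlonglongrightarrow> C * 0" 
    by (intro tendsto_mult tendsto_const) real_asymp
  then show "(\<lambda>n. C * (real n ^ 2 / 2 ^ n)) \<longlonglongrightarrow> 0" by simp
  show "eventually (\<lambda>n. 0 \<le> real n ^ 2 * fps_nth F n) sequentially"
    using assms(1) by (auto simp: nonneg_series_def)
qed

section \<open>The diagonal factor\<close>

text \<open>
  The factor \<open>I(x ^ a / a\<^sup>2)\<close>: both permutations have the same number of cycles of length \<open>a\<close>.
\<close>

definition square_series :: "nat \<Rightarrow> real fps" where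
  "square_series a = block_series a (\<lambda>c. (1 / (real a ^ c * fact c)) ^ 2)"

definition diag_upto :: "nat \<Rightarrow> real fps" where
  "diag_upto N = (\<Prod>a=3..N. square_series a)"

text \<open>
  The \<open>n\<close>-th coefficient of the infinite product over \<open>a \<ge> 3\<close>, to which the factors with \<open>a > n\<close> do not contribute.
\<close>

definition diag :: "nat \<Rightarrow> real" where
  "diag n = fps_nth (diag_upto n) n"

lemma nonneg_square_series: "nonneg_series (square_series a)"
  by (simp add: square_series_def nonneg_block_series)

lemma nonneg_diag_upto: "nonneg_series (diag_upto N)"
  unfolding diag_upto_def by (intro nonneg_series_prod nonneg_square_series)

lemma partial_eval_square_series:
  assumes "a \<ge> 1" "r \<ge> 0"
  shows "partial_eval N r (square_series a) \<le> exp (1 / real a ^ 2 * r ^ a)"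
  unfolding square_series_def
proof (rule partial_eval_block_series_le[OF assms])
  fix c
  have "(1 / real a ^ 2) ^ c / fact c * (1 / fact c) \<le> (1 / real a ^ 2) ^ c / fact c * 1"
    by (intro mult_left_mono) (auto simp: fact_ge_1)
  then show "(1 / (real a ^ c * fact c)) ^ 2 \<le> (1 / real a ^ 2) ^ c / fact c"
    by (simp add: power_divide power_mult_distrib power2_eq_square power_mult mult_ac)
qed auto

text \<open>
  The weight of \<open>c\<close> cycles of length \<open>a\<close> in both permutations is \<open>1 / (a c)\<^sup>2\<close> times the weight of \<open>c - 1\<close> such cycles. This factor is
  at most \<open>1 / a\<^sup>2\<close>, with equality for \<open>c = 1\<close>.
\<close>

lemma diag_upto_step:
  assumes a: "a \<ge> 3"
  shows "fps_nth (diag_upto a) n \<le> fps_nth (diag_upto (a - 1)) n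
      + (if a \<le> n then fps_nth (diag_upto a) (n - a) / real a ^ 2 else 0)" (is ?up)
    and "fps_nth (diag_upto a) n \<ge> fps_nth (diag_upto (a - 1)) n
      + (if a \<le> n then fps_nth (diag_upto (a - 1)) (n - a) / real a ^ 2 else 0)" (is ?lo)
proof -
  let ?P = "diag_upto (a - 1)" and ?B = "square_series a"
  have "{3..a} = insert a {3..a - 1}" using a by auto
  then have P: "diag_upto a = ?P * ?B" using a by (simp add: diag_upto_def mult.commute)
  let ?X = "fps_const (1 / real a ^ 2) * fps_X ^ a :: real fps"
  have X: "fps_nth (?X * F) k = (if a \<le> k then fps_nth F (k - a) / real a ^ 2 else 0)" for F k
    by (simp add: mult.assoc fps_X_power_mult_nth)
  have B: "fps_nth ?B k = (if a dvd k then (1 / (real a ^ (k div a) * fact (k div a))) ^ 2 else 0)" for k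
    by (simp add: square_series_def block_series_nth)
  have "fps_nth ?B k \<le> fps_nth (1 + ?X * ?B) k" for k
  proof (cases "k = 0 \<or> \<not> a dvd k")
    case True
    then show ?thesis using a nonneg_seriesD[OF nonneg_square_series[of a], of "k - a"] by (auto simp: X B)
  next
    case False
    then obtain c where c: "k = a * Suc c" by (metis dvdE mult_0_right not0_implies_Suc)
    have "fps_nth ?B k = (1 / (real a ^ Suc c * fact (Suc c))) ^ 2" using a by (simp add: B c)
    also have "\<dots> = (1 / (real a ^ c * fact c)) ^ 2 / real a ^ 2 * (1 / real (Suc c) ^ 2)"
      by (simp add: power_divide power_mult_distrib field_simps del: of_nat_Suc)
    also have "\<dots> \<le> (1 / (real a ^ c * fact c)) ^ 2 / real a ^ 2 * 1"
      by (intro mult_left_mono) auto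
    also have "\<dots> = fps_nth (?X * ?B) k" using a by (simp add: X B c)
    finally show ?thesis using c a by simp
  qed
  then have "fps_nth (?P * ?B) n \<le> fps_nth (?P * (1 + ?X * ?B)) n"
    by (rule fps_mult_mono[OF nonneg_diag_upto])
  also have "?P * (1 + ?X * ?B) = ?P + ?X * (?P * ?B)" by (simp add: algebra_simps)
  finally show ?up unfolding P fps_add_nth X .
  have "fps_nth (1 + ?X) k \<le> fps_nth ?B k" for k
    using a by (auto simp: B power2_eq_square)
  then have "fps_nth (?P * (1 + ?X)) n \<le> fps_nth (?P * ?B) n"
    by (rule fps_mult_mono[OF nonneg_diag_upto])
  also have "?P * (1 + ?X) = ?P + ?X * ?P" by (simp add: algebra_simps)
  finally show ?lo unfolding P fps_add_nth X .
qed

lemma diag_upto_stable: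
  assumes "n \<le> N"
  shows "fps_nth (diag_upto N) n = diag n"
  using assms
proof (induction N rule: dec_induct)
  case (step N)
  show ?case
  proof (cases "Suc N \<ge> 3")
    case True
    then show ?thesis using diag_upto_step[OF True, of n] step by simp
  next
    case False
    then have "diag_upto (Suc N) = diag_upto N" by (simp add: diag_upto_def)
    then show ?thesis using step by simp
  qed
qed (simp add: diag_def)

lemma diag_upto_mono_Suc: "fps_nth (diag_upto N) n \<le> fps_nth (diag_upto (Suc N)) n"
proof (cases "Suc N \<ge> 3")
  case True
  have "fps_nth (diag_upto N) (n - Suc N) / real (Suc N) ^ 2 \<ge> 0"
    by (intro divide_nonneg_nonneg nonneg_seriesD[OF nonneg_diag_upto]) auto
  then show ?thesis using diag_upto_step(2)[OF True, of n] by (auto split: if_splits)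
qed (simp add: diag_upto_def)

lemma diag_upto_le: "fps_nth (diag_upto N) n \<le> diag n"
proof -
  have "fps_nth (diag_upto N) n \<le> fps_nth (diag_upto (max N n)) n"
    by (rule lift_Suc_mono_le[of "\<lambda>N. fps_nth (diag_upto N) n"]) (auto intro: diag_upto_mono_Suc)
  then show ?thesis by (simp add: diag_upto_stable)
qed

lemma diag_nonneg: "diag n \<ge> 0"
  unfolding diag_def by (rule nonneg_seriesD[OF nonneg_diag_upto])

text \<open>
  The two inequalities below arise by removing a longest cycle. In the lower bound this cycle is longer than \<open>n / 2\<close>,
  hence the only one of its length.
\<close>

lemma diag_upper:
  assumes K: "K \<ge> 2"
  shows "diag n \<le> fps_nth (diag_upto K) n + (\<Sum>a | K < a \<and> a \<le> n. diag (n - a) / real a ^ 2)"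
proof (cases "n \<ge> K")
  case True
  have "fps_nth (diag_upto N) n \<le> fps_nth (diag_upto K) n + (\<Sum>a=Suc K..N. if a \<le> n then diag (n - a) / real a ^ 2 else 0)"
    if "N \<ge> K" for N using that
  proof (induction N rule: dec_induct)
    case (step N)
    have "fps_nth (diag_upto (Suc N)) n \<le> fps_nth (diag_upto N) n
      + (if Suc N \<le> n then fps_nth (diag_upto (Suc N)) (n - Suc N) / real (Suc N) ^ 2 else 0)"
      using diag_upto_step(1)[of "Suc N" n] step K by simp
    also have "\<dots> \<le> fps_nth (diag_upto N) n + (if Suc N \<le> n then diag (n - Suc N) / real (Suc N) ^ 2 else 0)"
      using diag_upto_le by (auto intro!: divide_right_mono)
    finally show ?case using step by simp
  qed simp
  from this[OF True] have "diag n \<le> fps_nth (diag_upto K) n + (\<Sum>a=Suc K..n. if a \<le> n then diag (n - a) / real a ^ 2 else 0)"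
    by (simp add: diag_def)
  also have "(\<Sum>a=Suc K..n. if a \<le> n then diag (n - a) / real a ^ 2 else 0)
     = (\<Sum>a | K < a \<and> a \<le> n. diag (n - a) / real a ^ 2)"
    by (intro sum.cong) auto
  finally show ?thesis .
next
  case False
  then have "fps_nth (diag_upto K) n = diag n" by (intro diag_upto_stable) auto
  moreover have "(\<Sum>a | K < a \<and> a \<le> n. diag (n - a) / real a ^ 2) \<ge> 0"
    by (intro sum_nonneg divide_nonneg_nonneg diag_nonneg) auto
  ultimately show ?thesis by simp
qed

lemma diag_lower:
  "(\<Sum>a | 3 \<le> a \<and> a \<le> n \<and> n < 2 * a. diag (n - a) / real a ^ 2) \<le> diag n"
proof -
  have "(\<Sum>a | 3 \<le> a \<and> a \<le> N \<and> a \<le> n \<and> n < 2 * a. diag (n - a) / real a ^ 2) \<le> fps_nth (diag_upto N) n" for N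
  proof (induction N)
    case 0
    then show ?case using nonneg_seriesD[OF nonneg_diag_upto] by (auto intro: sum_nonpos)
  next
    case (Suc N)
    show ?case
    proof (cases "3 \<le> Suc N \<and> Suc N \<le> n \<and> n < 2 * Suc N")
      case True
      then have "{a. 3 \<le> a \<and> a \<le> Suc N \<and> a \<le> n \<and> n < 2 * a}
        = insert (Suc N) {a. 3 \<le> a \<and> a \<le> N \<and> a \<le> n \<and> n < 2 * a}" by auto
      then have "(\<Sum>a | 3 \<le> a \<and> a \<le> Suc N \<and> a \<le> n \<and> n < 2 * a. diag (n - a) / real a ^ 2)
        = diag (n - Suc N) / real (Suc N) ^ 2 + (\<Sum>a | 3 \<le> a \<and> a \<le> N \<and> a \<le> n \<and> n < 2 * a. diag (n - a) / real a ^ 2)"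
        by (simp del: of_nat_Suc)
      also have "diag (n - Suc N) = fps_nth (diag_upto N) (n - Suc N)"
        using True by (intro diag_upto_stable[symmetric]) auto
      finally show ?thesis using Suc True diag_upto_step(2)[of "Suc N" n] by simp
    next
      case False
      then have "{a. 3 \<le> a \<and> a \<le> Suc N \<and> a \<le> n \<and> n < 2 * a} = {a. 3 \<le> a \<and> a \<le> N \<and> a \<le> n \<and> n < 2 * a}"
        using le_Suc_eq by auto
      moreover have "fps_nth (diag_upto N) n \<le> fps_nth (diag_upto (Suc N)) n"
        by (rule diag_upto_mono_Suc)
      ultimately show ?thesis using Suc by simp
    qed
  qed
  from this[of n] show ?thesis by (simp add: diag_def cong: conj_cong)
qed

lemma diag_upto_tendsto: "(\<lambda>n. real n ^ 2 * fps_nth (diag_upto K) n) \<longlonglongrightarrow> 0"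
proof (rule geometric_coeff_tendsto[OF nonneg_diag_upto])
  fix N
  have "partial_eval N 2 (diag_upto K) \<le> (\<Prod>a=3..K. partial_eval N 2 (square_series a))"
    unfolding diag_upto_def by (intro partial_eval_prod_le nonneg_square_series) auto
  also have "\<dots> \<le> (\<Prod>a=3..K. exp (1 / real a ^ 2 * 2 ^ a))"
    by (intro prod_mono conjI partial_eval_nonneg nonneg_square_series partial_eval_square_series) auto
  finally show "partial_eval N 2 (diag_upto K) \<le> (\<Prod>a=3..K. exp (1 / real a ^ 2 * 2 ^ a))" .
qed

lemma sum_diag_le: "(\<Sum>n\<le>N. diag n) \<le> exp 1"
proof -
  have "(\<Sum>n\<le>N. diag n) = partial_eval N 1 (diag_upto N)"
    by (simp add: partial_eval_def diag_upto_stable)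
  also have "\<dots> \<le> (\<Prod>a=3..N. partial_eval N 1 (square_series a))"
    unfolding diag_upto_def by (intro partial_eval_prod_le nonneg_square_series) auto
  also have "\<dots> \<le> (\<Prod>a=3..N. exp (1 / real a ^ 2 * 1 ^ a))"
    by (intro prod_mono conjI partial_eval_nonneg nonneg_square_series partial_eval_square_series) auto
  also have "\<dots> = exp (\<Sum>a=3..N. 1 / real a ^ 2)" by (simp add: exp_sum)
  also have "\<dots> \<le> exp 1"
    using sum_inverse_squares_le[of 2 N] by (simp add: eval_nat_numeral)
  finally show ?thesis .
qed

lemma summable_diag: "summable diag"
  by (rule bounded_imp_summable[of _ "exp 1"]) (use diag_nonneg sum_diag_le in auto)

text \<open>
  Strong induction on \<open>n\<close>: with \<open>n\<^sup>2 \<le> 2 a\<^sup>2 + 2 (n - a)\<^sup>2\<close> the recursive bound is turned into one for \<open>n\<^sup>2 diag n\<close>.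
  Cycles longer than 8 are removed because \<open>(\<Sum>a>8. 1 / a\<^sup>2) \<le> 1 / 8\<close> makes the coefficient \<open>2 / 8\<close> of the inductive
  bound less than 1.
\<close>

lemma diag_bounded: "\<exists>C\<ge>0. \<forall>n. real n ^ 2 * diag n \<le> C"
proof -
  obtain A where A: "A > 0" "\<And>n. real n ^ 2 * \<bar>fps_nth (diag_upto 8) n\<bar> \<le> A"
    using bounded_coeff_of_tendsto[OF diag_upto_tendsto[of 8]] by blast
  let ?S = "exp 1 :: real"
  \<comment> \<open>The solution of \<open>A + 2 S + C / 4 = C\<close>.\<close>
  define C where "C = 4 / 3 * (A + 2 * ?S)"
  have C0: "C \<ge> 0" using A by (simp add: C_def add_nonneg_nonneg)
  have "real n ^ 2 * diag n \<le> C" for n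
  proof (induction n rule: less_induct)
    case (less n)
    let ?T = "{a. 8 < a \<and> a \<le> n}"
    have "?T = {Suc 8..n}" by auto
    have "real n ^ 2 * diag n \<le> real n ^ 2 * (fps_nth (diag_upto 8) n + (\<Sum>a\<in>?T. diag (n - a) / real a ^ 2))"
      by (intro mult_left_mono diag_upper) auto
    also have "\<dots> = real n ^ 2 * fps_nth (diag_upto 8) n + (\<Sum>a\<in>?T. real n ^ 2 * (diag (n - a) / real a ^ 2))"
      by (simp add: distrib_left sum_distrib_left)
    also have "real n ^ 2 * fps_nth (diag_upto 8) n \<le> A"
      using A(2)[of n] nonneg_seriesD[OF nonneg_diag_upto, of 8 n] by simp
    also have "(\<Sum>a\<in>?T. real n ^ 2 * (diag (n - a) / real a ^ 2)) \<le> (\<Sum>a\<in>?T. 2 * diag (n - a) + 2 * C * (1 / real a ^ 2))"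
    proof (rule sum_mono)
      fix a assume a: "a \<in> ?T"
      have "(x + y) ^ 2 \<le> 2 * x ^ 2 + 2 * y ^ 2" for x y :: real
        using zero_le_power2[of "x - y"] by (simp add: power2_eq_square algebra_simps)
      from this[of "real a" "real (n - a)"] have "real n ^ 2 \<le> 2 * real a ^ 2 + 2 * real (n - a) ^ 2"
        using a by simp
      then have "real n ^ 2 * (diag (n - a) / real a ^ 2) \<le> (2 * real a ^ 2 + 2 * real (n - a) ^ 2) * (diag (n - a) / real a ^ 2)"
        by (intro mult_right_mono divide_nonneg_nonneg diag_nonneg) auto
      also have "\<dots> = 2 * diag (n - a) + 2 * (real (n - a) ^ 2 * diag (n - a)) * (1 / real a ^ 2)"
        using a by (simp add: field_simps)
      also have "\<dots> \<le> 2 * diag (n - a) + 2 * C * (1 / real a ^ 2)"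
        using less[of "n - a"] a by (intro add_mono mult_right_mono) (auto simp: diag_nonneg)
      finally show "real n ^ 2 * (diag (n - a) / real a ^ 2) \<le> 2 * diag (n - a) + 2 * C * (1 / real a ^ 2)" .
    qed
    also have "\<dots> = 2 * (\<Sum>a\<in>?T. diag (n - a)) + 2 * C * (\<Sum>a\<in>?T. 1 / real a ^ 2)"
      by (simp add: sum.distrib sum_distrib_left)
    also have "(\<Sum>a\<in>?T. diag (n - a)) \<le> ?S"
    proof -
      have "(\<Sum>a\<in>?T. diag (n - a)) = sum diag ((\<lambda>a. n - a) ` ?T)"
        by (subst sum.reindex) (auto simp: inj_on_def)
      also have "\<dots> \<le> (\<Sum>m\<le>n. diag m)" by (intro sum_mono2) (auto simp: diag_nonneg)
      finally show ?thesis using sum_diag_le[of n] by simp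
    qed
    also have "2 * C * (\<Sum>a\<in>?T. 1 / real a ^ 2) \<le> 2 * C * (1 / 8)"
      using sum_inverse_squares_le[of 8 n] C0 unfolding \<open>?T = {Suc 8..n}\<close> by (intro mult_left_mono) auto
    also have "A + (2 * ?S + 2 * C * (1 / 8)) = C" by (simp add: C_def field_simps)
    finally show ?case by simp
  qed
  then show ?thesis using C0 by blast
qed

text \<open>
  Removing a cycle longer than \<open>n / 2\<close> gives the term \<open>L\<close>, which has the asserted limit and is a lower bound. Pairs without
  cycles longer than \<open>K\<close> are exponentially rare, and longest cycles between \<open>K\<close> and \<open>n / 2\<close> contribute at most
  \<open>4 C / K\<close> in the limit.
\<close>

theorem diag_tendsto: "(\<lambda>n. real n ^ 2 * diag n) \<longlonglongrightarrow> suminf diag"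
proof -
  obtain C where C: "C \<ge> 0" "\<And>n. real n ^ 2 * diag n \<le> C" using diag_bounded by blast
  define L where "L n = real n ^ 2 * (\<Sum>m | m \<le> n \<and> (2 * m < n \<and> 3 \<le> n - m). diag m * (1 / real (n - m) ^ 2))" for n
  have one: "(\<lambda>n. real n ^ 2 * (1 / real n ^ 2)) \<longlonglongrightarrow> 1" by real_asymp
  have "L \<longlonglongrightarrow> 1 * suminf diag"
    unfolding L_def
  proof (rule half_convolution_tendsto[OF _ one])
    show "summable (\<lambda>n. \<bar>diag n\<bar>)" using summable_diag diag_nonneg by simp
    show "eventually (\<lambda>n. 2 * m < n \<and> 3 \<le> n - m) sequentially" for m
      using eventually_gt_at_top[of "2 * m + 3"] by eventually_elim auto
  qed auto
  then have L: "L \<longlonglongrightarrow> suminf diag" by simp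
  have L_eq: "L n = real n ^ 2 * (\<Sum>a | 3 \<le> a \<and> a \<le> n \<and> n < 2 * a. diag (n - a) / real a ^ 2)" for n
    unfolding L_def
    by (intro arg_cong2[where f = "(*)"] refl sum.reindex_bij_witness[where i = "\<lambda>a. n - a" and j = "\<lambda>a. n - a"]) auto
  \<comment> \<open>\<open>L n\<close> is \<open>n\<^sup>2\<close> times the contribution of a cycle longer than \<open>n / 2\<close>.\<close>
  have lower: "L n \<le> real n ^ 2 * diag n" for n
    unfolding L_eq by (intro mult_left_mono diag_lower) auto
  have upper: "real n ^ 2 * diag n \<le> real n ^ 2 * fps_nth (diag_upto K) n + L n + 4 * C / real K" if K: "K \<ge> 2" for n K
  proof -
    let ?T = "{a. K < a \<and> a \<le> n}"
    let ?U = "{a. 3 \<le> a \<and> a \<le> n \<and> n < 2 * a}" and ?V = "{a. K < a \<and> a \<le> n \<and> 2 * a \<le> n}"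
    have "(\<Sum>a\<in>?T. diag (n - a) / real a ^ 2) \<le> (\<Sum>a\<in>?U \<union> ?V. diag (n - a) / real a ^ 2)"
      using K by (intro sum_mono2 divide_nonneg_nonneg diag_nonneg) auto
    also have "\<dots> = (\<Sum>a\<in>?U. diag (n - a) / real a ^ 2) + (\<Sum>a\<in>?V. diag (n - a) / real a ^ 2)"
      by (intro sum.union_disjoint) auto
    finally have "real n ^ 2 * diag n \<le> real n ^ 2 * (fps_nth (diag_upto K) n
       + ((\<Sum>a\<in>?U. diag (n - a) / real a ^ 2) + (\<Sum>a\<in>?V. diag (n - a) / real a ^ 2)))"
      using diag_upper[OF K, of n] by (intro mult_left_mono) auto
    also have "\<dots> = real n ^ 2 * fps_nth (diag_upto K) n + L n + (\<Sum>a\<in>?V. real n ^ 2 * (diag (n - a) / real a ^ 2))"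
      unfolding L_eq by (simp add: distrib_left sum_distrib_left)
    also have "(\<Sum>a\<in>?V. real n ^ 2 * (diag (n - a) / real a ^ 2)) \<le> (\<Sum>a\<in>?V. 4 * C * (1 / real a ^ 2))"
    proof (rule sum_mono)
      fix a assume a: "a \<in> ?V"
      then have "real n \<le> 2 * real (n - a)" by auto
      then have "real n ^ 2 \<le> (2 * real (n - a)) ^ 2" by (rule power_mono) simp
      then have "real n ^ 2 * diag (n - a) \<le> (2 * real (n - a)) ^ 2 * diag (n - a)"
        by (rule mult_right_mono) (rule diag_nonneg)
      also have "\<dots> \<le> 4 * C" using C(2)[of "n - a"] by (simp add: power_mult_distrib)
      finally have "real n ^ 2 * diag (n - a) * (1 / real a ^ 2) \<le> 4 * C * (1 / real a ^ 2)"
        by (rule mult_right_mono) simp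
      then show "real n ^ 2 * (diag (n - a) / real a ^ 2) \<le> 4 * C * (1 / real a ^ 2)" by simp
    qed
    also have "\<dots> = 4 * C * (\<Sum>a\<in>?V. 1 / real a ^ 2)" by (simp add: sum_distrib_left)
    also have "\<dots> \<le> 4 * C * (\<Sum>a=Suc K..n. 1 / real a ^ 2)"
      using C(1) by (intro mult_left_mono sum_mono2) auto
    also have "\<dots> \<le> 4 * C * (1 / real K)"
      using C(1) K by (intro mult_left_mono sum_inverse_squares_le) auto
    finally show ?thesis by simp
  qed
  show ?thesis
  proof (rule LIMSEQ_I)
    fix e :: real assume e: "e > 0"
    obtain K :: nat where "K > 8 * C / e" using reals_Archimedean2 by blast
    define K' where "K' = max K 2"
    have K: "K' \<ge> 2" "4 * C / real K' < e / 2"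
    proof -
      show "K' \<ge> 2" by (simp add: K'_def)
      have "real K' > 8 * C / e" using \<open>K > 8 * C / e\<close> by (simp add: K'_def)
      then show "4 * C / real K' < e / 2" using e \<open>K' \<ge> 2\<close> by (simp add: field_simps)
    qed
    have "(\<lambda>n. real n ^ 2 * fps_nth (diag_upto K') n + L n) \<longlonglongrightarrow> 0 + suminf diag"
      by (intro tendsto_add diag_upto_tendsto L)
    then have "eventually (\<lambda>n. real n ^ 2 * fps_nth (diag_upto K') n + L n < suminf diag + e / 2) sequentially"
      using e by (intro order_tendstoD(2)) auto
    moreover have "eventually (\<lambda>n. L n > suminf diag - e) sequentially"
      using L e by (intro order_tendstoD(1)) auto
    ultimately have "eventually (\<lambda>n. norm (real n ^ 2 * diag n - suminf diag) < e) sequentially"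
    proof eventually_elim
      case (elim n)
      then show ?case using lower[of n] upper[OF K(1), of n] K(2) by (simp add: abs_less_iff)
    qed
    then show "\<exists>no. \<forall>n\<ge>no. norm (real n ^ 2 * diag n - suminf diag) < e"
      by (simp add: eventually_sequentially)
  qed
qed

text \<open>
  The recurrence for \<open>e\<close> turns cubic decay of \<open>h\<close> into bounds for \<open>n e n\<close>, then \<open>n\<^sup>2 e n\<close>, then \<open>n\<^sup>3 e n\<close>.
\<close>

lemma exp_coeff_tendsto:
  assumes h: "\<And>k. k \<ge> 1 \<Longrightarrow> 0 \<le> h k" "\<And>k. k \<ge> 1 \<Longrightarrow> h k \<le> b / real k ^ 3"
  shows "(\<lambda>n. real n ^ 2 * exp_coeff h n) \<longlonglongrightarrow> 0"
proof -
  have b: "b \<ge> 0" using h[of 1] by simp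
  have e: "exp_coeff h n \<ge> 0" for n using h(1) by (rule exp_coeff_nonneg)
  define S where "S = exp (2 * b)"
  have S0: "S \<ge> 0" by (simp add: S_def)
  have squares: "(\<Sum>k=1..n. 1 / real k ^ 2) \<le> 2" for n
  proof (cases n)
    case (Suc m)
    have "(\<Sum>k=1..n. 1 / real k ^ 2) = 1 + (\<Sum>k=Suc 1..n. 1 / real k ^ 2)"
      using Suc by (subst sum.atLeast_Suc_atMost) auto
    then show ?thesis using sum_inverse_squares_le[of 1 n] by simp
  qed simp
  have h2: "real k * h k \<le> b * (1 / real k ^ 2)" if "k \<ge> 1" for k
  proof -
    have "real k * h k \<le> real k * (b / real k ^ 3)" using h(2)[OF that] by (rule mult_left_mono) simp
    then show ?thesis using that by (simp add: power3_eq_cube power2_eq_square)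
  qed
  have sum_kh: "(\<Sum>k=1..n. real k * h k) \<le> 2 * b" for n
  proof -
    have "(\<Sum>k=1..n. real k * h k) \<le> (\<Sum>k=1..n. b * (1 / real k ^ 2))"
      by (rule sum_mono) (use h2 in auto)
    also have "\<dots> = b * (\<Sum>k=1..n. 1 / real k ^ 2)" by (rule sum_distrib_left[symmetric])
    also have "\<dots> \<le> b * 2" by (rule mult_left_mono[OF squares b])
    finally show ?thesis by simp
  qed
  have sum_h: "(\<Sum>k=1..n. h k) \<le> 2 * b" for n
  proof -
    have "(\<Sum>k=1..n. h k) \<le> (\<Sum>k=1..n. real k * h k)"
    proof (rule sum_mono)
      fix k assume k: "k \<in> {1..n}"
      then have "1 * h k \<le> real k * h k" using h(1) by (intro mult_right_mono) auto
      then show "h k \<le> real k * h k" by simp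
    qed
    then show ?thesis using sum_kh[of n] by linarith
  qed
  have sum_e: "(\<Sum>k=1..n. exp_coeff h (n - k)) \<le> S" for n
  proof -
    have "(\<Sum>k=1..n. exp_coeff h (n - k)) = sum (exp_coeff h) ((\<lambda>k. n - k) ` {1..n})"
      by (subst sum.reindex) (auto simp: inj_on_def)
    also have "\<dots> \<le> (\<Sum>m\<le>n. exp_coeff h m)" using e by (intro sum_mono2) auto
    also have "\<dots> \<le> exp (\<Sum>k=1..n. h k)" using h(1) by (rule sum_exp_coeff_le)
    also have "\<dots> \<le> S" using sum_h by (simp add: S_def)
    finally show ?thesis .
  qed
  have rec: "real n * exp_coeff h n = (\<Sum>k=1..n. real k * h k * exp_coeff h (n - k))" if "n \<ge> 1" for n
  proof -
    from that obtain m where m: "n = Suc m" by (cases n) auto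
    have "(\<Sum>k=1..n. real k * h k * exp_coeff h (n - k)) = (\<Sum>i\<le>m. real (Suc i) * h (Suc i) * exp_coeff h (m - i))"
      by (rule sum.reindex_bij_witness[where i = Suc and j = "\<lambda>k. k - 1"]) (auto simp: m)
    then show ?thesis unfolding m exp_coeff.simps(2) by simp
  qed
  \<comment> \<open>Each further factor \<open>n = k + (n - k)\<close> is absorbed by \<open>h k\<close> or by the bound already obtained.\<close>
  have 1: "real n * exp_coeff h n \<le> b * S" if "n \<ge> 1" for n
  proof -
    have "(\<Sum>k=1..n. real k * h k * exp_coeff h (n - k)) \<le> (\<Sum>k=1..n. b * exp_coeff h (n - k))"
    proof (intro sum_mono mult_right_mono e)
      fix k assume k: "k \<in> {1..n}"
      have "b * (1 / real k ^ 2) \<le> b * 1" using k b by (intro mult_left_mono) auto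
      then show "real k * h k \<le> b" using h2[of k] k by auto
    qed
    also have "\<dots> = b * (\<Sum>k=1..n. exp_coeff h (n - k))" by (rule sum_distrib_left[symmetric])
    also have "\<dots> \<le> b * S" by (rule mult_left_mono[OF sum_e b])
    finally show ?thesis using rec[OF that] by simp
  qed
  have 1: "real n * exp_coeff h n \<le> b * S" for n
    using 1[of n] b S0 by (cases "n = 0") auto
  have 2: "real n ^ 2 * exp_coeff h n \<le> b * S + 2 * b * (b * S)" if "n \<ge> 1" for n
  proof -
    have "real n ^ 2 * exp_coeff h n = real n * (real n * exp_coeff h n)" by (simp add: power2_eq_square)
    also have "\<dots> = (\<Sum>k=1..n. real n * (real k * h k * exp_coeff h (n - k)))"
      unfolding rec[OF that] by (rule sum_distrib_left)
    also have "\<dots> \<le> (\<Sum>k=1..n. b * exp_coeff h (n - k) + real k * h k * (b * S))"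
    proof (rule sum_mono)
      fix k assume k: "k \<in> {1..n}"
      have "real k * (real k * h k) \<le> real k * (b * (1 / real k ^ 2))" using h2[of k] k by (intro mult_left_mono) auto
      also have "\<dots> = b / real k" using k by (simp add: power2_eq_square)
      also have "\<dots> \<le> b / 1" using k b by (intro divide_left_mono) auto
      finally have "real k * (real k * h k) * exp_coeff h (n - k) \<le> b * exp_coeff h (n - k)"
        using e by (intro mult_right_mono) auto
      moreover have "real k * h k * (real (n - k) * exp_coeff h (n - k)) \<le> real k * h k * (b * S)"
        using k h(1) 1[of "n - k"] by (intro mult_left_mono) auto
      moreover have "real n = real k + real (n - k)" using k by auto
      ultimately show "real n * (real k * h k * exp_coeff h (n - k)) \<le> b * exp_coeff h (n - k) + real k * h k * (b * S)"
        by (simp add: algebra_simps del: of_nat_diff)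
    qed
    also have "\<dots> = b * (\<Sum>k=1..n. exp_coeff h (n - k)) + (\<Sum>k=1..n. real k * h k) * (b * S)"
      by (simp add: sum.distrib sum_distrib_left sum_distrib_right)
    also have "\<dots> \<le> b * S + 2 * b * (b * S)"
      using b S0 by (intro add_mono mult_left_mono[OF sum_e] mult_right_mono[OF sum_kh]) auto
    finally show ?thesis .
  qed
  define B where "B = b * S + 2 * b * (b * S)"
  have B0: "B \<ge> 0" using b S0 by (simp add: B_def)
  have 2: "real n ^ 2 * exp_coeff h n \<le> B" for n
    using 2[of n] B0 unfolding B_def by (cases "n = 0") auto
  have 3: "real n ^ 2 * exp_coeff h n \<le> (2 * b * S + 4 * b * B) * (1 / real n)" if "n \<ge> 1" for n
  proof -
    have "real n * (real n ^ 2 * exp_coeff h n) = real n ^ 2 * (real n * exp_coeff h n)" by simp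
    also have "\<dots> = (\<Sum>k=1..n. real n ^ 2 * (real k * h k * exp_coeff h (n - k)))"
      unfolding rec[OF that] by (rule sum_distrib_left)
    also have "\<dots> \<le> (\<Sum>k=1..n. 2 * b * exp_coeff h (n - k) + real k * h k * (2 * B))"
    proof (rule sum_mono)
      fix k assume k: "k \<in> {1..n}"
      have "real k ^ 2 * (real k * h k) \<le> real k ^ 2 * (b * (1 / real k ^ 2))" using h2[of k] k by (intro mult_left_mono) auto
      also have "\<dots> = b" using k by simp
      finally have "real k ^ 2 * (real k * h k) * exp_coeff h (n - k) \<le> b * exp_coeff h (n - k)"
        using e by (intro mult_right_mono) auto
      moreover have "real k * h k * (real (n - k) ^ 2 * exp_coeff h (n - k)) \<le> real k * h k * B"
        using k h(1) 2[of "n - k"] by (intro mult_left_mono) auto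
      moreover have "real n ^ 2 * (real k * h k * exp_coeff h (n - k))
         \<le> (2 * real k ^ 2 + 2 * real (n - k) ^ 2) * (real k * h k * exp_coeff h (n - k))"
      proof (rule mult_right_mono)
        have "(x + y) ^ 2 \<le> 2 * x ^ 2 + 2 * y ^ 2" for x y :: real
          using zero_le_power2[of "x - y"] by (simp add: power2_eq_square algebra_simps)
        from this[of "real k" "real (n - k)"] show "real n ^ 2 \<le> 2 * real k ^ 2 + 2 * real (n - k) ^ 2"
          using k by simp
      qed (use k h(1) e in auto)
      ultimately show "real n ^ 2 * (real k * h k * exp_coeff h (n - k)) \<le> 2 * b * exp_coeff h (n - k) + real k * h k * (2 * B)"
        by (simp add: algebra_simps del: of_nat_diff)
    qed
    also have "\<dots> = 2 * b * (\<Sum>k=1..n. exp_coeff h (n - k)) + (\<Sum>k=1..n. real k * h k) * (2 * B)"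
      by (simp add: sum.distrib sum_distrib_left sum_distrib_right)
    also have "\<dots> \<le> 2 * b * S + 2 * b * (2 * B)"
      using b B0 by (intro add_mono mult_left_mono[OF sum_e] mult_right_mono[OF sum_kh]) auto
    finally have "real n * (real n ^ 2 * exp_coeff h n) \<le> 2 * b * S + 4 * b * B" by simp
    then show ?thesis using that by (simp add: field_simps)
  qed
  show ?thesis
  proof (rule tendsto_sandwich[OF _ _ tendsto_const])
    show "eventually (\<lambda>n. 0 \<le> real n ^ 2 * exp_coeff h n) sequentially" using e by simp
    show "eventually (\<lambda>n. real n ^ 2 * exp_coeff h n \<le> (2 * b * S + 4 * b * B) * (1 / real n)) sequentially"
      using eventually_ge_at_top[of 1] by eventually_elim (rule 3)
    have "(\<lambda>n. (2 * b * S + 4 * b * B) * (1 / real n)) \<longlonglongrightarrow> (2 * b * S + 4 * b * B) * 0"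
      by (intro tendsto_mult tendsto_const lim_const_over_n)
    then show "(\<lambda>n. (2 * b * S + 4 * b * B) * (1 / real n)) \<longlonglongrightarrow> 0" by simp
  qed
qed

section \<open>The majorant for commuting pairs\<close>

definition cyc :: "nat \<Rightarrow> nat \<Rightarrow> real" where
  "cyc a k = 1 / (real a ^ k * fact k)"

lemma type_weight_cyc: "type_weight n l = (\<Prod>a=1..n. cyc a (l a))"
  by (simp add: type_weight_def cyc_def)

lemma cyc_nonneg: "cyc a k \<ge> 0"
  by (simp add: cyc_def)

lemma kappa_eq: "kappa n = fps_nth (\<Prod>a=1..n. square_series a) n"
proof -
  let ?G = "{g. g \<in> PiE {1..n} (\<lambda>_. {..n}) \<and> (\<Sum>a\<in>{1..n}. a * g a) = n}"
  have "fps_nth (\<Prod>a=1..n. square_series a) n = (\<Sum>g\<in>?G. \<Prod>a=1..n. (1 / (real a ^ g a * fact (g a))) ^ 2)"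
    unfolding square_series_def by (rule prod_block_series_nth) auto
  also have "\<dots> = (\<Sum>l\<in>types n. type_weight n l ^ 2)"
  proof (rule sum.reindex_bij_witness[where i = "\<lambda>l. restrict l {1..n}"
        and j = "\<lambda>g a. if a \<in> {1..n} then g a else 0"])
    fix g assume g: "g \<in> ?G"
    then show "restrict (\<lambda>a. if a \<in> {1..n} then g a else 0) {1..n} = g"
      by (auto simp: fun_eq_iff PiE_def extensional_def)
    have "(\<Sum>a=1..n. a * (if a \<in> {1..n} then g a else 0)) = (\<Sum>a=1..n. a * g a)"
      by (intro sum.cong) auto
    then show "(\<lambda>a. if a \<in> {1..n} then g a else 0) \<in> types n"
      using g unfolding types_def is_type_def by auto
    show "type_weight n (\<lambda>a. if a \<in> {1..n} then g a else 0) ^ 2 = (\<Prod>a=1..n. (1 / (real a ^ g a * fact (g a))) ^ 2)"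
      unfolding type_weight_def prod_power_distrib by (intro prod.cong) auto
  next
    fix l assume "l \<in> types n"
    then have l: "is_type n l" by (simp add: types_def)
    have out: "l a = 0" if "a \<notin> {1..n}" for a using l that unfolding is_type_def by blast
    show "(\<lambda>a. if a \<in> {1..n} then restrict l {1..n} a else 0) = l"
    proof
      fix a show "(if a \<in> {1..n} then restrict l {1..n} a else 0) = l a"
        using out[of a] by (cases "a \<in> {1..n}") simp_all
    qed
    have "(\<Sum>a\<in>{1..n}. a * restrict l {1..n} a) = (\<Sum>a\<in>{1..n}. a * l a)" by (intro sum.cong) auto
    then have "(\<Sum>a\<in>{1..n}. a * restrict l {1..n} a) = n" using l by (simp add: is_type_def)
    moreover have "restrict l {1..n} \<in> PiE {1..n} (\<lambda>_. {..n})" using is_type_le[OF l] by auto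
    ultimately show "restrict l {1..n} \<in> ?G" by blast
  qed
  finally show ?thesis by (simp add: kappa_def)
qed

definition diag_series :: "real fps" where
  "diag_series = Abs_fps diag"

lemma kappa_eq_diag:
  assumes n: "n \<ge> 2"
  shows "kappa n = fps_nth (square_series 1 * (square_series 2 * diag_series)) n"
proof -
  have "{1..n} = insert 1 (insert 2 {3..n})" using n by auto
  then have "(\<Prod>a=1..n. square_series a) = square_series 1 * (square_series 2 * diag_upto n)"
    by (simp add: diag_upto_def)
  moreover have "fps_nth (F * (G * diag_upto n)) n = fps_nth (F * (G * diag_series)) n" for F G
    by (simp add: fps_mult_nth diag_upto_stable diag_series_def)
  ultimately show ?thesis by (simp add: kappa_eq)
qed

lemma fact_mult_le: "fact a * fact b \<le> (fact (a + b) :: real)"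
proof -
  have "fact a * fact b \<le> (fact (a + b) :: nat)" by (intro dvd_imp_le fact_fact_dvd_fact) auto
  then have "real (fact a * fact b) \<le> real (fact (a + b))" by (rule of_nat_mono)
  then show ?thesis by simp
qed

lemma cyc_add_le: "cyc a (j + k) \<le> cyc a j * cyc a k"
proof (cases "a = 0")
  case False
  then have "real a ^ j * fact j * (real a ^ k * fact k) \<le> real a ^ (j + k) * fact (j + k)"
    using fact_mult_le[of j k] by (simp add: power_add mult_ac)
  then have "1 / (real a ^ (j + k) * fact (j + k)) \<le> 1 / (real a ^ j * fact j * (real a ^ k * fact k))"
    using False by (intro divide_left_mono) auto
  then show ?thesis by (simp add: cyc_def)
next
  case True
  then show ?thesis by (cases j; cases k) (auto simp: cyc_def)
qed

lemma cyc_sum_le: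
  assumes "finite S"
  shows "cyc a (k + (\<Sum>x\<in>S. f x)) \<le> cyc a k * (\<Prod>x\<in>S. cyc a (f x))"
  using assms
proof (induction S rule: finite_induct)
  case (insert x S)
  have "cyc a (k + (\<Sum>x\<in>insert x S. f x)) = cyc a ((k + (\<Sum>x\<in>S. f x)) + f x)"
    using insert by (simp add: add_ac)
  also have "\<dots> \<le> cyc a (k + (\<Sum>x\<in>S. f x)) * cyc a (f x)" by (rule cyc_add_le)
  also have "\<dots> \<le> cyc a k * (\<Prod>x\<in>S. cyc a (f x)) * cyc a (f x)"
    by (rule mult_right_mono[OF insert.IH cyc_nonneg])
  finally show ?case using insert by (simp add: mult_ac)
qed simp

text \<open>
  The block types of two different lengths \<open>a\<close>, \<open>b\<close>, neither of which is 1.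
\<close>

definition off_diagonal :: "nat \<Rightarrow> (nat \<times> nat) set" where
  "off_diagonal n = {(a, b). a \<in> {2..n} \<and> b \<in> {2..n} \<and> a \<noteq> b}"

lemma finite_off_diagonal: "finite (off_diagonal n)"
  by (rule finite_subset[of _ "{2..n} \<times> {2..n}"]) (auto simp: off_diagonal_def)

text \<open>
  The factorials are split by \<open>j! k! \<le> (j + k)!\<close>, except that the row of length 1 is kept whole, and in the row of length
  2 the entries \<open>X 2 2\<close> and \<open>X 2 1\<close> stay together.
\<close>

lemma row_weight_le:
  assumes n: "n \<ge> 2" and X: "\<And>a. a \<in> {1..n} \<Longrightarrow> a * l a = (\<Sum>b=1..n. lcm a b * X a b)"
  shows "type_weight n l \<le> cyc 1 (X 1 1 + 2 * X 1 2 + (\<Sum>b=3..n. b * X 1 b)) * cyc 2 (X 2 2 + X 2 1)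
    * (\<Prod>a=3..n. cyc a (X a a)) * (\<Prod>a=3..n. cyc a (X a 1))
    * (\<Prod>(a, b)\<in>off_diagonal n. cyc a (X a b * (lcm a b div a)))"
proof -
  let ?s = "\<lambda>a b. X a b * (lcm a b div a)"
  have split: "(\<Sum>b=1..n. f b) = f 1 + (f 2 + (\<Sum>b=3..n. f b))" for f :: "nat \<Rightarrow> nat"
  proof -
    have "{1..n} = insert 1 (insert 2 {3..n})" using n by auto
    then show ?thesis by simp
  qed
  have split2: "(\<Sum>b=1..n. f b) = f 1 + (\<Sum>b\<in>{2..n}. f b)" for f :: "nat \<Rightarrow> nat"
  proof -
    have "{1..n} = insert 1 {2..n}" using n by auto
    then show ?thesis by simp
  qed
  have lcm: "lcm a b * X a b = a * ?s a b" for a b by (simp add: mult_ac)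
  have l: "l a = (\<Sum>b=1..n. ?s a b)" if "a \<in> {1..n}" for a
  proof -
    have "a * l a = a * (\<Sum>b=1..n. ?s a b)" unfolding X[OF that] sum_distrib_left by (intro sum.cong refl lcm)
    moreover have "a \<noteq> 0" using that by simp
    ultimately show ?thesis by simp
  qed
  have l1: "l 1 = X 1 1 + 2 * X 1 2 + (\<Sum>b=3..n. b * X 1 b)"
    using l[of 1] n unfolding split by (simp add: mult.commute)
  have "cyc 2 (l 2) \<le> cyc 2 (X 2 2 + X 2 1) * (\<Prod>b\<in>{2..n} - {2}. cyc 2 (?s 2 b))"
  proof -
    have "{2..n} - {2} = {3..n}" by auto
    moreover have "lcm 2 1 div 2 = (1::nat)" "lcm 2 2 div 2 = (1::nat)" by simp_all
    ultimately have "l 2 = (X 2 2 + X 2 1) + (\<Sum>b\<in>{2..n} - {2}. ?s 2 b)"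
      using l[of 2] n unfolding split by simp
    then show ?thesis by (simp only:) (rule cyc_sum_le, simp)
  qed
  moreover have "cyc a (l a) \<le> cyc a (X a a) * cyc a (X a 1) * (\<Prod>b\<in>{2..n} - {a}. cyc a (?s a b))" if a: "a \<in> {3..n}" for a
  proof -
    have "(\<Sum>b\<in>{2..n}. ?s a b) = ?s a a + (\<Sum>b\<in>{2..n} - {a}. ?s a b)"
      using a by (intro sum.remove) auto
    moreover have "lcm a 1 div a = 1" "lcm a a div a = 1" using a by simp_all
    ultimately have "l a = (X a a + X a 1) + (\<Sum>b\<in>{2..n} - {a}. ?s a b)"
      using l[of a] a unfolding split2 by simp
    then have "cyc a (l a) \<le> cyc a (X a a + X a 1) * (\<Prod>b\<in>{2..n} - {a}. cyc a (?s a b))"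
      by (simp only:) (rule cyc_sum_le, simp)
    also have "\<dots> \<le> cyc a (X a a) * cyc a (X a 1) * (\<Prod>b\<in>{2..n} - {a}. cyc a (?s a b))"
      by (intro mult_right_mono cyc_add_le prod_nonneg) (simp add: cyc_nonneg)
    finally show ?thesis .
  qed
  ultimately have "cyc 2 (l 2) * (\<Prod>a=3..n. cyc a (l a))
    \<le> (cyc 2 (X 2 2 + X 2 1) * (\<Prod>b\<in>{2..n} - {2}. cyc 2 (?s 2 b))) *
      (\<Prod>a=3..n. cyc a (X a a) * cyc a (X a 1) * (\<Prod>b\<in>{2..n} - {a}. cyc a (?s a b)))"
    by (intro mult_mono prod_mono conjI mult_nonneg_nonneg prod_nonneg) (simp_all add: cyc_nonneg)
  also have "\<dots> = cyc 2 (X 2 2 + X 2 1) * (\<Prod>a=3..n. cyc a (X a a)) * (\<Prod>a=3..n. cyc a (X a 1)) *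
      (\<Prod>a\<in>{2..n}. \<Prod>b\<in>{2..n} - {a}. cyc a (?s a b))"
  proof -
    have "{2..n} = insert 2 {3..n}" using n by auto
    then have "(\<Prod>a\<in>{2..n}. G a) = G 2 * (\<Prod>a=3..n. G a)" for G :: "nat \<Rightarrow> real" by simp
    from this[of "\<lambda>a. \<Prod>b\<in>{2..n} - {a}. cyc a (?s a b)"] show ?thesis by (simp only: prod.distrib mult_ac)
  qed
  also have "(\<Prod>a\<in>{2..n}. \<Prod>b\<in>{2..n} - {a}. cyc a (?s a b)) = (\<Prod>(a, b)\<in>off_diagonal n. cyc a (?s a b))"
  proof -
    have "off_diagonal n = Sigma {2..n} (\<lambda>a. {2..n} - {a})" by (auto simp: off_diagonal_def)
    then show ?thesis by (simp add: prod.Sigma)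
  qed
  finally have "cyc 1 (l 1) * (cyc 2 (l 2) * (\<Prod>a=3..n. cyc a (l a)))
    \<le> cyc 1 (l 1) * (cyc 2 (X 2 2 + X 2 1) * (\<Prod>a=3..n. cyc a (X a a)) * (\<Prod>a=3..n. cyc a (X a 1)) *
      (\<Prod>(a, b)\<in>off_diagonal n. cyc a (?s a b)))"
    by (rule mult_left_mono[OF _ cyc_nonneg])
  moreover have "type_weight n l = cyc 1 (l 1) * (cyc 2 (l 2) * (\<Prod>a=3..n. cyc a (l a)))"
  proof -
    have "{1..n} = insert 1 (insert 2 {3..n})" using n by auto
    then show ?thesis by (simp add: type_weight_cyc)
  qed
  ultimately show ?thesis unfolding l1 by (simp only: mult.assoc)
qed

definition block_weight :: "nat \<times> nat \<Rightarrow> real" where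
  "block_weight = (\<lambda>(a, b). cyc a (lcm a b div a) * cyc b (lcm a b div b))"

lemma block_weight_nonneg: "block_weight t \<ge> 0"
  by (simp add: block_weight_def cyc_nonneg split: prod.split)

lemma fact_mult_Suc_le:
  assumes "s \<ge> 1"
  shows "fact k * fact s * real (Suc k) \<le> fact (k + s)"
  using assms
proof (induction s rule: dec_induct)
  case (step s)
  have "fact k * fact (Suc s) * real (Suc k) = real (Suc s) * (fact k * fact s * real (Suc k))"
    by (simp only: fact_Suc mult_ac)
  also have "\<dots> \<le> real (Suc (k + s)) * fact (k + s)"
    using step by (intro mult_mono) auto
  finally show ?case by (simp only: fact_Suc add_Suc_right)
qed simp

lemma fact_power_le: "fact s ^ z \<le> (fact (z * s) :: real)"
proof (induction z)
  case (Suc z)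
  have "fact s ^ Suc z \<le> fact s * (fact (z * s) :: real)" using Suc by (simp add: mult_left_mono)
  also have "\<dots> \<le> fact (s + z * s)" by (rule fact_mult_le)
  finally show ?case by simp
qed simp

lemma fact_power_fact_le:
  assumes s: "s \<ge> 1"
  shows "fact z * fact s ^ z \<le> (fact (z * s) :: real)"
proof (induction z)
  case (Suc z)
  have "fact (Suc z) * fact s ^ Suc z = real (Suc z) * fact s * (fact z * (fact s ^ z :: real))"
    by (simp only: fact_Suc power_Suc mult_ac)
  also have "\<dots> \<le> real (Suc (z * s)) * fact s * fact (z * s)"
  proof (intro mult_mono)
    have "z * 1 \<le> z * s" using s by (rule mult_left_mono) simp
    then show "real (Suc z) \<le> real (Suc (z * s))" by (intro of_nat_mono Suc_le_mono[THEN iffD2]) simp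
  qed (use Suc in auto)
  also have "\<dots> = fact (z * s) * fact s * real (Suc (z * s))" by (simp only: mult_ac)
  also have "\<dots> \<le> fact (z * s + s)" by (rule fact_mult_Suc_le[OF s])
  finally show ?case by (simp add: add.commute)
qed simp

lemma cyc_power_le: "cyc a (z * s) \<le> cyc a s ^ z"
proof (cases "a = 0")
  case False
  have "real a ^ (z * s) * fact s ^ z \<le> real a ^ (z * s) * fact (z * s)"
    by (intro mult_left_mono fact_power_le) simp
  then have "1 / (real a ^ (z * s) * fact (z * s)) \<le> 1 / (real a ^ (z * s) * fact s ^ z)"
    using False by (intro divide_left_mono) auto
  then show ?thesis by (simp add: cyc_def power_divide power_mult_distrib mult.commute[of z] flip: power_mult)
next
  case True
  then show ?thesis by (cases s; cases z) (auto simp: cyc_def power_0_left)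
qed

lemma cyc_power_fact_le:
  assumes "s \<ge> 1" "a \<ge> 1"
  shows "cyc a (z * s) \<le> cyc a s ^ z / fact z"
proof -
  have "real a ^ (z * s) * (fact z * fact s ^ z) \<le> real a ^ (z * s) * fact (z * s)"
    by (intro mult_left_mono fact_power_fact_le assms) simp
  then have "1 / (real a ^ (z * s) * fact (z * s)) \<le> 1 / (real a ^ (z * s) * (fact z * fact s ^ z))"
    using assms by (intro divide_left_mono) auto
  then show ?thesis by (simp add: cyc_def power_divide power_mult_distrib mult.commute[of z] mult_ac flip: power_mult)
qed

text \<open>
  Since \<open>(z s)! \<ge> z! (s!) ^ z\<close> and \<open>(z t)! \<ge> (t!) ^ z\<close>, the weight of \<open>z\<close> blocks of one type is at most the \<open>z\<close>-th term of an
  exponential series.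
\<close>

lemma block_power_le:
  assumes "a \<ge> 1" "b \<ge> 1"
  shows "cyc a (z * (lcm a b div a)) * cyc b (z * (lcm a b div b)) \<le> block_weight (a, b) ^ z / fact z"
proof -
  have "lcm a b div a \<ge> 1" using assms by (simp add: Suc_le_eq div_greater_zero_iff lcm_pos_nat dvd_imp_le)
  then have "cyc a (z * (lcm a b div a)) * cyc b (z * (lcm a b div b))
     \<le> (cyc a (lcm a b div a) ^ z / fact z) * cyc b (lcm a b div b) ^ z"
    using assms by (intro mult_mono cyc_power_fact_le cyc_power_le cyc_nonneg divide_nonneg_nonneg zero_le_power) auto
  then show ?thesis by (simp add: block_weight_def power_mult_distrib)
qed

text \<open>
  The factors that are not split, for \<open>p = X 1 1\<close>, \<open>q = X 2 2\<close>, \<open>i = X 1 2\<close>, \<open>j = X 2 1\<close>. Here \<open>u\<close> is the number of points that are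
  fixed by the second permutation and lie in cycles of length at least 3 of the first, and \<open>v\<close> is the same number with the
  roles exchanged.
\<close>

definition core :: "nat \<Rightarrow> nat \<Rightarrow> nat \<Rightarrow> nat \<Rightarrow> nat \<Rightarrow> nat \<Rightarrow> real" where
  "core p q i j u v = of_bool (i = 0 \<or> j = 0) *
     (cyc 1 (p + 2 * i + v) * cyc 1 (p + 2 * j + u)) * (cyc 2 (q + j) * cyc 2 (q + i))"

lemma core_nonneg: "core p q i j u v \<ge> 0"
  by (simp add: core_def cyc_nonneg)

lemma block_matrix_weight_le:
  assumes n: "n \<ge> 2" and X: "block_matrix n X l m" and red: "X 1 2 = 0 \<or> X 2 1 = 0"
  shows "type_weight n l * type_weight n m \<le>
     core (X 1 1) (X 2 2) (X 1 2) (X 2 1) (\<Sum>a=3..n. a * X a 1) (\<Sum>b=3..n. b * X 1 b)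
     * (\<Prod>a=3..n. cyc a (X a 1)) * (\<Prod>b=3..n. cyc b (X 1 b)) * (\<Prod>a=3..n. cyc a (X a a) ^ 2)
     * (\<Prod>t\<in>off_diagonal n. block_weight t ^ X (fst t) (snd t) / fact (X (fst t) (snd t)))"
proof -
  have row: "\<And>a. a \<in> {1..n} \<Longrightarrow> a * l a = (\<Sum>b=1..n. lcm a b * X a b)"
   and col: "\<And>b. b \<in> {1..n} \<Longrightarrow> b * m b = (\<Sum>a=1..n. lcm b a * X a b)"
    using X by (simp_all add: block_matrix_def lcm.commute)
  let ?u = "\<Sum>a=3..n. a * X a 1" and ?v = "\<Sum>b=3..n. b * X 1 b"
  let ?R = "\<lambda>(a, b). cyc a (X a b * (lcm a b div a))"
  let ?C = "\<lambda>(a, b). cyc b (X a b * (lcm a b div b))"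
  let ?A = "\<Prod>a=3..n. cyc a (X a a)" and ?Y = "\<Prod>a=3..n. cyc a (X a 1)" and ?Y' = "\<Prod>b=3..n. cyc b (X 1 b)"
  let ?T = "off_diagonal n"
  have "(\<Prod>(b, a)\<in>?T. cyc b (X a b * (lcm b a div b))) = (\<Prod>t\<in>?T. ?C t)"
    by (rule prod.reindex_bij_witness[where i = prod.swap and j = prod.swap])
      (auto simp: off_diagonal_def lcm.commute)
  then have colw: "type_weight n m \<le> cyc 1 (X 1 1 + 2 * X 2 1 + ?u) * cyc 2 (X 2 2 + X 1 2) * ?A * ?Y' * (\<Prod>t\<in>?T. ?C t)"
    using row_weight_le[OF n, of m "\<lambda>a b. X b a"] col by simp
  have roww: "type_weight n l \<le> cyc 1 (X 1 1 + 2 * X 1 2 + ?v) * cyc 2 (X 2 2 + X 2 1) * ?A * ?Y * (\<Prod>t\<in>?T. ?R t)"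
    by (rule row_weight_le[OF n row])
  have C0: "?C t \<ge> 0" "?R t \<ge> 0" for t by (simp_all add: cyc_nonneg split: prod.split)
  have P0: "?A \<ge> 0" "?Y \<ge> 0" "?Y' \<ge> 0" by (simp_all add: prod_nonneg cyc_nonneg)
  have "type_weight n l * type_weight n m
     \<le> (cyc 1 (X 1 1 + 2 * X 1 2 + ?v) * cyc 2 (X 2 2 + X 2 1) * ?A * ?Y * (\<Prod>t\<in>?T. ?R t)) *
       (cyc 1 (X 1 1 + 2 * X 2 1 + ?u) * cyc 2 (X 2 2 + X 1 2) * ?A * ?Y' * (\<Prod>t\<in>?T. ?C t))"
    by (intro mult_mono roww colw mult_nonneg_nonneg P0 cyc_nonneg prod_nonneg)
      (use C0 in \<open>auto simp: type_weight_cyc cyc_nonneg intro!: prod_nonneg\<close>)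
  also have "\<dots> = core (X 1 1) (X 2 2) (X 1 2) (X 2 1) ?u ?v * ?Y * ?Y' * (?A * ?A) * (\<Prod>t\<in>?T. ?R t * ?C t)"
    using red by (simp only: core_def prod.distrib of_bool_eq mult_1 mult_ac)
  also have "?A * ?A = (\<Prod>a=3..n. cyc a (X a a) ^ 2)" by (simp only: prod.distrib power2_eq_square)
  also have "core (X 1 1) (X 2 2) (X 1 2) (X 2 1) ?u ?v * ?Y * ?Y' * (\<Prod>a=3..n. cyc a (X a a) ^ 2) * (\<Prod>t\<in>?T. ?R t * ?C t)
     \<le> core (X 1 1) (X 2 2) (X 1 2) (X 2 1) ?u ?v * ?Y * ?Y' * (\<Prod>a=3..n. cyc a (X a a) ^ 2) *
       (\<Prod>t\<in>?T. block_weight t ^ X (fst t) (snd t) / fact (X (fst t) (snd t)))"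
  proof (intro mult_left_mono prod_mono conjI)
    fix t assume "t \<in> ?T"
    then obtain a b where t: "t = (a, b)" "a \<ge> 1" "b \<ge> 1" by (auto simp: off_diagonal_def)
    show "?R t * ?C t \<le> block_weight t ^ X (fst t) (snd t) / fact (X (fst t) (snd t))"
      using block_power_le[OF t(2,3), of "X a b"] by (simp add: t(1))
  qed (use C0 P0 in \<open>auto simp: core_nonneg intro!: mult_nonneg_nonneg prod_nonneg\<close>)
  finally show ?thesis .
qed

lemma sum_multiplicities:
  assumes T: "finite T" and s: "\<And>t. t \<in> T \<Longrightarrow> s t \<ge> 1" and \<phi>: "\<And>u. u > n \<Longrightarrow> \<phi> u = 0"
  shows "(\<Sum>g\<in>PiE T (\<lambda>_. {..n}). (\<Prod>t\<in>T. f t (g t)) * \<phi> (\<Sum>t\<in>T. s t * g t))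
    = (\<Sum>u\<le>n. fps_nth (\<Prod>t\<in>T. block_series (s t) (f t)) u * \<phi> u)"
proof -
  let ?P = "PiE T (\<lambda>_. {..n})"
  let ?S = "\<lambda>g. \<Sum>t\<in>T. s t * g t"
  have fin: "finite ?P" using T by (intro finite_PiE) auto
  have "(\<Sum>g\<in>?P. (\<Prod>t\<in>T. f t (g t)) * \<phi> (?S g)) = (\<Sum>g | g \<in> ?P \<and> ?S g \<le> n. (\<Prod>t\<in>T. f t (g t)) * \<phi> (?S g))"
    using fin \<phi> by (intro sum.mono_neutral_right) (auto simp: not_le)
  also have "\<dots> = (\<Sum>u\<le>n. \<Sum>g | g \<in> {g. g \<in> ?P \<and> ?S g \<le> n} \<and> ?S g = u. (\<Prod>t\<in>T. f t (g t)) * \<phi> (?S g))"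
    using fin by (intro sum.group[symmetric]) auto
  also have "\<dots> = (\<Sum>u\<le>n. fps_nth (\<Prod>t\<in>T. block_series (s t) (f t)) u * \<phi> u)"
  proof (intro sum.cong refl)
    fix u assume u: "u \<in> {..n}"
    have "(\<Sum>g | g \<in> {g. g \<in> ?P \<and> ?S g \<le> n} \<and> ?S g = u. (\<Prod>t\<in>T. f t (g t)) * \<phi> (?S g))
      = (\<Sum>g | g \<in> ?P \<and> ?S g = u. (\<Prod>t\<in>T. f t (g t)) * \<phi> u)"
      using u by (intro sum.cong) auto
    also have "\<dots> = fps_nth (\<Prod>t\<in>T. block_series (s t) (f t)) u * \<phi> u"
    proof -
      have "u \<le> n" using u by simp
      then show ?thesis using prod_block_series_nth[OF T s, where m = u and n = n and f = f] by (simp add: sum_distrib_right)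
    qed
    finally show "(\<Sum>g | g \<in> {g. g \<in> ?P \<and> ?S g \<le> n} \<and> ?S g = u. (\<Prod>t\<in>T. f t (g t)) * \<phi> (?S g))
      = fps_nth (\<Prod>t\<in>T. block_series (s t) (f t)) u * \<phi> u" .
  qed
  finally show ?thesis .
qed

definition row_type :: "nat \<Rightarrow> (nat \<Rightarrow> nat \<Rightarrow> nat) \<Rightarrow> nat \<Rightarrow> nat" where
  "row_type n X a = (if a \<in> {1..n} then (\<Sum>b=1..n. lcm a b * X a b) div a else 0)"

text \<open>
  The matrix with given parts: column 1 (\<open>y\<close>) and row 1 (\<open>y'\<close>) from index 3 on, diagonal (\<open>d\<close>) from index 3 on, and
  the entries \<open>z\<close> at off-diagonal places.
\<close>

definition assemble :: "nat \<Rightarrow> nat \<Rightarrow> nat \<Rightarrow> nat \<Rightarrow> (nat \<Rightarrow> nat) \<Rightarrow> (nat \<Rightarrow> nat) \<Rightarrow> (nat \<Rightarrow> nat) \<Rightarrow> (nat \<times> nat \<Rightarrow> nat)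
    \<Rightarrow> nat \<Rightarrow> nat \<Rightarrow> nat" where
  "assemble p q i j y y' d z a b =
     (if a = 1 then (if b = 1 then p else if b = 2 then i else y' b)
      else if b = 1 then (if a = 2 then j else y a)
      else if a = b then (if a = 2 then q else d a) else z (a, b))"

definition block_size :: "nat \<Rightarrow> nat \<Rightarrow> nat \<Rightarrow> nat \<Rightarrow> nat \<Rightarrow> nat \<Rightarrow> nat" where
  "block_size p q i j u v = p + 2 * q + 2 * i + 2 * j + u + v"

lemma block_matrix_total:
  assumes n: "n \<ge> 2" and X: "block_matrix n X l m" and l: "is_type n l"
  shows "block_size (X 1 1) (X 2 2) (X 1 2) (X 2 1) (\<Sum>a=3..n. a * X a 1) (\<Sum>b=3..n. b * X 1 b)
    + (\<Sum>a=3..n. a * X a a) + (\<Sum>t\<in>off_diagonal n. lcm (fst t) (snd t) * X (fst t) (snd t)) = n"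
proof -
  let ?g = "\<lambda>a b. lcm a b * X a b"
  have split: "(\<Sum>b=1..n. f b) = f 1 + (\<Sum>b=2..n. f b)" "(\<Sum>b=2..n. f b) = f 2 + (\<Sum>b=3..n. f b)" for f :: "nat \<Rightarrow> nat"
  proof -
    have "{1..n} = insert 1 {2..n}" "{2..n} = insert 2 {3..n}" using n by auto
    then show "(\<Sum>b=1..n. f b) = f 1 + (\<Sum>b=2..n. f b)" "(\<Sum>b=2..n. f b) = f 2 + (\<Sum>b=3..n. f b)" by simp_all
  qed
  have "n = (\<Sum>a=1..n. \<Sum>b=1..n. ?g a b)"
    using X l by (simp add: block_matrix_def is_type_def)
  also have "\<dots> = (\<Sum>b=1..n. ?g 1 b) + ((\<Sum>a=2..n. ?g a 1) + (\<Sum>a=2..n. \<Sum>b=2..n. ?g a b))"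
    unfolding split(1) by (simp only: sum.distrib)
  also have "(\<Sum>a=2..n. \<Sum>b=2..n. ?g a b) = (\<Sum>a=2..n. ?g a a) + (\<Sum>t\<in>off_diagonal n. ?g (fst t) (snd t))"
  proof -
    have "(\<Sum>b=2..n. ?g a b) = ?g a a + (\<Sum>b\<in>{2..n} - {a}. ?g a b)" if "a \<in> {2..n}" for a
      using that by (intro sum.remove) auto
    then have "(\<Sum>a=2..n. \<Sum>b=2..n. ?g a b) = (\<Sum>a=2..n. ?g a a + (\<Sum>b\<in>{2..n} - {a}. ?g a b))"
      by (intro sum.cong refl)
    also have "\<dots> = (\<Sum>a=2..n. ?g a a) + (\<Sum>a=2..n. \<Sum>b\<in>{2..n} - {a}. ?g a b)" by (rule sum.distrib)
    also have "(\<Sum>a=2..n. \<Sum>b\<in>{2..n} - {a}. ?g a b) = (\<Sum>t\<in>off_diagonal n. ?g (fst t) (snd t))"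
    proof -
      have "off_diagonal n = Sigma {2..n} (\<lambda>a. {2..n} - {a})" by (auto simp: off_diagonal_def)
      then show ?thesis by (simp add: sum.Sigma case_prod_beta)
    qed
    finally show ?thesis .
  qed
  finally show ?thesis unfolding split by (simp add: block_size_def lcm.commute)
qed

definition rho_weight :: "nat \<Rightarrow> nat \<times> nat \<times> nat \<times> nat \<times> (nat \<Rightarrow> nat) \<times> (nat \<Rightarrow> nat) \<times> (nat \<Rightarrow> nat) \<times> (nat \<times> nat \<Rightarrow> nat) \<Rightarrow> real" where
  "rho_weight n = (\<lambda>(p, q, i, j, y, y', d, z).
     (\<Prod>a=3..n. cyc a (y a)) * ((\<Prod>b=3..n. cyc b (y' b)) * ((\<Prod>a=3..n. cyc a (d a) ^ 2)
     * ((\<Prod>t\<in>off_diagonal n. block_weight t ^ z t / fact (z t))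
     * (of_bool (block_size p q i j (\<Sum>a=3..n. a * y a) (\<Sum>b=3..n. b * y' b)
          + (\<Sum>a=3..n. a * d a) + (\<Sum>t\<in>off_diagonal n. lcm (fst t) (snd t) * z t) = n)
     * core p q i j (\<Sum>a=3..n. a * y a) (\<Sum>b=3..n. b * y' b))))))"

lemma rho_weight_nonneg: "rho_weight n x \<ge> 0"
  unfolding rho_weight_def split_beta
  by (intro mult_nonneg_nonneg prod_nonneg divide_nonneg_nonneg zero_le_power core_nonneg cyc_nonneg
      block_weight_nonneg) simp_all

text \<open>
  Each pair of types is recovered from one of its block matrices, and its weight is bounded by the one of that matrix.
\<close>

lemma rho_bound_le_matrix_sum:
  assumes n: "n \<ge> 2"
  shows "rho_bound n \<le> sum (rho_weight n) ({..n} \<times> {..n} \<times> {..n} \<times> {..n} \<times> PiE {3..n} (\<lambda>_. {..n})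
      \<times> PiE {3..n} (\<lambda>_. {..n}) \<times> PiE {3..n} (\<lambda>_. {..n}) \<times> PiE (off_diagonal n) (\<lambda>_. {..n}))"
  unfolding rho_bound_def
proof (rule sum_le_included[where i = "\<lambda>(p, q, i, j, y, y', d, z).
    (row_type n (assemble p q i j y y' d z), row_type n (\<lambda>a b. assemble p q i j y y' d z b a))"])
  let ?D = "{..n} \<times> {..n} \<times> {..n} \<times> {..n} \<times> PiE {3..n} (\<lambda>_. {..n})
      \<times> PiE {3..n} (\<lambda>_. {..n}) \<times> PiE {3..n} (\<lambda>_. {..n}) \<times> PiE (off_diagonal n) (\<lambda>_. {..n})"
  let ?i = "\<lambda>(p, q, i, j, y, y', d, z).
    (row_type n (assemble p q i j y y' d z), row_type n (\<lambda>a b. assemble p q i j y y' d z b a))"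
  show "finite (block_pairs n)" using block_pairs_subset finite_types finite_subset by blast
  show "finite ?D" by (intro finite_cartesian_product finite_PiE finite_off_diagonal) auto
  show "\<forall>x\<in>?D. 0 \<le> rho_weight n x" using rho_weight_nonneg by blast
  show "\<forall>x\<in>block_pairs n. \<exists>x'\<in>?D. ?i x' = x \<and> (case x of (l, m) \<Rightarrow> type_weight n l * type_weight n m) \<le> rho_weight n x'"
  proof
    fix x assume "x \<in> block_pairs n"
    then obtain l m X where x: "x = (l, m)" and l: "is_type n l" and m: "is_type n m"
      and X: "block_matrix n X l m" and red: "X 1 2 = 0 \<or> X 2 1 = 0"
      unfolding block_pairs_def by blast
    have row: "a * l a = (\<Sum>b=1..n. lcm a b * X a b)" if "a \<in> {1..n}" for a
      using X that unfolding block_matrix_def by blast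
    have col: "b * m b = (\<Sum>a=1..n. lcm b a * X a b)" if "b \<in> {1..n}" for b
    proof -
      have "b * m b = (\<Sum>a=1..n. lcm a b * X a b)" using X that unfolding block_matrix_def by blast
      then show ?thesis by (simp only: lcm.commute)
    qed
    have le: "X a b \<le> n" if "a \<in> {1..n}" "b \<in> {1..n}" for a b
    proof -
      have "1 * X a b \<le> lcm a b * X a b" using that lcm_pos_nat[of a b] by (intro mult_right_mono) auto
      also have "\<dots> \<le> (\<Sum>b=1..n. lcm a b * X a b)" using that by (intro member_le_sum) auto
      also have "\<dots> = a * l a" by (rule row[OF that(1), symmetric])
      also have "\<dots> \<le> (\<Sum>a=1..n. a * l a)" using that by (intro member_le_sum) auto
      also have "\<dots> = n" using l unfolding is_type_def by blast
      finally show ?thesis by simp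
    qed
    let ?y = "restrict (\<lambda>a. X a 1) {3..n}" and ?y' = "restrict (\<lambda>b. X 1 b) {3..n}"
    let ?d = "restrict (\<lambda>a. X a a) {3..n}" and ?z = "restrict (\<lambda>t. X (fst t) (snd t)) (off_diagonal n)"
    let ?x = "(X 1 1, X 2 2, X 1 2, X 2 1, ?y, ?y', ?d, ?z)"
    have asm: "assemble (X 1 1) (X 2 2) (X 1 2) (X 2 1) ?y ?y' ?d ?z a b = X a b"
      if "a \<in> {1..n}" "b \<in> {1..n}" for a b
      using that unfolding assemble_def off_diagonal_def by auto
    have D: "?x \<in> ?D" using le n by (auto simp: off_diagonal_def)
    have I: "?i ?x = x"
    proof -
      have "row_type n (assemble (X 1 1) (X 2 2) (X 1 2) (X 2 1) ?y ?y' ?d ?z) a = l a" for a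
      proof (cases "a \<in> {1..n}")
        case True
        have "(\<Sum>b=1..n. lcm a b * assemble (X 1 1) (X 2 2) (X 1 2) (X 2 1) ?y ?y' ?d ?z a b) = (\<Sum>b=1..n. lcm a b * X a b)"
          using asm True by (intro sum.cong refl arg_cong2[where f = "(*)"]) blast
        also have "\<dots> = a * l a" using row[OF True] by simp
        finally show ?thesis using True by (simp add: row_type_def)
      next
        case False
        then have "l a = 0" using l unfolding is_type_def by blast
        then show ?thesis unfolding row_type_def if_not_P[OF False] by simp
      qed
      then have 1: "row_type n (assemble (X 1 1) (X 2 2) (X 1 2) (X 2 1) ?y ?y' ?d ?z) = l" by (rule ext)
      have "row_type n (\<lambda>a b. assemble (X 1 1) (X 2 2) (X 1 2) (X 2 1) ?y ?y' ?d ?z b a) a = m a" for a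
      proof (cases "a \<in> {1..n}")
        case True
        have "(\<Sum>b=1..n. lcm a b * assemble (X 1 1) (X 2 2) (X 1 2) (X 2 1) ?y ?y' ?d ?z b a) = (\<Sum>b=1..n. lcm a b * X b a)"
          using asm True by (intro sum.cong refl arg_cong2[where f = "(*)"]) blast
        also have "\<dots> = a * m a" using col[OF True] by simp
        finally show ?thesis using True by (simp add: row_type_def)
      next
        case False
        then have "m a = 0" using m unfolding is_type_def by blast
        then show ?thesis unfolding row_type_def if_not_P[OF False] by simp
      qed
      then have 2: "row_type n (\<lambda>a b. assemble (X 1 1) (X 2 2) (X 1 2) (X 2 1) ?y ?y' ?d ?z b a) = m" by (rule ext)
      show ?thesis by (simp only: x prod.case 1 2)
    qed
    have W: "type_weight n l * type_weight n m \<le> rho_weight n ?x"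
    proof -
      have sums: "(\<Sum>a=3..n. a * ?y a) = (\<Sum>a=3..n. a * X a 1)" "(\<Sum>a=3..n. a * ?y' a) = (\<Sum>b=3..n. b * X 1 b)"
        "(\<Sum>a=3..n. a * ?d a) = (\<Sum>a=3..n. a * X a a)"
        "(\<Sum>t\<in>off_diagonal n. lcm (fst t) (snd t) * ?z t) = (\<Sum>t\<in>off_diagonal n. lcm (fst t) (snd t) * X (fst t) (snd t))"
        by (intro sum.cong; simp)+
      have prods: "(\<Prod>a=3..n. cyc a (?y a)) = (\<Prod>a=3..n. cyc a (X a 1))"
        "(\<Prod>b=3..n. cyc b (?y' b)) = (\<Prod>b=3..n. cyc b (X 1 b))"
        "(\<Prod>a=3..n. cyc a (?d a) ^ 2) = (\<Prod>a=3..n. cyc a (X a a) ^ 2)"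
        "(\<Prod>t\<in>off_diagonal n. block_weight t ^ ?z t / fact (?z t))
          = (\<Prod>t\<in>off_diagonal n. block_weight t ^ X (fst t) (snd t) / fact (X (fst t) (snd t)))"
        by (intro prod.cong; simp)+
      show ?thesis
        unfolding rho_weight_def prod.case sums prods block_matrix_total[OF n X l]
        using block_matrix_weight_le[OF n X red] by (simp only: of_bool_eq simp_thms mult_1 mult_ac)
    qed
    have "(case x of (l, m) \<Rightarrow> type_weight n l * type_weight n m) \<le> rho_weight n ?x"
      unfolding x prod.case by (rule W)
    then show "\<exists>x'\<in>?D. ?i x' = x \<and> (case x of (l, m) \<Rightarrow> type_weight n l * type_weight n m) \<le> rho_weight n x'"
      by (intro bexI[OF _ D] conjI I)
  qed
qed

text \<open>
  The exponential of this series is the generating function of the probability that a random permutation has no cycles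
  of length 1 or 2.
\<close>

definition long_cycle_coeff :: "nat \<Rightarrow> real" where
  "long_cycle_coeff k = (if k \<ge> 3 then 1 / real k else 0)"

definition long_cycle_prob :: "nat \<Rightarrow> real" where
  "long_cycle_prob = exp_coeff long_cycle_coeff"

text \<open>
  The total weight of the off-diagonal block types of size \<open>k\<close>; both lengths divide \<open>k\<close>, so \<open>off_diagonal k\<close> contains all of them.
\<close>

definition block_coeff :: "nat \<Rightarrow> real" where
  "block_coeff k = (\<Sum>t | t \<in> off_diagonal k \<and> lcm (fst t) (snd t) = k. block_weight t)"

definition off_diagonal_series :: "real fps" where
  "off_diagonal_series = Abs_fps (exp_coeff block_coeff)"

definition core_term :: "nat \<times> nat \<times> nat \<times> nat \<times> nat \<times> nat \<Rightarrow> real" where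
  "core_term = (\<lambda>(p, q, i, j, u, v). core p q i j u v * long_cycle_prob u * long_cycle_prob v)"

definition core_size :: "nat \<times> nat \<times> nat \<times> nat \<times> nat \<times> nat \<Rightarrow> nat" where
  "core_size = (\<lambda>(p, q, i, j, u, v). block_size p q i j u v)"

definition core_box :: "nat \<Rightarrow> (nat \<times> nat \<times> nat \<times> nat \<times> nat \<times> nat) set" where
  "core_box n = {..n} \<times> {..n} \<times> {..n} \<times> {..n} \<times> {..n} \<times> {..n}"

definition core_series :: "real fps" where
  "core_series = Abs_fps (\<lambda>m. \<Sum>x | x \<in> core_box m \<and> core_size x = m. core_term x)"

lemma finite_core_box: "finite (core_box n)"
  by (simp add: core_box_def)

lemma core_size_box:
  assumes "core_size x \<le> n"
  shows "x \<in> core_box n"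
  using assms by (cases x) (auto simp: core_size_def core_box_def block_size_def)

lemma sum_core_box:
  "sum F (core_box n) = (\<Sum>p\<le>n. \<Sum>q\<le>n. \<Sum>i\<le>n. \<Sum>j\<le>n. \<Sum>u\<le>n. \<Sum>v\<le>n. F (p, q, i, j, u, v))"
  unfolding core_box_def sum.cartesian_product by (intro sum.cong refl) (simp split: prod.split)

lemma long_cycle_coeff_nonneg: "long_cycle_coeff k \<ge> 0"
  by (simp add: long_cycle_coeff_def)

lemma long_cycle_prob_nonneg: "long_cycle_prob u \<ge> 0"
  unfolding long_cycle_prob_def by (rule exp_coeff_nonneg) (rule long_cycle_coeff_nonneg)

lemma block_coeff_nonneg: "block_coeff k \<ge> 0"
  unfolding block_coeff_def by (intro sum_nonneg block_weight_nonneg)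

lemma core_term_nonneg: "core_term x \<ge> 0"
  by (cases x) (simp add: core_term_def core_nonneg long_cycle_prob_nonneg)

lemma long_cycles_le: "fps_nth (\<Prod>a=3..n. block_series a (cyc a)) u \<le> long_cycle_prob u"
proof -
  have "cyc a = (\<lambda>c. (1 / real a) ^ c / fact c)" for a
    by (simp add: cyc_def fun_eq_iff power_divide)
  then have "(\<Prod>a=3..n. block_series a (cyc a)) = exp_product {3..n} (\<lambda>a. a) (\<lambda>a. 1 / real a)"
    by (simp add: exp_product_def)
  moreover have "fps_nth \<dots> u \<le> exp_coeff long_cycle_coeff u"
  proof (rule exp_product_le_exp_coeff)
    fix k
    have "{t. t \<in> {3..n} \<and> t = k} = (if k \<in> {3..n} then {k} else {})" by auto
    then show "(\<Sum>t | t \<in> {3..n} \<and> t = k. 1 / real t) \<le> long_cycle_coeff k"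
      by (simp add: long_cycle_coeff_def)
  qed auto
  ultimately show ?thesis by (simp add: long_cycle_prob_def)
qed

lemma off_diagonal_blocks_le:
  "fps_nth (\<Prod>t\<in>off_diagonal n. block_series (lcm (fst t) (snd t)) (\<lambda>c. block_weight t ^ c / fact c)) u
    \<le> exp_coeff block_coeff u"
proof -
  have "fps_nth (exp_product (off_diagonal n) (\<lambda>t. lcm (fst t) (snd t)) block_weight) u \<le> exp_coeff block_coeff u"
  proof (rule exp_product_le_exp_coeff[OF finite_off_diagonal])
    fix t assume "t \<in> off_diagonal n"
    then show "lcm (fst t) (snd t) \<ge> 1" using lcm_pos_nat[of "fst t" "snd t"] by (auto simp: off_diagonal_def)
  next
    fix k assume k: "k \<in> {1..u}"
    show "(\<Sum>t | t \<in> off_diagonal n \<and> lcm (fst t) (snd t) = k. block_weight t) \<le> block_coeff k"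
      unfolding block_coeff_def
    proof (rule sum_mono2)
      show "{t. t \<in> off_diagonal n \<and> lcm (fst t) (snd t) = k} \<subseteq> {t. t \<in> off_diagonal k \<and> lcm (fst t) (snd t) = k}"
      proof
        fix t assume t: "t \<in> {t. t \<in> off_diagonal n \<and> lcm (fst t) (snd t) = k}"
        then have "fst t \<le> k" "snd t \<le> k"
          using k dvd_imp_le[of "fst t" k] dvd_imp_le[of "snd t" k] by auto
        then show "t \<in> {t. t \<in> off_diagonal k \<and> lcm (fst t) (snd t) = k}"
          using t by (auto simp: off_diagonal_def)
      qed
    qed (auto simp: finite_off_diagonal block_weight_nonneg)
  qed (auto simp: block_weight_nonneg)
  then show ?thesis by (simp add: exp_product_def)
qed

text \<open>
  The sum over matrices is a sum over independent families of multiplicities. Each family is summed according to its total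
  size, which produces the coefficients of a product of power series.
\<close>

theorem rho_bound_le:
  assumes n: "n \<ge> 2"
  shows "rho_bound n \<le> fps_nth (core_series * (off_diagonal_series * diag_series)) n"
proof -
  let ?N = "{..n}" and ?E = "PiE {3..n} (\<lambda>_. {..n})" and ?T = "off_diagonal n"
  let ?Z = "PiE ?T (\<lambda>_. {..n})"
  let ?s = "\<lambda>y. \<Sum>a=3..n. a * y a" and ?L = "\<lambda>t. lcm (fst t) (snd t) :: nat"
  let ?phi = "\<lambda>p q i j u v r s. of_bool (block_size p q i j u v + r + s = n) * core p q i j u v"
  let ?Y = "fps_nth (\<Prod>a=3..n. block_series a (cyc a))"
  let ?M = "fps_nth (\<Prod>t\<in>?T. block_series (?L t) (\<lambda>c. block_weight t ^ c / fact c))"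
  have L: "?L t \<ge> 1" if "t \<in> ?T" for t
    using that lcm_pos_nat[of "fst t" "snd t"] by (auto simp: off_diagonal_def)
  \<comment> \<open>Summation over one family of multiplicities at a time; \<open>\<phi>\<close> carries the other families and the condition on the total size.\<close>
  have sumZ: "(\<Sum>z\<in>?Z. (\<Prod>t\<in>?T. block_weight t ^ z t / fact (z t)) * \<phi> (\<Sum>t\<in>?T. ?L t * z t)) = (\<Sum>s\<le>n. ?M s * \<phi> s)"
    if "\<And>u. u > n \<Longrightarrow> \<phi> u = 0" for \<phi>
    using finite_off_diagonal L that by (rule sum_multiplicities)
  have sumY: "(\<Sum>y\<in>?E. (\<Prod>a=3..n. cyc a (y a)) * \<phi> (?s y)) = (\<Sum>u\<le>n. ?Y u * \<phi> u)"
    if "\<And>u. u > n \<Longrightarrow> \<phi> u = 0" for \<phi>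
    using that by (intro sum_multiplicities) auto
  have sumD: "(\<Sum>d\<in>?E. (\<Prod>a=3..n. cyc a (d a) ^ 2) * \<phi> (?s d)) = (\<Sum>r\<le>n. diag r * \<phi> r)"
    if "\<And>u. u > n \<Longrightarrow> \<phi> u = 0" for \<phi>
  proof -
    have "(\<Sum>d\<in>?E. (\<Prod>a=3..n. cyc a (d a) ^ 2) * \<phi> (?s d))
       = (\<Sum>r\<le>n. fps_nth (\<Prod>a=3..n. block_series a (\<lambda>c. cyc a c ^ 2)) r * \<phi> r)"
      using that by (intro sum_multiplicities) auto
    also have "(\<Prod>a=3..n. block_series a (\<lambda>c. cyc a c ^ 2)) = diag_upto n"
      by (simp add: diag_upto_def square_series_def cyc_def)
    finally show ?thesis by (simp add: diag_upto_stable)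
  qed
  have "rho_bound n \<le> (\<Sum>p\<le>n. \<Sum>q\<le>n. \<Sum>i\<le>n. \<Sum>j\<le>n. \<Sum>y\<in>?E. \<Sum>y'\<in>?E. \<Sum>d\<in>?E. \<Sum>z\<in>?Z. rho_weight n (p, q, i, j, y, y', d, z))"
  proof -
    have "sum F (?N \<times> ?N \<times> ?N \<times> ?N \<times> ?E \<times> ?E \<times> ?E \<times> ?Z)
      = (\<Sum>p\<le>n. \<Sum>q\<le>n. \<Sum>i\<le>n. \<Sum>j\<le>n. \<Sum>y\<in>?E. \<Sum>y'\<in>?E. \<Sum>d\<in>?E. \<Sum>z\<in>?Z. F (p, q, i, j, y, y', d, z))" for F :: "_ \<Rightarrow> real"
      unfolding sum.cartesian_product by (intro sum.cong refl) (simp split: prod.split)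
    then show ?thesis using rho_bound_le_matrix_sum[OF n] by simp
  qed
  also have "\<dots> = (\<Sum>p\<le>n. \<Sum>q\<le>n. \<Sum>i\<le>n. \<Sum>j\<le>n. \<Sum>u\<le>n. \<Sum>v\<le>n. \<Sum>r\<le>n. \<Sum>s\<le>n. ?Y u * (?Y v * (diag r * (?M s * ?phi p q i j u v r s))))"
  proof (intro sum.cong refl)
    fix p q i j
    have "(\<Sum>y\<in>?E. \<Sum>y'\<in>?E. \<Sum>d\<in>?E. \<Sum>z\<in>?Z. rho_weight n (p, q, i, j, y, y', d, z))
      = (\<Sum>y\<in>?E. (\<Prod>a=3..n. cyc a (y a)) * (\<Sum>y'\<in>?E. (\<Prod>b=3..n. cyc b (y' b)) *
         (\<Sum>d\<in>?E. (\<Prod>a=3..n. cyc a (d a) ^ 2) *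
         (\<Sum>z\<in>?Z. (\<Prod>t\<in>?T. block_weight t ^ z t / fact (z t)) * ?phi p q i j (?s y) (?s y') (?s d) (\<Sum>t\<in>?T. ?L t * z t)))))"
      by (simp only: rho_weight_def prod.case sum_distrib_left)
    also have "\<dots> = (\<Sum>y\<in>?E. (\<Prod>a=3..n. cyc a (y a)) * (\<Sum>y'\<in>?E. (\<Prod>b=3..n. cyc b (y' b)) *
         (\<Sum>d\<in>?E. (\<Prod>a=3..n. cyc a (d a) ^ 2) * (\<Sum>s\<le>n. ?M s * ?phi p q i j (?s y) (?s y') (?s d) s))))"
      by (intro sum.cong refl arg_cong2[where f = "(*)"] sumZ) simp
    also have "\<dots> = (\<Sum>y\<in>?E. (\<Prod>a=3..n. cyc a (y a)) * (\<Sum>y'\<in>?E. (\<Prod>b=3..n. cyc b (y' b)) *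
         (\<Sum>r\<le>n. diag r * (\<Sum>s\<le>n. ?M s * ?phi p q i j (?s y) (?s y') r s))))"
      by (intro sum.cong refl arg_cong2[where f = "(*)"] sumD) simp
    also have "\<dots> = (\<Sum>y\<in>?E. (\<Prod>a=3..n. cyc a (y a)) * (\<Sum>v\<le>n. ?Y v *
         (\<Sum>r\<le>n. diag r * (\<Sum>s\<le>n. ?M s * ?phi p q i j (?s y) v r s))))"
      by (intro sum.cong refl arg_cong2[where f = "(*)"] sumY) (simp add: block_size_def)
    also have "\<dots> = (\<Sum>u\<le>n. ?Y u * (\<Sum>v\<le>n. ?Y v * (\<Sum>r\<le>n. diag r * (\<Sum>s\<le>n. ?M s * ?phi p q i j u v r s))))"
      by (intro sumY) (simp add: block_size_def)
    also have "\<dots> = (\<Sum>u\<le>n. \<Sum>v\<le>n. \<Sum>r\<le>n. \<Sum>s\<le>n. ?Y u * (?Y v * (diag r * (?M s * ?phi p q i j u v r s))))"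
      by (simp only: sum_distrib_left)
    finally show "(\<Sum>y\<in>?E. \<Sum>y'\<in>?E. \<Sum>d\<in>?E. \<Sum>z\<in>?Z. rho_weight n (p, q, i, j, y, y', d, z))
      = (\<Sum>u\<le>n. \<Sum>v\<le>n. \<Sum>r\<le>n. \<Sum>s\<le>n. ?Y u * (?Y v * (diag r * (?M s * ?phi p q i j u v r s))))" .
  qed
  also have "\<dots> \<le> (\<Sum>p\<le>n. \<Sum>q\<le>n. \<Sum>i\<le>n. \<Sum>j\<le>n. \<Sum>u\<le>n. \<Sum>v\<le>n. \<Sum>r\<le>n. \<Sum>s\<le>n.
      long_cycle_prob u * (long_cycle_prob v * (diag r * (exp_coeff block_coeff s * ?phi p q i j u v r s))))"
  proof (intro sum_mono)
    fix p q i j u v r s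
    have Y0: "?Y u \<ge> 0" for u
      by (intro nonneg_seriesD nonneg_series_prod nonneg_block_series cyc_nonneg)
    have M0: "?M u \<ge> 0" for u
      by (intro nonneg_seriesD nonneg_series_prod nonneg_block_series divide_nonneg_nonneg zero_le_power block_weight_nonneg) simp
    show "?Y u * (?Y v * (diag r * (?M s * ?phi p q i j u v r s)))
      \<le> long_cycle_prob u * (long_cycle_prob v * (diag r * (exp_coeff block_coeff s * ?phi p q i j u v r s)))"
      by (intro mult_mono long_cycles_le off_diagonal_blocks_le order_refl mult_nonneg_nonneg long_cycle_prob_nonneg
          diag_nonneg Y0 M0 core_nonneg exp_coeff_nonneg block_coeff_nonneg) simp_all
  qed
  also have "\<dots> = (\<Sum>x\<in>core_box n. \<Sum>r\<le>n. \<Sum>s\<le>n. of_bool (core_size x + r + s = n) * (core_term x * (diag r * exp_coeff block_coeff s)))"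
    by (simp only: sum_core_box core_size_def core_term_def prod.case mult_ac)
  also have "\<dots> = (\<Sum>x\<in>core_box n. if core_size x \<le> n then core_term x * fps_nth (off_diagonal_series * diag_series) (n - core_size x) else 0)"
  proof (intro sum.cong refl)
    fix x
    let ?b = "exp_coeff block_coeff"
    have "(\<Sum>r\<le>n. \<Sum>s\<le>n. of_bool (core_size x + r + s = n) * (core_term x * (diag r * ?b s)))
      = (\<Sum>s\<le>n. \<Sum>r\<le>n. if r = n - core_size x - s then of_bool (core_size x + s \<le> n) * (core_term x * (diag r * ?b s)) else 0)"
      by (subst sum.swap) (intro sum.cong refl, auto)
    also have "\<dots> = (\<Sum>s\<le>n. of_bool (core_size x + s \<le> n) * (core_term x * (diag (n - core_size x - s) * ?b s)))"
      by (intro sum.cong refl) (simp add: sum.delta)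
    also have "\<dots> = (if core_size x \<le> n then core_term x * fps_nth (off_diagonal_series * diag_series) (n - core_size x) else 0)"
    proof (cases "core_size x \<le> n")
      case True
      have "(\<Sum>s\<le>n. of_bool (core_size x + s \<le> n) * (core_term x * (diag (n - core_size x - s) * ?b s)))
        = (\<Sum>s\<in>{0..n - core_size x}. core_term x * (?b s * diag (n - core_size x - s)))"
        using True by (intro sum.mono_neutral_cong_right) auto
      then show ?thesis using True
        by (simp add: fps_mult_nth sum_distrib_left off_diagonal_series_def diag_series_def)
    qed (auto intro!: sum.neutral)
    finally show "(\<Sum>r\<le>n. \<Sum>s\<le>n. of_bool (core_size x + r + s = n) * (core_term x * (diag r * ?b s)))
      = (if core_size x \<le> n then core_term x * fps_nth (off_diagonal_series * diag_series) (n - core_size x) else 0)" .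
  qed
  also have "\<dots> = (\<Sum>x | x \<in> core_box n \<and> core_size x \<le> n. core_term x * fps_nth (off_diagonal_series * diag_series) (n - core_size x))"
    by (rule sum.inter_filter[symmetric, OF finite_core_box])
  also have "\<dots> = (\<Sum>m\<le>n. \<Sum>x | x \<in> {x. x \<in> core_box n \<and> core_size x \<le> n} \<and> core_size x = m.
      core_term x * fps_nth (off_diagonal_series * diag_series) (n - core_size x))"
    using finite_core_box by (intro sum.group[symmetric]) auto
  also have "\<dots> = fps_nth (core_series * (off_diagonal_series * diag_series)) n"
    unfolding fps_mult_nth[of core_series] atLeast0AtMost
  proof (intro sum.cong refl)
    fix m assume m: "m \<in> {..n}"
    have "{x. x \<in> {x. x \<in> core_box n \<and> core_size x \<le> n} \<and> core_size x = m} = {x. x \<in> core_box m \<and> core_size x = m}"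
      using m core_size_box by force
    then show "(\<Sum>x | x \<in> {x. x \<in> core_box n \<and> core_size x \<le> n} \<and> core_size x = m.
        core_term x * fps_nth (off_diagonal_series * diag_series) (n - core_size x))
      = fps_nth core_series m * fps_nth (off_diagonal_series * diag_series) (n - m)"
      by (simp add: core_series_def sum_distrib_right)
  qed
  finally show ?thesis .
qed

section \<open>The total weight of the off-diagonal blocks\<close>

lemma sum_le_geometric:
  fixes f :: "nat \<Rightarrow> real"
  assumes f: "\<And>k. f k \<ge> 0" and r: "0 \<le> r" "r < 1" and step: "\<And>k. k \<ge> K \<Longrightarrow> f (Suc k) \<le> r * f k"
  shows "(\<Sum>k=K..N. f k) \<le> f K / (1 - r)"
proof (cases "K \<le> N")
  case True
  have "(\<Sum>k=K..N. f k) \<le> (f K - r * f N) / (1 - r)"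
    using True
  proof (induction N rule: dec_induct)
    case base
    then show ?case using r by (simp add: field_simps)
  next
    case (step n)
    have "f (Suc n) \<le> r * f n" using assms(4)[OF step(1)] .
    then have "f (Suc n) * (1 - r) \<le> (r * f n - r * f (Suc n))" by (simp add: algebra_simps)
    then have "f (Suc n) \<le> (r * f n - r * f (Suc n)) / (1 - r)" using r by (simp add: pos_le_divide_eq)
    then show ?case using step by (simp add: diff_divide_distrib)
  qed
  also have "\<dots> \<le> f K / (1 - r)" using f[of N] r by (intro divide_right_mono) auto
  finally show ?thesis .
qed (use f[of K] r in simp)

lemma sum_le_initial_geometric:
  fixes f :: "nat \<Rightarrow> real"
  assumes f: "\<And>k. f k \<ge> 0" and r: "0 \<le> r" "r < 1" and step: "\<And>k. k \<ge> K \<Longrightarrow> f (Suc k) \<le> r * f k"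
  shows "(\<Sum>k\<le>N. f k) \<le> (\<Sum>k<K. f k) + f K / (1 - r)"
proof -
  have "(\<Sum>k\<le>N. f k) \<le> (\<Sum>k\<in>{..<K} \<union> {K..N}. f k)" using f by (intro sum_mono2) auto
  also have "\<dots> = (\<Sum>k<K. f k) + (\<Sum>k=K..N. f k)" by (intro sum.union_disjoint) auto
  finally show ?thesis using sum_le_geometric[where f = f and r = r and K = K and N = N] assms by auto
qed

lemma cyc_le_one: "a \<ge> 1 \<Longrightarrow> cyc a k \<le> 1"
proof -
  assume "a \<ge> 1"
  then have "1 * 1 \<le> real a ^ k * fact k" by (intro mult_mono one_le_power) auto
  then show ?thesis by (simp add: cyc_def)
qed

text \<open>
  With \<open>s = k div a\<close> and \<open>t = k div b\<close> one of the distinct numbers \<open>s\<close>, \<open>t\<close> is at least 2, whence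
  \<open>a ^ s * b ^ t \<ge> k ^ 3 / (s * t)\<^sup>2\<close>.
\<close>

lemma block_weight_cubic:
  assumes t: "(a, b) \<in> off_diagonal n" and k: "lcm a b = k"
  shows "block_weight (a, b) \<le> (real (k div a) ^ 2 / fact (k div a)) * (real (k div b) ^ 2 / fact (k div b)) / real k ^ 3"
proof -
  have ab: "a \<ge> 2" "b \<ge> 2" "a \<noteq> b" using t by (auto simp: off_diagonal_def)
  define s t where "s = k div a" and "t = k div b"
  have "a dvd k" "b dvd k" using k by auto
  then have s: "a * s = k" and t: "b * t = k" by (auto simp: s_def t_def)
  have "k > 0" using k ab lcm_pos_nat[of a b] by auto
  then have st: "s \<ge> 1" "t \<ge> 1" using s t by (auto simp: Suc_le_eq intro: Nat.gr0I)
  have "s \<noteq> t" using s t ab \<open>k > 0\<close> by auto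
  have *: "real k ^ 3 \<le> (real a ^ x * real b ^ y) * (real x ^ 2 * real y ^ 2)"
    if "x \<ge> 2" "y \<ge> 1" "a * x = k" "b * y = k" "a \<ge> 2" "b \<ge> 2" for a b x y
  proof -
    have "real k ^ 3 = (real a * real x) * (real a * real x) * (real b * real y)"
      using that(3,4) by (simp add: power3_eq_cube flip: of_nat_mult)
    also have "\<dots> = (real a ^ 2 * real b ^ 1) * (real x ^ 2 * real y)" by (simp add: power2_eq_square)
    also have "\<dots> \<le> (real a ^ x * real b ^ y) * (real x ^ 2 * real y ^ 2)"
      using that by (intro mult_mono power_increasing mult_nonneg_nonneg) (auto simp: power2_eq_square)
    finally show ?thesis .
  qed
  have "real k ^ 3 \<le> (real a ^ s * real b ^ t) * (real s ^ 2 * real t ^ 2)"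
  proof (cases "s \<ge> 2")
    case True
    then show ?thesis using *[of s t a b] s t st ab by simp
  next
    case False
    then have "t \<ge> 2" using st \<open>s \<noteq> t\<close> by linarith
    then show ?thesis using *[of t s b a] s t st ab by (simp add: mult_ac)
  qed
  then have "1 / (real a ^ s * real b ^ t) \<le> (real s ^ 2 * real t ^ 2) / real k ^ 3"
    using ab \<open>k > 0\<close> by (simp add: field_simps)
  then have "1 / (real a ^ s * real b ^ t) * (1 / (fact s * fact t)) \<le> (real s ^ 2 * real t ^ 2) / real k ^ 3 * (1 / (fact s * fact t))"
    by (rule mult_right_mono) simp
  then show ?thesis unfolding block_weight_def prod.case k by (simp add: cyc_def mult_ac flip: s_def t_def)
qed

text \<open>
  A block type \<open>(a, b)\<close> of size \<open>k\<close> is determined by the pair \<open>(k div a, k div b)\<close>, and the sum of \<open>s\<^sup>2 / s!\<close> converges.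
\<close>

lemma block_coeff_cubic: "\<exists>B. \<forall>k\<ge>1. block_coeff k \<le> B / real k ^ 3"
proof -
  let ?f = "\<lambda>s. real s ^ 2 / fact s"
  have f: "(\<Sum>s\<le>k. ?f s) \<le> 8" for k
  proof -
    have "(\<Sum>s\<le>k. ?f s) \<le> (\<Sum>s<3. ?f s) + ?f 3 / (1 - 1 / 2)"
    proof (rule sum_le_initial_geometric)
      fix s :: nat assume s: "s \<ge> 3"
      have "3 * real s \<le> real s * real s" using s by (intro mult_right_mono) auto
      moreover have "real s \<ge> 3" using s by simp
      ultimately have "real s + 1 \<le> 1 / 2 * real s ^ 2" unfolding power2_eq_square by linarith
      then have "(real s + 1) / fact s \<le> 1 / 2 * real s ^ 2 / fact s" by (rule divide_right_mono) simp
      moreover have "?f (Suc s) = (real s + 1) / fact s"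
        by (simp add: power2_eq_square add.commute)
      ultimately show "?f (Suc s) \<le> 1 / 2 * ?f s" by simp
    qed auto
    also have "\<dots> \<le> 8" by (simp add: eval_nat_numeral)
    finally show ?thesis .
  qed
  have "block_coeff k \<le> 64 / real k ^ 3" if k: "k \<ge> 1" for k
  proof -
    let ?T = "{t. t \<in> off_diagonal k \<and> lcm (fst t) (snd t) = k}"
    let ?h = "\<lambda>t. (k div fst t, k div snd t)"
    have fin: "finite ?T" using finite_off_diagonal by simp
    have inj: "inj_on ?h ?T"
    proof (rule inj_onI)
      fix x y assume x: "x \<in> ?T" and y: "y \<in> ?T" and eq: "?h x = ?h y"
      have lcm: "lcm (fst x) (snd x) = k" "lcm (fst y) (snd y) = k" using x y by auto
      have dvd: "fst x dvd k" "snd x dvd k" "fst y dvd k" "snd y dvd k"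
        using dvd_lcm1[of "fst x" "snd x"] dvd_lcm2[of "snd x" "fst x"] dvd_lcm1[of "fst y" "snd y"] dvd_lcm2[of "snd y" "fst y"]
        unfolding lcm by simp_all
      have "k = fst x * (k div fst x)" "k = fst y * (k div fst y)" "k = snd x * (k div snd x)" "k = snd y * (k div snd y)"
        using dvd by auto
      then have "fst x = fst y" "snd x = snd y" using eq k
        by (metis Pair_inject mult_cancel2 mult_is_0 not_one_le_zero)+
      then show "x = y" by (rule prod_eqI)
    qed
    have "block_coeff k \<le> (\<Sum>t\<in>?T. ?f (fst (?h t)) * ?f (snd (?h t)) / real k ^ 3)"
      unfolding block_coeff_def
    proof (rule sum_mono)
      fix t assume "t \<in> ?T"
      then show "block_weight t \<le> ?f (fst (?h t)) * ?f (snd (?h t)) / real k ^ 3"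
        using block_weight_cubic[of "fst t" "snd t" k k] by simp
    qed
    also have "\<dots> = (\<Sum>x\<in>?h ` ?T. ?f (fst x) * ?f (snd x) / real k ^ 3)"
      using inj by (subst sum.reindex) auto
    also have "\<dots> \<le> (\<Sum>x\<in>{..k} \<times> {..k}. ?f (fst x) * ?f (snd x) / real k ^ 3)"
      by (intro sum_mono2) auto
    also have "\<dots> = (\<Sum>s\<le>k. ?f s) * (\<Sum>t\<le>k. ?f t) / real k ^ 3"
      unfolding sum_product sum_divide_distrib sum.cartesian_product by (intro sum.cong refl) auto
    also have "\<dots> \<le> 8 * 8 / real k ^ 3"
      by (intro divide_right_mono mult_mono f sum_nonneg) auto
    finally show ?thesis by simp
  qed
  then show ?thesis by blast
qed

text \<open>
  The tail from 6 on telescopes, since \<open>1 / g\<^sup>3 \<le> 1 / ((g - 1) * g * (g + 1))\<close>.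
\<close>

lemma sum_inverse_cubes: "(\<Sum>g=2..N. 1 / real g ^ 3) \<le> 2024 / 10000"
proof -
  have tail: "(\<Sum>g=6..N. 1 / real g ^ 3) \<le> 1 / 60" 
  proof (cases "N \<ge> 6")
    case True
    have "(\<Sum>g=6..N. 1 / real g ^ 3) \<le> 1 / 60 - 1 / (2 * real N * (real N + 1))"
      using True
    proof (induction N rule: dec_induct)
      case (step n)
      let ?x = "real n"
      have x: "?x \<ge> 6" using step by simp
      have "1 / (?x + 1) ^ 3 \<le> 1 / (?x * (?x + 1) * (?x + 2))"
      proof (rule divide_left_mono)
        show "?x * (?x + 1) * (?x + 2) \<le> (?x + 1) ^ 3" by (simp add: power3_eq_cube algebra_simps)
        show "0 < (?x + 1) ^ 3 * (?x * (?x + 1) * (?x + 2))" using x by (intro mult_pos_pos) auto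
      qed simp
      also have "\<dots> = 1 / (2 * ?x * (?x + 1)) - 1 / (2 * (?x + 1) * (?x + 2))"
        using x by (simp add: divide_simps) (simp add: algebra_simps)
      finally have le: "1 / (?x + 1) ^ 3 \<le> 1 / (2 * ?x * (?x + 1)) - 1 / (2 * (?x + 1) * (?x + 2))" .
      have "(\<Sum>g=6..Suc n. 1 / real g ^ 3) = (\<Sum>g=6..n. 1 / real g ^ 3) + 1 / (?x + 1) ^ 3"
        using step(1) by (simp add: add.commute)
      moreover have "2 * real (Suc n) * (real (Suc n) + 1) = 2 * (?x + 1) * (?x + 2)" by (simp add: algebra_simps)
      ultimately show ?case using step(3) le by (simp only:)
    qed simp
    then show ?thesis by (rule order_trans) simp
  qed simp
  have "(\<Sum>g=2..N. 1 / real g ^ 3) \<le> (\<Sum>g\<in>{2..5} \<union> {6..N}. 1 / real g ^ 3)" by (intro sum_mono2) auto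
  also have "\<dots> = (\<Sum>g\<in>{2..5}. 1 / real g ^ 3) + (\<Sum>g=6..N. 1 / real g ^ 3)" by (intro sum.union_disjoint) auto
  also have "(\<Sum>g\<in>{2..5}. 1 / real g ^ 3) = 1 / 8 + 1 / 27 + 1 / 64 + 1 / 125"
    by (simp add: numeral_eq_Suc)
  finally show ?thesis using tail by simp
qed

lemma sum_inverse_fourth: "(\<Sum>g=2..N. 1 / real g ^ 4) \<le> 853 / 10000"
proof -
  have "(\<Sum>g=2..N. 1 / real g ^ 4) \<le> (\<Sum>g\<in>{2..3} \<union> {4..N}. 1 / real g ^ 4)" by (intro sum_mono2) auto
  also have "\<dots> = (\<Sum>g\<in>{2..3}. 1 / real g ^ 4) + (\<Sum>g=4..N. 1 / real g ^ 4)" by (intro sum.union_disjoint) auto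
  also have "(\<Sum>g\<in>{2..3}. 1 / real g ^ 4) = 1 / 16 + 1 / 81"
    by (simp add: numeral_eq_Suc)
  also have "(\<Sum>g=4..N. 1 / real g ^ 4) \<le> (\<Sum>g=4..N. 1 / 4 * (1 / real g ^ 3))"
  proof (rule sum_mono)
    fix g assume g: "g \<in> {4..N}"
    have "real g ^ 4 = real g * real g ^ 3" using power_Suc[of "real g" 3] by (simp del: power_Suc)
    then have "real g ^ 4 \<ge> 4 * real g ^ 3" using g by (simp add: mult_right_mono)
    then show "1 / real g ^ 4 \<le> 1 / 4 * (1 / real g ^ 3)" using g by (simp add: field_simps)
  qed
  also have "\<dots> = 1 / 4 * (\<Sum>g=4..N. 1 / real g ^ 3)" by (rule sum_distrib_left[symmetric])
  also have "(\<Sum>g=4..N. 1 / real g ^ 3) \<le> 2024 / 10000 - 1 / 8 - 1 / 27"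
  proof (cases "N \<ge> 4")
    case True
    then have "{2..N} = insert 2 (insert 3 {4..N})" by auto
    then show ?thesis using sum_inverse_cubes[of N] by simp
  qed simp
  finally show ?thesis by simp
qed

lemma sum_inverse_fifth: "(\<Sum>g=1..N. 1 / real g ^ 5) \<le> 1051 / 1000"
proof (cases "N \<ge> 1")
  case True
  then have "{1..N} = insert 1 {2..N}" by auto
  then have "(\<Sum>g=1..N. 1 / real g ^ 5) = 1 + (\<Sum>g=2..N. 1 / real g ^ 5)" by simp
  also have "(\<Sum>g=2..N. 1 / real g ^ 5) \<le> (\<Sum>g=2..N. 1 / 4 * (1 / real g ^ 3))"
  proof (rule sum_mono)
    fix g assume g: "g \<in> {2..N}"
    have "real g ^ 5 = real g ^ 2 * real g ^ 3" by (simp flip: power_add)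
    moreover have "real g ^ 2 \<ge> 2 ^ 2" using g by (intro power_mono) auto
    moreover from this have "2 ^ 2 * real g ^ 3 \<le> real g ^ 2 * real g ^ 3" by (rule mult_right_mono) simp
    ultimately have "real g ^ 5 \<ge> 4 * real g ^ 3" by simp
    then show "1 / real g ^ 5 \<le> 1 / 4 * (1 / real g ^ 3)" using g by (simp add: field_simps)
  qed
  also have "\<dots> = 1 / 4 * (\<Sum>g=2..N. 1 / real g ^ 3)" by (rule sum_distrib_left[symmetric])
  finally show ?thesis using sum_inverse_cubes[of N] by simp
qed simp

lemma block_weight_swap: "block_weight (a, b) = block_weight (b, a)"
  by (simp add: block_weight_def lcm.commute)

text \<open>
  The weight of the block type \<open>(t * g, s * g)\<close> with \<open>s\<close> and \<open>t\<close> coprime. The types with \<open>s = 1\<close>, where one length divides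
  the other, carry almost all of the weight.
\<close>

definition reduced_weight :: "nat \<Rightarrow> nat \<Rightarrow> nat \<Rightarrow> real" where
  "reduced_weight s t g = cyc (t * g) s * cyc (s * g) t"

lemma block_weight_reduced:
  assumes "a \<ge> 1" "b \<ge> 1"
  shows "block_weight (a, b) = reduced_weight (b div gcd a b) (a div gcd a b) (gcd a b)"
proof -
  let ?g = "gcd a b"
  have 1: "lcm a b = a * (b div ?g)" by (metis div_mult_swap gcd_dvd2 lcm_nat_def)
  have 2: "lcm a b = b * (a div ?g)" by (metis div_mult_swap gcd_dvd1 lcm_nat_def mult.commute)
  have "lcm a b div a = b div ?g" unfolding 1 using assms by simp
  moreover have "lcm a b div b = a div ?g" unfolding 2 using assms by simp
  ultimately have "lcm a b div a = b div ?g" "lcm a b div b = a div ?g" .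
  then show ?thesis by (simp add: block_weight_def reduced_weight_def)
qed

text \<open>
  One length is \<open>t\<close> times the other one. The case \<open>t = 2\<close> dominates, and for \<open>t \<ge> 3\<close> the factor \<open>1 / g ^ (t + 1)\<close> is at most
  \<open>1 / (2 ^ (t - 3) * g ^ 4)\<close>, because \<open>g \<ge> 2\<close>: the smaller length is \<open>g\<close>.
\<close>

lemma sum_dividing_blocks:
  "(\<Sum>t=2..N. \<Sum>g=2..N. reduced_weight 1 t g) \<le> 5606 / 100000"
proof -
  let ?c = "\<lambda>t. 1 / (real t * fact t * 2 ^ (t - 3)) :: real"
  have w: "reduced_weight 1 t g = 1 / (real t * fact t * real g ^ Suc t)" for t g
    by (simp add: reduced_weight_def cyc_def mult_ac)
  have tail: "(\<Sum>t=3..N. \<Sum>g=2..N. reduced_weight 1 t g) \<le> 1 / 18 / (1 - 1 / 8) * (853 / 10000)"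
  proof -
    have "(\<Sum>t=3..N. \<Sum>g=2..N. reduced_weight 1 t g) \<le> (\<Sum>t=3..N. \<Sum>g=2..N. ?c t * (1 / real g ^ 4))"
    proof (intro sum_mono)
      fix t g assume t: "t \<in> {3..N}" and g: "g \<in> {2..N}"
      have "(2::real) ^ (t - 3) * real g ^ 4 \<le> real g ^ (t - 3) * real g ^ 4"
        using g by (intro mult_right_mono power_mono) auto
      also have "\<dots> = real g ^ Suc t" using t by (simp flip: power_add del: power_Suc)
      finally have "real t * fact t * ((2::real) ^ (t - 3) * real g ^ 4) \<le> real t * fact t * real g ^ Suc t"
        by (rule mult_left_mono) simp
      then have "1 / (real t * fact t * real g ^ Suc t) \<le> 1 / (real t * fact t * ((2::real) ^ (t - 3) * real g ^ 4))"
        using t g by (intro divide_left_mono mult_pos_pos) auto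
      then show "reduced_weight 1 t g \<le> ?c t * (1 / real g ^ 4)" unfolding w by (simp add: mult_ac)
    qed
    also have "\<dots> = (\<Sum>t=3..N. ?c t) * (\<Sum>g=2..N. 1 / real g ^ 4)" by (simp add: sum_product)
    also have "\<dots> \<le> 1 / 18 / (1 - 1 / 8) * (853 / 10000)"
    proof (intro mult_mono sum_inverse_fourth)
      have "(\<Sum>t=3..N. ?c t) \<le> ?c 3 / (1 - 1 / 8)"
      proof (rule sum_le_geometric)
        fix t :: nat assume t: "t \<ge> 3"
        have "Suc t - 3 = Suc (t - 3)" using t by simp
      then have "(2::real) ^ (Suc t - 3) = 2 * 2 ^ (t - 3)" by (simp only: power_Suc)
        moreover have "8 * (real t * fact t * 2 ^ (t - 3)) \<le> real (Suc t) * fact (Suc t) * (2 * 2 ^ (t - 3))"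
        proof -
          have "4 * real t \<le> real (Suc t) * real (Suc t)"
            using t zero_le_power2[of "real t - 1"] by (simp add: power2_eq_square algebra_simps)
          then have "4 * real t * (2 * fact t * 2 ^ (t - 3)) \<le> real (Suc t) * real (Suc t) * (2 * fact t * 2 ^ (t - 3))"
            by (rule mult_right_mono) simp
          then show ?thesis by (simp only: fact_Suc mult_ac)
        qed
        ultimately show "?c (Suc t) \<le> 1 / 8 * ?c t" using t
          by (simp add: divide_simps del: fact_Suc of_nat_Suc power_Suc)
      qed auto
      then show "(\<Sum>t=3..N. ?c t) \<le> 1 / 18 / (1 - 1 / 8)" by (simp add: eval_nat_numeral)
    qed (auto intro!: sum_nonneg)
    finally show ?thesis .
  qed
  show ?thesis
  proof (cases "N \<ge> 2")
    case True
    then have "{2..N} = insert 2 {3..N}" by auto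
    then have "(\<Sum>t=2..N. \<Sum>g=2..N. reduced_weight 1 t g)
        = (\<Sum>g=2..N. reduced_weight 1 2 g) + (\<Sum>t=3..N. \<Sum>g=2..N. reduced_weight 1 t g)" by simp
    also have "(\<Sum>g=2..N. reduced_weight 1 2 g) = 1 / 4 * (\<Sum>g=2..N. 1 / real g ^ 3)"
      unfolding w sum_distrib_left by (intro sum.cong refl) (simp add: numeral_eq_Suc)
    finally show ?thesis using tail sum_inverse_cubes[of N] by simp
  qed simp
qed

text \<open>
  The estimates \<open>t ^ s \<ge> 9 * 3 ^ (s - 2)\<close>, \<open>s ^ t \<ge> 8 * 2 ^ (t - 3)\<close> and \<open>g ^ (s + t) \<ge> g ^ 5\<close> separate the variables.
\<close>

lemma sum_nondividing_blocks:
  "(\<Sum>s=2..N. \<Sum>t=3..N. \<Sum>g=1..N. reduced_weight s t g) \<le> 157 / 100000"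
proof -
  let ?c = "\<lambda>s. 1 / (fact s * 3 ^ (s - 2)) :: real" and ?d = "\<lambda>t. 1 / (fact t * 2 ^ (t - 3)) :: real"
  have c: "(\<Sum>s=2..N. ?c s) \<le> 1 / 2 / (1 - 1 / 9)"
  proof -
    have "(\<Sum>s=2..N. ?c s) \<le> ?c 2 / (1 - 1 / 9)"
    proof (rule sum_le_geometric)
      fix s :: nat assume s: "s \<ge> 2"
      have "Suc s - 2 = Suc (s - 2)" using s by simp
      then have "(3::real) ^ (Suc s - 2) = 3 * 3 ^ (s - 2)" by (simp only: power_Suc)
      moreover have "9 * (fact s * 3 ^ (s - 2)) \<le> fact (Suc s) * (3 * 3 ^ (s - 2) :: real)"
      proof -
        have "3 * (fact s * (3 * 3 ^ (s - 2))) \<le> real (Suc s) * (fact s * (3 * 3 ^ (s - 2) :: real))"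
          using s by (intro mult_right_mono) auto
        then show ?thesis by (simp only: fact_Suc mult_ac)
      qed
      ultimately show "?c (Suc s) \<le> 1 / 9 * ?c s"
        by (simp add: divide_simps del: fact_Suc of_nat_Suc power_Suc)
    qed auto
    then show ?thesis by (simp add: eval_nat_numeral)
  qed
  have d: "(\<Sum>t=3..N. ?d t) \<le> 1 / 6 / (1 - 1 / 8)"
  proof -
    have "(\<Sum>t=3..N. ?d t) \<le> ?d 3 / (1 - 1 / 8)"
    proof (rule sum_le_geometric)
      fix t :: nat assume t: "t \<ge> 3"
      have "Suc t - 3 = Suc (t - 3)" using t by simp
      then have "(2::real) ^ (Suc t - 3) = 2 * 2 ^ (t - 3)" by (simp only: power_Suc)
      moreover have "8 * (fact t * 2 ^ (t - 3)) \<le> fact (Suc t) * (2 * 2 ^ (t - 3) :: real)"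
      proof -
        have "4 * (fact t * (2 * 2 ^ (t - 3))) \<le> real (Suc t) * (fact t * (2 * 2 ^ (t - 3) :: real))"
          using t by (intro mult_right_mono) auto
        then show ?thesis by (simp only: fact_Suc mult_ac)
      qed
      ultimately show "?d (Suc t) \<le> 1 / 8 * ?d t"
        by (simp add: divide_simps del: fact_Suc of_nat_Suc power_Suc)
    qed auto
    then show ?thesis by (simp add: eval_nat_numeral)
  qed
  have "(\<Sum>s=2..N. \<Sum>t=3..N. \<Sum>g=1..N. reduced_weight s t g)
    \<le> (\<Sum>s=2..N. \<Sum>t=3..N. \<Sum>g=1..N. 1 / 72 * (?c s * (?d t * (1 / real g ^ 5))))"
  proof (intro sum_mono)
    fix s t g assume s: "s \<in> {2..N}" and t: "t \<in> {3..N}" and g: "g \<in> {1..N}"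
    have 1: "9 * 3 ^ (s - 2) \<le> real t ^ s"
    proof -
      have "(3::real) ^ s \<le> real t ^ s" using t by (intro power_mono) auto
      moreover have "s = 2 + (s - 2)"
        by (rule le_add_diff_inverse[symmetric]) (use s in simp)
      then have "(3::real) ^ s = 3 ^ 2 * 3 ^ (s - 2)" by (metis power_add)
      ultimately show ?thesis by simp
    qed
    have 2: "8 * 2 ^ (t - 3) \<le> real s ^ t"
    proof -
      have "(2::real) ^ t \<le> real s ^ t" using s by (intro power_mono) auto
      moreover have "t = 3 + (t - 3)"
        by (rule le_add_diff_inverse[symmetric]) (use t in simp)
      then have "(2::real) ^ t = 2 ^ 3 * 2 ^ (t - 3)" by (metis power_add)
      ultimately show ?thesis by simp
    qed
    have 3: "real g ^ 5 \<le> real g ^ (s + t)" using g s t by (intro power_increasing) auto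
    have "(9 * 3 ^ (s - 2)) * (8 * 2 ^ (t - 3)) * real g ^ 5 \<le> real t ^ s * real s ^ t * real g ^ (s + t)"
      by (intro mult_mono 1 2 3) auto
    then have "fact s * fact t * ((9 * 3 ^ (s - 2)) * (8 * 2 ^ (t - 3)) * real g ^ 5)
        \<le> fact s * fact t * (real t ^ s * real s ^ t * real g ^ (s + t))"
      by (rule mult_left_mono) simp
    then have "1 / (fact s * fact t * (real t ^ s * real s ^ t * real g ^ (s + t)))
        \<le> 1 / (fact s * fact t * ((9 * 3 ^ (s - 2)) * (8 * 2 ^ (t - 3)) * real g ^ 5))"
      using s t g by (intro divide_left_mono mult_pos_pos) auto
    moreover have "reduced_weight s t g = 1 / (fact s * fact t * (real t ^ s * real s ^ t * real g ^ (s + t)))"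
      by (simp add: reduced_weight_def cyc_def power_mult_distrib power_add mult_ac)
    ultimately show "reduced_weight s t g \<le> 1 / 72 * (?c s * (?d t * (1 / real g ^ 5)))"
      by (simp add: mult_ac)
  qed
  also have "\<dots> = 1 / 72 * ((\<Sum>s=2..N. ?c s) * ((\<Sum>t=3..N. ?d t) * (\<Sum>g=1..N. 1 / real g ^ 5)))"
    by (simp only: sum_distrib_left[symmetric] sum_distrib_right[symmetric])
  also have "\<dots> \<le> 1 / 72 * (1 / 2 / (1 - 1 / 9) * (1 / 6 / (1 - 1 / 8) * (1051 / 1000)))"
    by (intro mult_left_mono mult_mono c d sum_inverse_fifth mult_nonneg_nonneg sum_nonneg) auto
  also have "\<dots> \<le> 157 / 100000" by simp
  finally show ?thesis .
qed

text \<open>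
  The weight is symmetric, so twice the sum over \<open>b < a\<close> suffices; these pairs are written as \<open>a = t * g\<close>,
  \<open>b = s * g\<close> with \<open>g = gcd a b\<close>.
\<close>

lemma sum_block_coeff: "(\<Sum>k=1..N. block_coeff k) \<le> 116 / 1000"
proof -
  let ?T = "off_diagonal N"
  let ?P = "{(a, b). 2 \<le> b \<and> b < a \<and> a \<le> N}"
  let ?D = "{1} \<times> {2..N} \<times> {2..N}" and ?E = "{2..N} \<times> {3..N} \<times> {1..N}"
  have fin: "finite ?P" by (rule finite_subset[of _ "{..N} \<times> {..N}"]) auto
  have "(\<Sum>k=1..N. block_coeff k) = (\<Sum>x\<in>Sigma {1..N} (\<lambda>k. {t. t \<in> off_diagonal k \<and> lcm (fst t) (snd t) = k}). block_weight (snd x))"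
    unfolding block_coeff_def by (subst sum.Sigma) (auto simp: finite_off_diagonal split_beta)
  also have "\<dots> = (\<Sum>t\<in>snd ` Sigma {1..N} (\<lambda>k. {t. t \<in> off_diagonal k \<and> lcm (fst t) (snd t) = k}). block_weight t)"
    by (subst sum.reindex) (auto simp: inj_on_def)
  also have "\<dots> \<le> (\<Sum>t\<in>?T. block_weight t)"
    by (intro sum_mono2 finite_off_diagonal block_weight_nonneg) (auto simp: off_diagonal_def)
  also have "?T = ?P \<union> prod.swap ` ?P" by (auto simp: off_diagonal_def image_iff)
  also have "(\<Sum>t\<in>?P \<union> prod.swap ` ?P. block_weight t) = (\<Sum>t\<in>?P. block_weight t) + (\<Sum>t\<in>prod.swap ` ?P. block_weight t)"
    using fin by (intro sum.union_disjoint) auto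
  also have "(\<Sum>t\<in>prod.swap ` ?P. block_weight t) = (\<Sum>t\<in>?P. block_weight t)"
    by (subst sum.reindex) (auto intro!: sum.cong block_weight_swap)
  also have "(\<Sum>t\<in>?P. block_weight t) \<le> (\<Sum>x\<in>?D \<union> ?E. reduced_weight (fst x) (fst (snd x)) (snd (snd x)))"
  proof (rule sum_le_included[where i = "\<lambda>x. (fst (snd x) * snd (snd x), fst x * snd (snd x))"])
    show "\<forall>x\<in>?P. \<exists>y\<in>?D \<union> ?E. (fst (snd y) * snd (snd y), fst y * snd (snd y)) = x \<and>
        block_weight x \<le> reduced_weight (fst y) (fst (snd y)) (snd (snd y))"
    proof
      fix x assume "x \<in> ?P"
      then obtain a b where x: "x = (a, b)" and ab: "2 \<le> b" "b < a" "a \<le> N" by auto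
      define g where "g = gcd a b"
      define t s where "t = a div g" and "s = b div g"
      have t: "a = t * g" and s: "b = s * g" unfolding t_def s_def g_def by simp_all
      have g: "g \<ge> 1" using ab by (cases g) (auto simp: t)
      have st: "s < t" "s \<ge> 1" using ab g t s by (auto intro: Nat.gr0I simp: Suc_le_eq)
      have "t \<le> a" "g \<le> b" unfolding t s using g st by simp_all
      then have bounds: "g \<le> b" "t \<le> N" using ab by linarith+
      have "(s, t, g) \<in> ?D \<union> ?E"
      proof (cases "s = 1")
        case True
        then show ?thesis using st bounds ab s by auto
      next
        case False
        then show ?thesis using st bounds ab g by auto
      qed
      moreover have "block_weight x = reduced_weight s t g"
        using block_weight_reduced[of a b] ab unfolding x g_def[symmetric] t_def[symmetric] s_def[symmetric] by simp
      ultimately show "\<exists>y\<in>?D \<union> ?E. (fst (snd y) * snd (snd y), fst y * snd (snd y)) = x \<and>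
        block_weight x \<le> reduced_weight (fst y) (fst (snd y)) (snd (snd y))"
        by (intro bexI[of _ "(s, t, g)"]) (simp_all add: x t s)
    qed
  qed (auto simp: fin reduced_weight_def cyc_nonneg)
  also have "\<dots> = (\<Sum>x\<in>?D. reduced_weight (fst x) (fst (snd x)) (snd (snd x))) + (\<Sum>x\<in>?E. reduced_weight (fst x) (fst (snd x)) (snd (snd x)))"
    by (intro sum.union_disjoint) auto
  also have "(\<Sum>x\<in>?D. reduced_weight (fst x) (fst (snd x)) (snd (snd x))) = (\<Sum>t=2..N. \<Sum>g=2..N. reduced_weight 1 t g)"
    by (simp add: sum.cartesian_product' split_beta)
  also have "(\<Sum>x\<in>?E. reduced_weight (fst x) (fst (snd x)) (snd (snd x))) = (\<Sum>s=2..N. \<Sum>t=3..N. \<Sum>g=1..N. reduced_weight s t g)"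
    by (simp add: sum.cartesian_product' split_beta)
  finally show ?thesis using sum_dividing_blocks[of N] sum_nondividing_blocks[of N] by simp
qed

section \<open>The total weight of the core\<close>

lemma long_cycle_prob_values:
  "long_cycle_prob 0 = 1" "long_cycle_prob 1 = 0" "long_cycle_prob 2 = 0" "long_cycle_prob 3 = 1 / 3"
  by (simp_all add: long_cycle_prob_def exp_coeff.simps long_cycle_coeff_def numeral_eq_Suc)

lemma long_cycle_prob_rec:
  "long_cycle_prob (Suc (n + 2)) = (\<Sum>j\<le>n. long_cycle_prob j) / real (n + 3)"
proof -
  have "(\<Sum>i\<le>n + 2. real (Suc i) * long_cycle_coeff (Suc i) * long_cycle_prob (n + 2 - i))
     = (\<Sum>i\<in>{2..n + 2}. long_cycle_prob (n + 2 - i))"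
    by (rule sum.mono_neutral_cong_right) (auto simp: long_cycle_coeff_def simp del: of_nat_Suc)
  also have "\<dots> = (\<Sum>j\<le>n. long_cycle_prob j)"
    by (rule sum.reindex_bij_witness[where i = "\<lambda>j. n + 2 - j" and j = "\<lambda>i. n + 2 - i"]) auto
  finally show ?thesis unfolding long_cycle_prob_def exp_coeff.simps(2) by simp
qed

text \<open>
  The recurrence exhibits \<open>long_cycle_prob n\<close> as a sum of \<open>n - 2\<close> earlier values divided by \<open>n\<close>; the values at 0, 1, 2, 3 add up to
  \<open>4 / 3\<close>, and the later ones are at most \<open>1 / 4\<close> by induction.
\<close>

lemma long_cycle_prob_le: "n \<ge> 4 \<Longrightarrow> long_cycle_prob n \<le> 1 / 4"
proof (induction n rule: less_induct)
  case (less n)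
  define m where "m = n - 3"
  have n: "n = Suc (m + 2)" and m: "m \<ge> 1" using less.prems by (auto simp: m_def)
  have "(\<Sum>j\<le>m. long_cycle_prob j) \<le> real (m + 3) / 4"
  proof (cases "m \<le> 3")
    case True
    then consider "m = 1" | "m = 2" | "m = 3" using m by linarith
    moreover have "{..1::nat} = {0, 1}" "{..2::nat} = {0, 1, 2}" "{..3::nat} = {0, 1, 2, 3}" by auto
    ultimately show ?thesis by cases (simp_all add: long_cycle_prob_values[unfolded One_nat_def])
  next
    case False
    have "{..m} = {..3} \<union> {4..m}" using False by auto
    then have "(\<Sum>j\<le>m. long_cycle_prob j) = (\<Sum>j\<le>3. long_cycle_prob j) + (\<Sum>j=4..m. long_cycle_prob j)"
      by (simp only:) (rule sum.union_disjoint, auto)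
    also have "(\<Sum>j\<le>3. long_cycle_prob j) = 4 / 3"
    proof -
      have "{..3::nat} = {0, 1, 2, 3}" by auto
      then show ?thesis by (simp add: long_cycle_prob_values[unfolded One_nat_def])
    qed
    also have "(\<Sum>j=4..m. long_cycle_prob j) \<le> (\<Sum>j=4..m. 1 / 4)"
      by (rule sum_mono) (use less.IH n in auto)
    also have "(\<Sum>j=4..m. 1 / 4) = (real m - 3) / 4" using False by simp
    finally have "(\<Sum>j\<le>m. long_cycle_prob j) \<le> 4 / 3 + (real m - 3) / 4" by simp
    also have "\<dots> \<le> real (m + 3) / 4" by (simp add: field_simps)
    finally show ?thesis .
  qed
  then have "(\<Sum>j\<le>m. long_cycle_prob j) / real (m + 3) \<le> 1 / 4" by (simp add: field_simps)
  then show ?case unfolding n long_cycle_prob_rec .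
qed

text \<open>
  Summing \<open>core_term\<close> over \<open>v\<close> (or \<open>u\<close>) replaces the reciprocal factorial of a number of fixed points by this quantity, at
  \<open>d = p + 2 * i\<close> (or \<open>p + 2 * j\<close>).
\<close>

definition shifted_sum :: "nat \<Rightarrow> nat \<Rightarrow> real" where
  "shifted_sum N d = (\<Sum>v\<le>N. long_cycle_prob v * cyc 1 (d + v))"

lemma shifted_sum_nonneg: "shifted_sum N d \<ge> 0"
  unfolding shifted_sum_def by (intro sum_nonneg mult_nonneg_nonneg long_cycle_prob_nonneg cyc_nonneg)

lemma shifted_sum_Suc: "shifted_sum N (Suc d) \<le> shifted_sum N d / real (Suc d)"
  unfolding shifted_sum_def sum_divide_distrib
proof (rule sum_mono)
  fix v
  have "real (Suc d) * fact (d + v) \<le> fact (Suc d + v)"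
    unfolding add_Suc fact_Suc by (intro mult_right_mono) auto
  then have "1 / fact (Suc d + v) \<le> 1 / (real (Suc d) * fact (d + v))"
    by (intro divide_left_mono mult_pos_pos) auto
  then have "cyc 1 (Suc d + v) \<le> cyc 1 (d + v) / real (Suc d)" by (simp add: cyc_def mult_ac)
  then have "long_cycle_prob v * cyc 1 (Suc d + v) \<le> long_cycle_prob v * (cyc 1 (d + v) / real (Suc d))"
    by (rule mult_left_mono) (rule long_cycle_prob_nonneg)
  then show "long_cycle_prob v * cyc 1 (Suc d + v) \<le> long_cycle_prob v * cyc 1 (d + v) / real (Suc d)" by simp
qed

text \<open>
  The values of \<open>long_cycle_prob\<close> at 0 and 3 give the first two terms; the remaining ones form a geometric tail.
\<close>

lemma shifted_sum_le:
  "shifted_sum N d \<le> 1 / fact d + 1 / 3 / fact (d + 3) + 1 / 4 / fact (d + 4) / (1 - 1 / real (d + 5))"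
proof -
  let ?f = "\<lambda>v. long_cycle_prob v * cyc 1 (d + v)"
  have "shifted_sum N d \<le> (\<Sum>v\<in>{0, 1, 2, 3} \<union> {4..N}. ?f v)"
    unfolding shifted_sum_def by (intro sum_mono2 mult_nonneg_nonneg long_cycle_prob_nonneg cyc_nonneg) auto
  also have "\<dots> = (\<Sum>v\<in>{0, 1, 2, 3}. ?f v) + (\<Sum>v=4..N. ?f v)" by (intro sum.union_disjoint) auto
  also have "(\<Sum>v\<in>{0, 1, 2, 3}. ?f v) = 1 / fact d + 1 / 3 / fact (d + 3)"
    by (simp add: long_cycle_prob_values[unfolded One_nat_def] cyc_def)
  also have "(\<Sum>v=4..N. ?f v) \<le> (\<Sum>v=4..N. 1 / 4 / fact (d + v))"
  proof (rule sum_mono)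
    fix v assume "v \<in> {4..N}"
    then have "long_cycle_prob v * (1 / fact (d + v)) \<le> 1 / 4 * (1 / fact (d + v))"
      by (intro mult_right_mono long_cycle_prob_le) auto
    then show "?f v \<le> 1 / 4 / fact (d + v)" by (simp add: cyc_def)
  qed
  also have "\<dots> \<le> 1 / 4 / fact (d + 4) / (1 - 1 / real (d + 5))"
  proof (rule sum_le_geometric)
    fix v :: nat assume v: "v \<ge> 4"
    have "real (d + 5) * fact (d + v) \<le> fact (d + Suc v)"
      unfolding add_Suc_right fact_Suc using v by (intro mult_right_mono) auto
    then have "1 / fact (d + Suc v) \<le> 1 / (real (d + 5) * fact (d + v))"
      by (intro divide_left_mono mult_pos_pos) auto
    then have "1 / 4 * (1 / fact (d + Suc v)) \<le> 1 / 4 * (1 / (real (d + 5) * fact (d + v)))"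
      by (rule mult_left_mono) simp
    then show "1 / 4 / fact (d + Suc v) \<le> 1 / real (d + 5) * (1 / 4 / fact (d + v))" by (simp add: mult_ac)
  qed auto
  finally show ?thesis by simp
qed

lemma shifted_sum_values:
  "shifted_sum N 0 \<le> 10686 / 10000" "shifted_sum N 1 \<le> 10164 / 10000" "shifted_sum N 2 \<le> 5032 / 10000"
  "shifted_sum N 3 \<le> 1672 / 10000" "shifted_sum N 4 \<le> 418 / 10000"
  using shifted_sum_le[of N 0] shifted_sum_le[of N 1] shifted_sum_le[of N 2] shifted_sum_le[of N 3] shifted_sum_le[of N 4]
  by (simp_all add: fact_numeral)

lemma summable_square_series:
  assumes "a \<ge> 1"
  shows "(\<lambda>n. real n ^ 2 * fps_nth (square_series a) n) \<longlonglongrightarrow> 0" and "summable (fps_nth (square_series a))"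
proof -
  show lim: "(\<lambda>n. real n ^ 2 * fps_nth (square_series a) n) \<longlonglongrightarrow> 0"
    by (rule geometric_coeff_tendsto[OF nonneg_square_series])
      (rule partial_eval_square_series[OF assms], simp)
  from bounded_coeff_of_tendsto[OF this] obtain C where "\<And>n. real n ^ 2 * \<bar>fps_nth (square_series a) n\<bar> \<le> C" by blast
  then show "summable (fps_nth (square_series a))" by (rule summable_of_bounded_coeff)
qed

definition square_total :: "nat \<Rightarrow> real" where
  "square_total a = (\<Sum>n. fps_nth (square_series a) n)"

lemma sum_cyc_squares_le:
  assumes a: "a \<ge> 1"
  shows "(\<Sum>q\<le>N. cyc a q ^ 2) \<le> square_total a"
proof -
  have "(\<Sum>q\<le>N. cyc a q ^ 2) = (\<Sum>n\<in>(\<lambda>q. a * q) ` {..N}. fps_nth (square_series a) n)"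
    using a by (subst sum.reindex) (auto simp: inj_on_def square_series_def block_series_nth cyc_def)
  also have "\<dots> \<le> square_total a"
    unfolding square_total_def
    by (intro sum_le_suminf summable_square_series a) (auto intro: nonneg_seriesD nonneg_square_series)
  finally show ?thesis .
qed

lemma square_total_lower: "square_total 1 \<ge> 22795 / 10000" "square_total 2 \<ge> 1265625 / 1000000"
proof -
  have "(\<Sum>q\<le>4. cyc 1 q ^ 2) \<ge> 22795 / 10000"
  proof -
    have "{..4::nat} = {0, 1, 2, 3, 4}" by auto
    then show ?thesis by (simp add: cyc_def fact_numeral power2_eq_square)
  qed
  then show "square_total 1 \<ge> 22795 / 10000" using sum_cyc_squares_le[of 1 4] by simp
  have "(\<Sum>q\<le>2. cyc 2 q ^ 2) \<ge> 1265625 / 1000000"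
  proof -
    have "{..2::nat} = {0, 1, 2}" by auto
    then show ?thesis by (simp add: cyc_def fact_numeral power2_eq_square)
  qed
  then show "square_total 2 \<ge> 1265625 / 1000000" using sum_cyc_squares_le[of 2 2] by simp
qed

text \<open>
  For \<open>j = 0\<close> the total of \<open>core\<close> with given \<open>i\<close> is the product of the sum over \<open>q\<close> (2-cycles) and the sum over \<open>p\<close>
  (fixed points).
\<close>

definition two_cycle_sum :: "nat \<Rightarrow> nat \<Rightarrow> real" where
  "two_cycle_sum N i = (\<Sum>q\<le>N. cyc 2 q * cyc 2 (q + i))"

definition fixed_point_sum :: "nat \<Rightarrow> nat \<Rightarrow> real" where
  "fixed_point_sum N i = (\<Sum>p\<le>N. shifted_sum N p * shifted_sum N (p + 2 * i))"

lemma two_cycle_sum_nonneg: "two_cycle_sum N i \<ge> 0"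
  unfolding two_cycle_sum_def by (intro sum_nonneg mult_nonneg_nonneg cyc_nonneg)

lemma fixed_point_sum_nonneg: "fixed_point_sum N i \<ge> 0"
  unfolding fixed_point_sum_def by (intro sum_nonneg mult_nonneg_nonneg shifted_sum_nonneg)

lemma two_cycle_sum_0: "two_cycle_sum N 0 \<le> square_total 2"
  using sum_cyc_squares_le[of 2 N] by (simp add: two_cycle_sum_def power2_eq_square)

lemma cyc_Suc: "cyc a (Suc k) = cyc a k / (real a * real (Suc k))"
  by (simp add: cyc_def mult_ac)

lemma two_cycle_sum_1: "two_cycle_sum N 1 \<le> 4467 / 10000 * square_total 2"
proof -
  have "two_cycle_sum N 1 \<le> (\<Sum>q<1. cyc 2 q * cyc 2 (q + 1)) + cyc 2 1 * cyc 2 (1 + 1) / (1 - 1 / 24)"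
    unfolding two_cycle_sum_def
  proof (rule sum_le_initial_geometric)
    fix q :: nat assume q: "q \<ge> 1"
    have "(24::real) \<le> (real 2 * real (Suc q)) * (real 2 * real (Suc (q + 1)))"
      using q mult_mono[of 4 "real 2 * real (Suc q)" 6 "real 2 * real (Suc (q + 1))"] by simp
    then have "cyc 2 q * cyc 2 (q + 1) / ((real 2 * real (Suc q)) * (real 2 * real (Suc (q + 1)))) \<le> cyc 2 q * cyc 2 (q + 1) / 24"
      by (intro divide_left_mono mult_nonneg_nonneg cyc_nonneg) auto
    then show "cyc 2 (Suc q) * cyc 2 (Suc q + 1) \<le> 1 / 24 * (cyc 2 q * cyc 2 (q + 1))"
      by (simp only: add_Suc cyc_Suc times_divide_times_eq)
  qed (auto simp: cyc_nonneg)
  also have "\<dots> \<le> 56523 / 100000" by (simp add: cyc_def fact_numeral numeral_eq_Suc[of "num.Bit0 num.One"])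
  also have "\<dots> \<le> 4467 / 10000 * square_total 2" using square_total_lower(2) by simp
  finally show ?thesis .
qed

lemma two_cycle_sum_le:
  assumes "i \<ge> 2"
  shows "two_cycle_sum N i \<le> 1 / 8 * square_total 2"
proof -
  have cyc2: "cyc 2 i \<le> 1 / 8"
  proof -
    obtain j where j: "i = 2 + j" using assms le_Suc_ex by blast
    have "cyc 2 i \<le> cyc 2 2 * cyc 2 j" unfolding j by (rule cyc_add_le)
    also have "\<dots> \<le> cyc 2 2 * 1" by (intro mult_left_mono cyc_le_one cyc_nonneg) auto
    also have "\<dots> = 1 / 8" by (simp add: cyc_def)
    finally show ?thesis .
  qed
  have "two_cycle_sum N i \<le> (\<Sum>q\<le>N. 1 / 8 * cyc 2 q ^ 2)"
    unfolding two_cycle_sum_def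
  proof (rule sum_mono)
    fix q
    have "cyc 2 q * cyc 2 (q + i) \<le> cyc 2 q * (cyc 2 q * cyc 2 i)"
      by (intro mult_left_mono cyc_add_le cyc_nonneg)
    also have "\<dots> \<le> cyc 2 q * (cyc 2 q * (1 / 8))" by (intro mult_left_mono cyc2 cyc_nonneg)
    finally show "cyc 2 q * cyc 2 (q + i) \<le> 1 / 8 * cyc 2 q ^ 2" by (simp add: power2_eq_square)
  qed
  also have "\<dots> = 1 / 8 * (\<Sum>q\<le>N. cyc 2 q ^ 2)" by (rule sum_distrib_left[symmetric])
  also have "\<dots> \<le> 1 / 8 * square_total 2" by (intro mult_left_mono sum_cyc_squares_le) auto
  finally show ?thesis .
qed

lemma shifted_sum_step:
  assumes "d \<ge> e"
  shows "shifted_sum N (Suc d) \<le> shifted_sum N d / real (Suc e)"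
proof -
  have "shifted_sum N d / real (Suc d) \<le> shifted_sum N d / real (Suc e)"
    using assms by (intro divide_left_mono shifted_sum_nonneg) auto
  then show ?thesis using shifted_sum_Suc[of N d] by linarith
qed

lemma fixed_point_term_step:
  assumes "p \<ge> e"
  shows "shifted_sum N (Suc p) * shifted_sum N (Suc p + d) \<le> 1 / (real (Suc e) * real (Suc (e + d))) * (shifted_sum N p * shifted_sum N (p + d))"
proof -
  have "shifted_sum N (Suc p) * shifted_sum N (Suc p + d) \<le> (shifted_sum N p / real (Suc e)) * (shifted_sum N (p + d) / real (Suc (e + d)))"
    unfolding add_Suc using assms by (intro mult_mono shifted_sum_step shifted_sum_nonneg divide_nonneg_nonneg) auto
  then show ?thesis by simp
qed

lemma fixed_point_sum_le:
  "fixed_point_sum N i \<le> (\<Sum>p<e. shifted_sum N p * shifted_sum N (p + 2 * i))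
     + shifted_sum N e * shifted_sum N (e + 2 * i) / (1 - 1 / (real (Suc e) * real (Suc (e + 2 * i))))"
  if "e \<ge> 1"
  unfolding fixed_point_sum_def
proof (rule sum_le_initial_geometric)
  have "1 * 1 < real (Suc e) * real (Suc (e + 2 * i))" using that by (intro mult_strict_mono) auto
  then show "1 / (real (Suc e) * real (Suc (e + 2 * i))) < 1" by simp
  show "shifted_sum N (Suc p) * shifted_sum N (Suc p + 2 * i)
      \<le> 1 / (real (Suc e) * real (Suc (e + 2 * i))) * (shifted_sum N p * shifted_sum N (p + 2 * i))" if "p \<ge> e" for p
    using that by (rule fixed_point_term_step)
qed (simp_all only: mult_nonneg_nonneg shifted_sum_nonneg, simp)

lemma shifted_sum_products:
  "shifted_sum N 0 * shifted_sum N 0 \<le> 114191 / 100000" "shifted_sum N 1 * shifted_sum N 1 \<le> 103308 / 100000"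
  "shifted_sum N 2 * shifted_sum N 2 \<le> 25322 / 100000" "shifted_sum N 3 * shifted_sum N 3 \<le> 2796 / 100000"
  "shifted_sum N 4 * shifted_sum N 4 \<le> 175 / 100000" "shifted_sum N 0 * shifted_sum N 2 \<le> 53772 / 100000"
  "shifted_sum N 1 * shifted_sum N 3 \<le> 16995 / 100000" "shifted_sum N 2 * shifted_sum N 4 \<le> 2104 / 100000"
  "shifted_sum N 0 * shifted_sum N 4 \<le> 4467 / 100000" "shifted_sum N 1 * shifted_sum N 5 \<le> 850 / 100000"
proof -
  have 5: "shifted_sum N 5 \<le> 836 / 100000" using shifted_sum_Suc[of N 4] shifted_sum_values(5)[of N] by simp
  have *: "shifted_sum N d * shifted_sum N e \<le> z" if "shifted_sum N d \<le> x" "shifted_sum N e \<le> y" "x * y \<le> z" "0 \<le> x" for d e x y z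
    using mult_mono[OF that(1,2) that(4) shifted_sum_nonneg] that(3) by linarith
  note v = shifted_sum_values[of N]
  show "shifted_sum N 0 * shifted_sum N 0 \<le> 114191 / 100000" by (rule *[OF v(1) v(1)]) simp_all
  show "shifted_sum N 1 * shifted_sum N 1 \<le> 103308 / 100000" by (rule *[OF v(2) v(2)]) simp_all
  show "shifted_sum N 2 * shifted_sum N 2 \<le> 25322 / 100000" by (rule *[OF v(3) v(3)]) simp_all
  show "shifted_sum N 3 * shifted_sum N 3 \<le> 2796 / 100000" by (rule *[OF v(4) v(4)]) simp_all
  show "shifted_sum N 4 * shifted_sum N 4 \<le> 175 / 100000" by (rule *[OF v(5) v(5)]) simp_all
  show "shifted_sum N 0 * shifted_sum N 2 \<le> 53772 / 100000" by (rule *[OF v(1) v(3)]) simp_all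
  show "shifted_sum N 1 * shifted_sum N 3 \<le> 16995 / 100000" by (rule *[OF v(2) v(4)]) simp_all
  show "shifted_sum N 2 * shifted_sum N 4 \<le> 2104 / 100000" by (rule *[OF v(3) v(5)]) simp_all
  show "shifted_sum N 0 * shifted_sum N 4 \<le> 4467 / 100000" by (rule *[OF v(1) v(5)]) simp_all
  show "shifted_sum N 1 * shifted_sum N 5 \<le> 850 / 100000" by (rule *[OF v(2) 5]) simp_all
qed

lemma fixed_point_sum_values:
  "fixed_point_sum N 0 \<le> 24581 / 10000" "fixed_point_sum N 1 \<le> 7304 / 10000" "fixed_point_sum N 2 \<le> 54 / 1000"
proof -
  note c = shifted_sum_products[of N]
  have sums: "(\<Sum>p<4. f p) = f 0 + f 1 + f 2 + f 3" "(\<Sum>p<2. f p) = f 0 + f 1" "(\<Sum>p<1. f p) = f 0" for f :: "nat \<Rightarrow> real"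
    by (simp_all add: numeral_eq_Suc)
  have "fixed_point_sum N 0 \<le> shifted_sum N 0 * shifted_sum N 0 + shifted_sum N 1 * shifted_sum N 1 + shifted_sum N 2 * shifted_sum N 2
      + shifted_sum N 3 * shifted_sum N 3 + shifted_sum N 4 * shifted_sum N 4 / (1 - 1 / 25)"
    using fixed_point_sum_le[of 4 N 0] unfolding sums by simp
  then show "fixed_point_sum N 0 \<le> 24581 / 10000" using c(1-5) by simp
  have "fixed_point_sum N 1 \<le> shifted_sum N 0 * shifted_sum N 2 + shifted_sum N 1 * shifted_sum N 3 + shifted_sum N 2 * shifted_sum N 4 / (1 - 1 / 15)"
    using fixed_point_sum_le[of 2 N 1] unfolding sums by (simp add: numeral_eq_Suc)
  then show "fixed_point_sum N 1 \<le> 7304 / 10000" using c(6-8) by simp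
  have "fixed_point_sum N 2 \<le> shifted_sum N 0 * shifted_sum N 4 + shifted_sum N 1 * shifted_sum N 5 / (1 - 1 / 12)"
    using fixed_point_sum_le[of 1 N 2] unfolding sums by (simp add: numeral_eq_Suc)
  then show "fixed_point_sum N 2 \<le> 54 / 1000" using c(9-10) by simp
qed

lemma sum_fixed_point_sum: "(\<Sum>i=2..N. fixed_point_sum M i) \<le> 5625 / 100000"
proof -
  have "(\<Sum>i=2..N. fixed_point_sum M i) \<le> fixed_point_sum M 2 / (1 - 1 / 25)"
  proof (rule sum_le_geometric)
    fix i :: nat assume i: "i \<ge> 2"
    have "shifted_sum M p * shifted_sum M (p + 2 * Suc i) \<le> 1 / 25 * (shifted_sum M p * shifted_sum M (p + 2 * i))" for p
    proof -
      have "shifted_sum M (Suc (Suc (p + 2 * i))) \<le> shifted_sum M (Suc (p + 2 * i)) / real (Suc 4)"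
        using i by (intro shifted_sum_step) auto
      also have "\<dots> \<le> (shifted_sum M (p + 2 * i) / real (Suc 4)) / real (Suc 4)"
        using i by (intro divide_right_mono shifted_sum_step) auto
      finally have "shifted_sum M (p + 2 * Suc i) \<le> 1 / 25 * shifted_sum M (p + 2 * i)" by simp
      then have "shifted_sum M p * shifted_sum M (p + 2 * Suc i) \<le> shifted_sum M p * (1 / 25 * shifted_sum M (p + 2 * i))"
        by (rule mult_left_mono) (rule shifted_sum_nonneg)
      then show ?thesis by simp
    qed
    then show "fixed_point_sum M (Suc i) \<le> 1 / 25 * fixed_point_sum M i"
      unfolding fixed_point_sum_def sum_distrib_left by (intro sum_mono)
  qed (auto simp: fixed_point_sum_nonneg)
  then show ?thesis using fixed_point_sum_values(3)[of M] by simp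
qed

lemma long_cycle_prob_le_one: "long_cycle_prob n \<le> 1"
proof (cases "n \<ge> 4")
  case False
  then have "n \<in> {0, 1, 2, 3}" by auto
  then show ?thesis by (auto simp: long_cycle_prob_values[unfolded One_nat_def])
qed (use long_cycle_prob_le[of n] in simp)

lemma nonneg_core_series: "nonneg_series core_series"
  by (auto simp: nonneg_series_def core_series_def intro!: sum_nonneg core_term_nonneg)

lemma partial_eval_core_le:
  assumes r: "r \<ge> 0"
  shows "partial_eval N r core_series \<le> (\<Sum>x\<in>core_box N. core_term x * r ^ core_size x)"
proof -
  have "partial_eval N r core_series
     = (\<Sum>m\<le>N. \<Sum>x | x \<in> {x. x \<in> core_box N \<and> core_size x \<le> N} \<and> core_size x = m. core_term x * r ^ core_size x)"
    unfolding partial_eval_def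
  proof (intro sum.cong refl)
    fix m assume m: "m \<in> {..N}"
    have "{x. x \<in> {x. x \<in> core_box N \<and> core_size x \<le> N} \<and> core_size x = m} = {x. x \<in> core_box m \<and> core_size x = m}"
      using m core_size_box by force
    then show "fps_nth core_series m * r ^ m
       = (\<Sum>x | x \<in> {x. x \<in> core_box N \<and> core_size x \<le> N} \<and> core_size x = m. core_term x * r ^ core_size x)"
      by (simp add: core_series_def sum_distrib_right)
  qed
  also have "\<dots> = (\<Sum>x | x \<in> core_box N \<and> core_size x \<le> N. core_term x * r ^ core_size x)"
    using finite_core_box by (intro sum.group) auto
  also have "\<dots> \<le> (\<Sum>x\<in>core_box N. core_term x * r ^ core_size x)"
    using r by (intro sum_mono2 finite_core_box mult_nonneg_nonneg core_term_nonneg) auto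
  finally show ?thesis .
qed

lemma cyc_add_le_left: "a \<ge> 1 \<Longrightarrow> cyc a (j + k) \<le> cyc a j"
proof -
  assume a: "a \<ge> 1"
  have "cyc a (j + k) \<le> cyc a j * cyc a k" by (rule cyc_add_le)
  also have "\<dots> \<le> cyc a j * 1" by (intro mult_left_mono cyc_le_one[OF a] cyc_nonneg)
  finally show ?thesis by simp
qed

text \<open>
  Reciprocal factorials dominate: even after weighting size \<open>m\<close> with \<open>2 ^ m\<close> the sum over all six parameters is finite.
\<close>

lemma core_series_tendsto: "(\<lambda>n. real n ^ 2 * fps_nth core_series n) \<longlonglongrightarrow> 0"
proof (rule geometric_coeff_tendsto[OF nonneg_core_series])
  fix N
  let ?e = "\<lambda>x c. x ^ c / fact c :: real"
  have bound: "core_term (p, q, i, j, u, v) * 2 ^ core_size (p, q, i, j, u, v)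
      \<le> ?e 2 p * (?e 1 q * (?e 4 i * (?e 4 j * (?e 2 u * ?e 2 v))))" for p q i j u v
  proof -
    have 1: "cyc 1 (p + 2 * i + v) \<le> cyc 1 p * cyc 1 i * cyc 1 v"
    proof -
      have "cyc 1 (p + 2 * i + v) \<le> cyc 1 (p + 2 * i) * cyc 1 v" by (rule cyc_add_le)
      also have "\<dots> \<le> cyc 1 p * cyc 1 (i + i) * cyc 1 v"
        unfolding mult_2 by (intro mult_right_mono cyc_add_le cyc_nonneg)
      also have "\<dots> \<le> cyc 1 p * cyc 1 i * cyc 1 v"
        by (intro mult_right_mono mult_left_mono cyc_add_le_left cyc_nonneg) simp
      finally show ?thesis .
    qed
    have 2: "cyc 1 (p + 2 * j + u) \<le> cyc 1 j * cyc 1 u"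
    proof -
      have "cyc 1 (p + 2 * j + u) = cyc 1 ((j + (j + p)) + u)" by (simp add: mult_2 add_ac)
      also have "\<dots> \<le> cyc 1 (j + (j + p)) * cyc 1 u" by (rule cyc_add_le)
      also have "\<dots> \<le> cyc 1 j * cyc 1 u"
        by (intro mult_right_mono cyc_add_le_left cyc_nonneg) simp
      finally show ?thesis .
    qed
    have "core_term (p, q, i, j, u, v) \<le>
        1 * ((cyc 1 p * cyc 1 i * cyc 1 v) * (cyc 1 j * cyc 1 u)) * (cyc 2 q * cyc 2 q) * 1 * 1"
      unfolding core_term_def core_def prod.case
      by (intro mult_mono 1 2 cyc_add_le_left long_cycle_prob_le_one mult_nonneg_nonneg cyc_nonneg
          long_cycle_prob_nonneg) simp_all
    also have "cyc 2 q * cyc 2 q \<le> (1 / 4) ^ q * cyc 1 q"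
    proof -
      have "(1 / 4) ^ q * (1 / fact q) * (1 / fact q) \<le> (1 / 4) ^ q * (1 / fact q) * (1::real)"
        by (intro mult_left_mono) (auto simp: fact_ge_1)
      moreover have "(2::real) ^ q * 2 ^ q = 4 ^ q" by (simp flip: power_mult_distrib)
      ultimately show ?thesis by (simp add: cyc_def power_divide mult_ac)
    qed
    finally have "core_term (p, q, i, j, u, v)
       \<le> 1 * ((cyc 1 p * cyc 1 i * cyc 1 v) * (cyc 1 j * cyc 1 u)) * ((1 / 4) ^ q * cyc 1 q) * 1 * 1"
      by (simp add: mult_left_mono mult_right_mono cyc_nonneg)
    then have "core_term (p, q, i, j, u, v) * 2 ^ core_size (p, q, i, j, u, v)
       \<le> (1 * ((cyc 1 p * cyc 1 i * cyc 1 v) * (cyc 1 j * cyc 1 u)) * ((1 / 4) ^ q * cyc 1 q) * 1 * 1) * 2 ^ core_size (p, q, i, j, u, v)"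
      by (rule mult_right_mono) simp
    also have "\<dots> = (1 * ((cyc 1 p * cyc 1 i * cyc 1 v) * (cyc 1 j * cyc 1 u)) * ((1 / 4) ^ q * cyc 1 q) * 1 * 1)
        * (2 ^ p * 4 ^ q * 4 ^ i * 4 ^ j * 2 ^ u * 2 ^ v)"
      by (simp add: core_size_def block_size_def power_add power_mult)
    also have "\<dots> = ?e 2 p * (?e 1 q * (?e 4 i * (?e 4 j * (?e 2 u * ?e 2 v))))"
      by (simp add: cyc_def power_divide)
    finally show ?thesis .
  qed
  have "partial_eval N 2 core_series \<le> (\<Sum>x\<in>core_box N. core_term x * 2 ^ core_size x)"
    by (rule partial_eval_core_le) simp
  also have "\<dots> \<le> (\<Sum>p\<le>N. \<Sum>q\<le>N. \<Sum>i\<le>N. \<Sum>j\<le>N. \<Sum>u\<le>N. \<Sum>v\<le>N. ?e 2 p * (?e 1 q * (?e 4 i * (?e 4 j * (?e 2 u * ?e 2 v)))))"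
    unfolding sum_core_box by (intro sum_mono bound)
  also have "\<dots> = (\<Sum>p\<le>N. ?e 2 p) * ((\<Sum>q\<le>N. ?e 1 q) * ((\<Sum>i\<le>N. ?e 4 i) * ((\<Sum>j\<le>N. ?e 4 j) * ((\<Sum>u\<le>N. ?e 2 u) * (\<Sum>v\<le>N. ?e 2 v)))))"
    by (simp only: sum_distrib_left[symmetric] sum_distrib_right[symmetric])
  also have "\<dots> \<le> exp 2 * (exp 1 * (exp 4 * (exp 4 * (exp 2 * exp 2))))"
    by (intro mult_mono sum_exp_le mult_nonneg_nonneg sum_nonneg divide_nonneg_nonneg) simp_all
  finally show "partial_eval N 2 core_series \<le> exp 2 * (exp 1 * (exp 4 * (exp 4 * (exp 2 * exp 2))))" .
qed

text \<open>
  Only the terms with \<open>i = 0\<close> or \<open>j = 0\<close> are present, so the total is the term \<open>i = j = 0\<close> plus twice the terms with \<open>i \<ge> 1\<close>,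
  \<open>j = 0\<close>. The terms \<open>i = 0\<close> and \<open>i = 1\<close> are estimated individually, the others as a geometric series.
\<close>

lemma core_series_total: "partial_eval N 1 core_series \<le> 1373 / 1000 * square_total 1 * square_total 2"
proof -
  let ?D = long_cycle_prob
  let ?G = "\<lambda>i j. (\<Sum>q\<le>N. cyc 2 (q + j) * cyc 2 (q + i)) * (\<Sum>p\<le>N. shifted_sum N (p + 2 * i) * shifted_sum N (p + 2 * j))"
  let ?H = "\<lambda>i. two_cycle_sum N i * fixed_point_sum N i"
  have "partial_eval N 1 core_series \<le> (\<Sum>x\<in>core_box N. core_term x * 1 ^ core_size x)"
    by (rule partial_eval_core_le) simp
  also have "\<dots> = (\<Sum>p\<le>N. \<Sum>q\<le>N. \<Sum>i\<le>N. \<Sum>j\<le>N. of_bool (i = 0 \<or> j = 0) *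
      ((cyc 2 (q + j) * cyc 2 (q + i)) * (shifted_sum N (p + 2 * i) * shifted_sum N (p + 2 * j))))"
    unfolding sum_core_box
  proof (intro sum.cong refl)
    fix p q i j
    have "(\<Sum>u\<le>N. \<Sum>v\<le>N. core_term (p, q, i, j, u, v) * 1 ^ core_size (p, q, i, j, u, v))
      = (\<Sum>u\<le>N. \<Sum>v\<le>N. (of_bool (i = 0 \<or> j = 0) * (cyc 2 (q + j) * cyc 2 (q + i))) *
          ((?D v * cyc 1 (p + 2 * i + v)) * (?D u * cyc 1 (p + 2 * j + u))))"
      by (intro sum.cong refl) (simp only: core_term_def core_def prod.case power_one mult_1_right mult_ac)
    also have "\<dots> = (of_bool (i = 0 \<or> j = 0) * (cyc 2 (q + j) * cyc 2 (q + i))) *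
         ((\<Sum>v\<le>N. ?D v * cyc 1 (p + 2 * i + v)) * (\<Sum>u\<le>N. ?D u * cyc 1 (p + 2 * j + u)))"
      by (simp only: sum_distrib_left[symmetric] sum_distrib_right[symmetric])
    finally show "(\<Sum>u\<le>N. \<Sum>v\<le>N. core_term (p, q, i, j, u, v) * 1 ^ core_size (p, q, i, j, u, v))
      = of_bool (i = 0 \<or> j = 0) * ((cyc 2 (q + j) * cyc 2 (q + i)) * (shifted_sum N (p + 2 * i) * shifted_sum N (p + 2 * j)))"
      by (simp only: shifted_sum_def mult.assoc)
  qed
  also have "\<dots> = (\<Sum>i\<le>N. \<Sum>j\<le>N. \<Sum>q\<le>N. \<Sum>p\<le>N. of_bool (i = 0 \<or> j = 0) *
      ((cyc 2 (q + j) * cyc 2 (q + i)) * (shifted_sum N (p + 2 * i) * shifted_sum N (p + 2 * j))))"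
  proof -
    have swap: "(\<Sum>p\<le>N. \<Sum>q\<le>N. \<Sum>i\<le>N. \<Sum>j\<le>N. F p q i j) = (\<Sum>i\<le>N. \<Sum>j\<le>N. \<Sum>q\<le>N. \<Sum>p\<le>N. F p q i j)" for F :: "nat \<Rightarrow> nat \<Rightarrow> nat \<Rightarrow> nat \<Rightarrow> real"
      unfolding sum.cartesian_product
      by (rule sum.reindex_bij_witness[where i = "\<lambda>(i, j, q, p). (p, q, i, j)" and j = "\<lambda>(p, q, i, j). (i, j, q, p)"]) auto
    show ?thesis by (rule swap)
  qed
  also have "\<dots> = (\<Sum>i\<le>N. \<Sum>j\<le>N. of_bool (i = 0 \<or> j = 0) * ?G i j)"
    by (simp only: sum_distrib_left[symmetric] sum_distrib_right[symmetric])
  also have "\<dots> = ?G 0 0 + (\<Sum>j=1..N. ?G 0 j) + (\<Sum>i=1..N. ?G i 0)"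
  proof -
    have split: "(\<Sum>i\<le>N. f i) = f 0 + (\<Sum>i=1..N. f i)" for f :: "nat \<Rightarrow> real"
    proof -
      have "{..N} = insert 0 {1..N}" by auto
      then show ?thesis by simp
    qed
    have "(\<Sum>i=1..N. \<Sum>j\<le>N. of_bool (i = 0 \<or> j = 0) * ?G i j) = (\<Sum>i=1..N. ?G i 0)"
    proof (intro sum.cong refl)
      fix i assume i: "i \<in> {1..N}"
      have "(\<Sum>j=1..N. of_bool (i = 0 \<or> j = 0) * ?G i j) = 0" using i by (intro sum.neutral) auto
      then show "(\<Sum>j\<le>N. of_bool (i = 0 \<or> j = 0) * ?G i j) = ?G i 0" unfolding split[of "\<lambda>j. of_bool (i = 0 \<or> j = 0) * ?G i j"] by simp
    qed
    moreover have "(\<Sum>j\<le>N. of_bool (0 = (0::nat) \<or> j = 0) * ?G 0 j) = ?G 0 0 + (\<Sum>j=1..N. ?G 0 j)"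
      unfolding split[of "\<lambda>j. of_bool (0 = (0::nat) \<or> j = 0) * ?G 0 j"] by simp
    ultimately show ?thesis unfolding split[of "\<lambda>i. \<Sum>j\<le>N. of_bool (i = 0 \<or> j = 0) * ?G i j"] by simp
  qed
  also have "\<dots> = ?H 0 + (\<Sum>i=1..N. ?H i) + (\<Sum>i=1..N. ?H i)"
    by (simp add: two_cycle_sum_def fixed_point_sum_def mult.commute)
  also have "(\<Sum>i=1..N. ?H i) \<le> ?H 1 + (\<Sum>i=2..N. ?H i)"
  proof -
    have "(\<Sum>i=1..N. ?H i) \<le> (\<Sum>i\<in>insert 1 {2..N}. ?H i)"
      by (intro sum_mono2 mult_nonneg_nonneg two_cycle_sum_nonneg fixed_point_sum_nonneg) auto
    then show ?thesis by simp
  qed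
  also have "?H 1 \<le> (4467 / 10000 * square_total 2) * (7304 / 10000)"
    using square_total_lower(2)
    by (intro mult_mono two_cycle_sum_1 fixed_point_sum_values fixed_point_sum_nonneg) simp
  also have "(\<Sum>i=2..N. ?H i) \<le> (1 / 8 * square_total 2) * (5625 / 100000)"
  proof -
    have "(\<Sum>i=2..N. ?H i) \<le> (\<Sum>i=2..N. (1 / 8 * square_total 2) * fixed_point_sum N i)"
      by (intro sum_mono mult_right_mono two_cycle_sum_le fixed_point_sum_nonneg) auto
    also have "\<dots> = (1 / 8 * square_total 2) * (\<Sum>i=2..N. fixed_point_sum N i)" by (rule sum_distrib_left[symmetric])
    also have "\<dots> \<le> (1 / 8 * square_total 2) * (5625 / 100000)"
      using square_total_lower(2) by (intro mult_left_mono sum_fixed_point_sum) simp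
    finally show ?thesis .
  qed
  also have "?H 0 \<le> square_total 2 * (24581 / 10000)"
    using square_total_lower(2)
    by (intro mult_mono two_cycle_sum_0 fixed_point_sum_values fixed_point_sum_nonneg) simp
  \<comment> \<open>\<open>2.4581 + 2 * 0.4467 * 0.7304 + 2 * (1 / 8) * 0.05625 \<le> 3.1248\<close>\<close>
  finally have "partial_eval N 1 core_series \<le> 31248 / 10000 * square_total 2" 
    using square_total_lower(2) by simp
  also have "31248 / 10000 \<le> 1373 / 1000 * square_total 1" using square_total_lower(1) by simp
  finally show ?thesis using square_total_lower(2) by (simp add: mult_right_mono)
qed

section \<open>Comparison of the limits\<close>

lemma off_diagonal_series_tendsto: "(\<lambda>n. real n ^ 2 * fps_nth off_diagonal_series n) \<longlonglongrightarrow> 0"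
proof -
  obtain B where "\<And>k. k \<ge> 1 \<Longrightarrow> block_coeff k \<le> B / real k ^ 3" using block_coeff_cubic by blast
  then have "(\<lambda>n. real n ^ 2 * exp_coeff block_coeff n) \<longlonglongrightarrow> 0"
    by (rule exp_coeff_tendsto[OF block_coeff_nonneg])
  then show ?thesis by (simp add: off_diagonal_series_def)
qed

lemma exp_bound_116: "exp (116 / 1000 :: real) \<le> 11245 / 10000"
proof -
  \<comment> \<open>The quadratic estimate at \<open>0.116\<close> is too weak; it is used at \<open>0.0145 = 0.116 / 8\<close>.\<close>
  have "exp (145 / 10000 :: real) \<le> 1 + 145 / 10000 + (145 / 10000) ^ 2" by (rule exp_bound) auto
  then have "exp (145 / 10000 :: real) ^ 8 \<le> (1 + 145 / 10000 + (145 / 10000) ^ 2) ^ 8"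
    by (rule power_mono) simp
  also have "exp (145 / 10000 :: real) ^ 8 = exp (116 / 1000)" by (simp flip: exp_of_nat_mult)
  also have "(1 + 145 / 10000 + (145 / 10000) ^ 2) ^ 8 \<le> (11245 / 10000 :: real)" by (simp add: power_numeral_reduce)
  finally show ?thesis .
qed

text \<open>
  The coefficient sum of a convolution of nonnegative series is at most the product of the coefficient sums.
\<close>

lemma correction_total:
  "(\<Sum>n. fps_nth (core_series * off_diagonal_series) n) \<le> 1373 / 1000 * square_total 1 * square_total 2 * (11245 / 10000)"
proof (rule suminf_le_const)
  let ?F = "core_series * off_diagonal_series"
  have "(\<lambda>n. real n ^ 2 * fps_nth ?F n) \<longlonglongrightarrow> 0 * (\<Sum>n. fps_nth core_series n)"
    by (rule convolution_tendsto[OF core_series_tendsto off_diagonal_series_tendsto])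
  from bounded_coeff_of_tendsto[OF this] obtain C where "\<And>n. real n ^ 2 * \<bar>fps_nth ?F n\<bar> \<le> C" by blast
  then show "summable (fps_nth ?F)" by (rule summable_of_bounded_coeff)
  have nonneg: "nonneg_series off_diagonal_series"
    by (simp add: nonneg_series_def off_diagonal_series_def exp_coeff_nonneg block_coeff_nonneg)
  fix n
  have "(\<Sum>k<n. fps_nth ?F k) \<le> partial_eval n 1 ?F"
    unfolding partial_eval_def power_one mult_1_right
    by (intro sum_mono2 nonneg_seriesD nonneg_series_mult nonneg_core_series nonneg) auto
  also have "\<dots> \<le> partial_eval n 1 core_series * partial_eval n 1 off_diagonal_series"
    by (intro partial_eval_mult_le nonneg_core_series nonneg) simp
  also have "\<dots> \<le> (1373 / 1000 * square_total 1 * square_total 2) * (11245 / 10000)"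
  proof (intro mult_mono core_series_total partial_eval_nonneg nonneg)
    have "partial_eval n 1 off_diagonal_series = (\<Sum>k\<le>n. exp_coeff block_coeff k)"
      by (simp add: partial_eval_def off_diagonal_series_def)
    also have "\<dots> \<le> exp (\<Sum>k=1..n. block_coeff k)" by (rule sum_exp_coeff_le) (rule block_coeff_nonneg)
    also have "\<dots> \<le> exp (116 / 1000)" using sum_block_coeff[of n] by simp
    finally show "partial_eval n 1 off_diagonal_series \<le> 11245 / 10000" using exp_bound_116 by linarith
  qed (use square_total_lower in simp_all)
  finally show "(\<Sum>k<n. fps_nth ?F k) \<le> 1373 / 1000 * square_total 1 * square_total 2 * (11245 / 10000)" .
qed

theorem kappa_rho_eventually: "eventually (\<lambda>n. 42 / 65 * rho_bound n \<le> kappa n) sequentially"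
proof -
  let ?F = "core_series * off_diagonal_series"
  let ?D = "suminf diag" and ?S = "\<Sum>n. fps_nth ?F n"
  let ?I = "square_total 1 * square_total 2"
  have diag: "(\<lambda>n. real n ^ 2 * fps_nth diag_series n) \<longlonglongrightarrow> ?D"
    using diag_tendsto by (simp add: diag_series_def)
  have kappa: "(\<lambda>n. real n ^ 2 * fps_nth (square_series 1 * (square_series 2 * diag_series)) n)
      \<longlonglongrightarrow> ?D * square_total 2 * square_total 1"
    unfolding square_total_def by (intro convolution_tendsto summable_square_series diag) simp_all
  have rho: "(\<lambda>n. real n ^ 2 * fps_nth (?F * diag_series) n) \<longlonglongrightarrow> ?D * ?S"
  proof (rule convolution_tendsto[OF _ diag])
    show "(\<lambda>n. real n ^ 2 * fps_nth ?F n) \<longlonglongrightarrow> 0"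
      using convolution_tendsto[OF core_series_tendsto off_diagonal_series_tendsto] by simp
  qed
  have "(\<lambda>n. real n ^ 2 * fps_nth (square_series 1 * (square_series 2 * diag_series)) n
      - 42 / 65 * (real n ^ 2 * fps_nth (?F * diag_series) n))
    \<longlonglongrightarrow> ?D * square_total 2 * square_total 1 - 42 / 65 * (?D * ?S)"
    by (rule tendsto_diff[OF kappa tendsto_mult_left[OF rho]])
  moreover have "?D * square_total 2 * square_total 1 - 42 / 65 * (?D * ?S) > 0"
  proof -
    have "diag 0 = 1" by (simp add: diag_def diag_upto_def)
    then have "?D \<ge> 1" using sum_le_suminf[OF summable_diag, of "{0}"] diag_nonneg by simp
    moreover have "42 / 65 * ?S < ?I"
    proof -
      have "?I > 0" using square_total_lower by simp
      then show ?thesis using correction_total by (simp add: mult.assoc)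
    qed
    ultimately have "?D * (42 / 65 * ?S) < ?D * ?I" by simp
    then show ?thesis by (simp add: mult_ac)
  qed
  ultimately have "eventually (\<lambda>n. real n ^ 2 * fps_nth (square_series 1 * (square_series 2 * diag_series)) n
      - 42 / 65 * (real n ^ 2 * fps_nth (?F * diag_series) n) > 0) sequentially"
    by (rule order_tendstoD(1))
  then show ?thesis
    using eventually_ge_at_top[of 2]
  proof eventually_elim
    case (elim n)
    have "rho_bound n \<le> fps_nth (?F * diag_series) n" using rho_bound_le[OF elim(2)] by (simp add: mult.assoc)
    then have "real n ^ 2 * (42 / 65 * rho_bound n) \<le> real n ^ 2 * (42 / 65 * fps_nth (?F * diag_series) n)"
      by (intro mult_left_mono) auto
    also have "\<dots> \<le> real n ^ 2 * kappa n" using elim by (simp add: kappa_eq_diag)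
    finally show ?case using elim(2) by simp
  qed
qed

theorem corollary1p8:
  shows "\<exists>N::nat. \<forall>n\<ge>N.
    \<P>((\<sigma>, \<tau>) in measure_pmf (random_perm_pair n).
        conjugate_in (sym_group n) \<sigma> \<tau> \<bar> have_commuting_conjugates (sym_group n) \<sigma> \<tau>)
      \<ge> (42 / 65 :: real)"
proof -
  have "eventually (\<lambda>n. 42 / 65 * rho_bound n \<le> kappa n \<and> n \<ge> 2) sequentially"
    using kappa_rho_eventually eventually_ge_at_top[of 2] by (rule eventually_conj)
  then obtain N where N: "\<And>n. n \<ge> N \<Longrightarrow> 42 / 65 * rho_bound n \<le> kappa n \<and> n \<ge> 2"
    by (auto simp: eventually_sequentially)
  show ?thesis
  proof (intro exI[of _ N] allI impI)
    fix n assume "n \<ge> N"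
    from N[OF this] show "\<P>((\<sigma>, \<tau>) in measure_pmf (random_perm_pair n).
        conjugate_in (sym_group n) \<sigma> \<tau> \<bar> have_commuting_conjugates (sym_group n) \<sigma> \<tau>) \<ge> (42 / 65 :: real)"
      by (intro conditional_probability_ge) simp_all
  qed
qed

end
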